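(* Let $A\in\mathbb{R}^{d\times d}$ be a regular matrix, let $\mathbf{T}=A\mathbb{Z}^d$ be the corresponding $d$-periodic lattice of points in $\mathbb{R}^d$, with dual group $\mathbf{T}^*=A^{-1}\mathbb{Z}^d$, fundamental region $F_{\mathbf{T}}=A[0,1)^d$ and spatial intensity $\alpha=|\det A|^{-1}$. Let $D\subset\mathbb{R}^d$ be a bounded measurable set such that the finite right derivative $\overline{\gamma_D}'^{+}(0)$ of its isotropic covariogram $\overline{\gamma_D}$ at $0$ exists. Let $\Phi$ be a function on $\mathbb{R}^+$ defined by the equation $$\int_{\mathbf{SO}_d}\int_{F_{\mathbf{T}}}\Bigl(\mathbf{card}\bigl((rMD+x)\cap\mathbf{T}\bigr)-\alpha\lambda^d(rD)\Bigr)^2\alpha\,d\lambda^d(x)\,dM=\frac{-\overline{\gamma_D}'^{+}(0)}{2\pi^2\kappa_{d-1}}\Bigl(\sum_{0\ne\xi\in\mathbf{T}^*}|\xi|^{-d-1}\Bigr)\Phi(r)\,r^{d-1},\qquad r\in\mathbb{R}^+.$$ Further, let $\rho^{d+1}\,\widehat{\overline{\gamma_D}}(\rho)$ be bounded measurable on $\mathbb{R}^+$. Then $\Phi$ is bounded and $$\lim_{t\to\infty}\frac1t\int_0^t\Phi(s)\,ds=1.$$ If moreover $\lim_{\rho\to\infty}\rho^{d+1}\,\widehat{\overline{\gamma_D}}(\rho)$ exists, then $$\lim_{t\to\infty}\Phi(t)=1.$$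
   Context: $\lambda^d$ is Lebesgue measure on $\mathbb{R}^d$, $\mathbf{card}$ is the number of elements, $I_D$ is the characteristic function of $D$, and $\kappa_k=\pi^{k/2}\Gamma(\frac k2+1)^{-1}$ is the volume of the unit ball in $\mathbb{R}^k$. $\mathbb{R}^+$ is the positive half-line. $\mathbf{SO}_d$ is the group of rotations of $\mathbb{R}^d$ and $dM$ denotes integration with respect to its invariant probability measure; $MD$ is the set $D$ rotated by $M$, and $rMD$ is $MD$ dilated by the factor $r$. The Fourier transform of $f\in\mathbf{L}^1(\mathbb{R}^d)$ is $\widehat f(\xi)=\int_{\mathbb{R}^d}f(x)\exp(-2\pi i x\cdot\xi)\,dx$. The covariogram of a bounded measurable set $D$ is $\gamma_D(x)=(I_D\star I_{-D})(x)=\int_{\mathbb{R}^d}I_D(y)I_D(y-x)\,dy$. The isotropic covariogram is the function on $[0,\infty)$ given by $\overline{\gamma_D}(|x|)=\int_{\mathbf{SO}_d}\gamma_{MD}(x)\,dM$; equivalently, $\overline{\gamma_D}(u)$ is the average of $\gamma_D(ux)$ over $x$ in the unit sphere $S_{d-1}$. $\widehat{\overline{\gamma_D}}(\rho)$ denotes the value at any $\xi$ with $|\xi|=\rho$ of the Fourier transform of the radial function $x\mapsto\overline{\gamma_D}(|x|)$ on $\mathbb{R}^d$, i.e. $\widehat{\overline{\gamma_D}}(\rho)=2\pi\rho^{1-\frac d2}\int_0^\infty r^{\frac d2}J_{\frac d2-1}(2\pi\rho r)\,\overline{\gamma_D}(r)\,dr$, where $J_\nu$ is the Bessel function of the fi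rst kind.
   Formalization: The right-hand side of the equation defining Φ gets the missing factor α² (as printed, false unless |det A|=1); the dual group is A^{-T}Z^d (A^{-1} acting on row vectors); Φ(r) must be the unique solution of the equation, which excludes null sets D. *)

theory Defs
  imports "HOL-Probability.Probability"
begin

definition int_vectors :: "(real^'n) set" where
  "int_vectors = {z. \<forall>i. z $ i \<in> \<int>}"

definition lattice_of :: "real^'n^'n \<Rightarrow> (real^'n) set" where
  "lattice_of A = (\<lambda>z. A *v z) ` int_vectors"

text \<open>In the dual lattice the inverse matrix acts on row vectors. With column vectors the
  matrix is the transposed inverse; the untransposed inverse would in general not give the
  dual group, which is characterised in the lemma below.\<close>

definition dual_lattice_of :: "real^'n^'n \<Rightarrow> (real^'n) set" where
  "dual_lattice_of A = (\<lambda>z. z v* matrix_inv A) ` int_vectors"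

lemma dual_lattice_of_eq_dual_group:
  fixes A :: "real^'n^'n"
  assumes "invertible A"
  shows "dual_lattice_of A = {\<xi>. \<forall>x\<in>lattice_of A. \<xi> \<bullet> x \<in> \<int>}"
proof -
  have inv: "A ** matrix_inv A = mat 1 \<and> matrix_inv A ** A = mat 1"
    using assms unfolding invertible_def matrix_inv_def by (rule someI_ex)
  show ?thesis
  proof (intro set_eqI iffI)
    fix \<xi> assume "\<xi> \<in> dual_lattice_of A"
    then obtain z where z: "z \<in> int_vectors" and \<xi>: "\<xi> = z v* matrix_inv A"
      by (auto simp: dual_lattice_of_def)
    have "\<xi> \<bullet> (A *v w) = z \<bullet> w" for w
      by (simp add: \<xi> dot_lmul_matrix matrix_vector_mul_assoc inv)
    then show "\<xi> \<in> {\<xi>. \<forall>x\<in>lattice_of A. \<xi> \<bullet> x \<in> \<int>}"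
      using z by (auto simp: lattice_of_def int_vectors_def inner_vec_def intro!: Ints_sum)
  next
    fix \<xi> assume \<xi>: "\<xi> \<in> {\<xi>. \<forall>x\<in>lattice_of A. \<xi> \<bullet> x \<in> \<int>}"
    have "(\<xi> v* A) $ i \<in> \<int>" for i
    proof -
      have "axis i 1 \<in> int_vectors"
        by (auto simp: int_vectors_def axis_def)
      then have "\<xi> \<bullet> (A *v axis i 1) \<in> \<int>"
        using \<xi> by (auto simp: lattice_of_def)
      then show ?thesis
        by (simp add: dot_lmul_matrix[symmetric] inner_axis)
    qed
    then have "\<xi> v* A \<in> int_vectors"
      by (simp add: int_vectors_def)
    moreover have "\<xi> = (\<xi> v* A) v* matrix_inv A"
      by (simp add: vector_matrix_mul_assoc inv)
    ultimately show "\<xi> \<in> dual_lattice_of A"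
      by (auto simp: dual_lattice_of_def)
  qed
qed

definition fundamental_region :: "real^'n^'n \<Rightarrow> (real^'n) set" where
  "fundamental_region A = (\<lambda>z. A *v z) ` {z. \<forall>i. 0 \<le> z $ i \<and> z $ i < 1}"

definition spatial_intensity :: "real^'n^'n \<Rightarrow> real" where
  "spatial_intensity A = inverse \<bar>det A\<bar>"

definition SO :: "(real^'n^'n) set" where
  "SO = {M. rotation_matrix M}"

text \<open>As the rotation group is compact, this left-invariant probability measure exists,
  is unique, and is also right-invariant.\<close>

definition is_haar_prob_SO :: "(real^'n^'n) measure \<Rightarrow> bool" where
  "is_haar_prob_SO \<mu> \<longleftrightarrow>
     prob_space \<mu> \<and> sets \<mu> = sets (restrict_space borel SO) \<and>
     (\<forall>N\<in>SO. distr \<mu> \<mu> (\<lambda>M. N ** M) = \<mu>)"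

definition fourier :: "('a::euclidean_space \<Rightarrow> complex) \<Rightarrow> 'a \<Rightarrow> complex" where
  "fourier f \<xi> = (LINT x|lebesgue. f x * exp (- 2 * of_real pi * \<i> * of_real (x \<bullet> \<xi>)))"

definition covariogram :: "'a::euclidean_space set \<Rightarrow> 'a \<Rightarrow> real" where
  "covariogram D x = (LINT y|lebesgue. indicator D y * indicator D (y - x))"

text \<open>The average over rotations only depends on the norm of the argument, so it is
  evaluated at an arbitrary vector of norm \<open>u\<close>; only \<open>u \<ge> 0\<close> is meaningful.\<close>

definition iso_covariogram :: "(real^'n^'n) measure \<Rightarrow> (real^'n) set \<Rightarrow> real \<Rightarrow> real" where
  "iso_covariogram \<mu> D u =
     (LINT M|\<mu>. covariogram ((\<lambda>y. M *v y) ` D) (SOME x. norm x = u))"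

text \<open>Likewise the Fourier transform of the radial function \<open>x \<mapsto> iso_covariogram \<mu> D (norm x)\<close>
  is radial and is evaluated at an arbitrary frequency of norm \<open>\<rho> \<ge> 0\<close>.\<close>

definition iso_covariogram_ft :: "(real^'n^'n) measure \<Rightarrow> (real^'n) set \<Rightarrow> real \<Rightarrow> complex" where
  "iso_covariogram_ft \<mu> D \<rho> =
     fourier (\<lambda>x::real^'n. of_real (iso_covariogram \<mu> D (norm x))) (SOME \<xi>. norm \<xi> = \<rho>)"

end

theory Submission
  imports Defs
begin

text \<open>By Parseval's identity on the fundamental region and averaging over rotations, \<open>\<Phi> r\<close> is, up to
  normalisation, the weighted mean of the dilates \<open>G (r * norm \<xi>)\<close> over the dual lattice, with
  weights \<open>norm \<xi> powr (- d - 1)\<close> and \<open>G \<rho> = \<rho> ^ (d + 1) * h \<rho>\<close>, where \<open>h\<close> is the Fourier transform of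
  the isotropic covariogram. As \<open>G\<close> is bounded, dominated convergence reduces everything to the
  statement that the Cesaro means of \<open>G\<close> tend to \<open>- \<gamma>' / (2 * pi\<^sup>2 * \<kappa>)\<close> with \<open>\<kappa>\<close> the volume of the unit
  ball in dimension \<open>d - 1\<close>. Testing the covariogram against
  differences of two Gaussians of nearby width turns its right derivative at 0 into the limit of
  the means of \<open>G\<close> with respect to certain kernels, and a Tauberian argument in the style of
  Karamata (Weierstrass approximation in the variable \<open>exp (- pi * s\<^sup>2)\<close>) replaces these kernels by
  the indicator of \<open>(0, 1]\<close>.\<close>

section \<open>Linear substitutions in Lebesgue integrals\<close>

text \<open>The derivative is known at the single point 0 on the side of the covariogram, whereas a
  mean over an interval is a sharp cutoff on the side of its transform, so a smooth family of
  cutoffs has to mediate. One Gaussian is not enough: polar coordinates supply only the power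
  \<open>d - 1\<close>, so passing to \<open>G\<close> costs a factor \<open>1 / s^2\<close>, which
  is not integrable at 0, and the value of the covariogram at 0 would hide its slope. The difference
  of two Gaussians cures both defects at once. In Karamata's theorem positivity allows one-sided
  approximation of the indicator; here the bound on \<open>G\<close> permits approximation in L^1
  instead. A dilation by a fixed positive factor does not change a limit at infinity, which is why
  every dual lattice vector contributes the same mean and the lattice enters only through its total
  weight. Transforms, rotations and product measures are handled for Borel sets; a Lebesgue
  measurable set is reduced to a Borel subset of full measure.\<close>

lemma integrable_scaleR_cancel:
  fixes f :: "'a \<Rightarrow> 'b::{banach, second_countable_topology}"
  assumes "integrable M (\<lambda>x. c *\<^sub>R f x)" "c \<noteq> 0"
  shows "integrable M f"
  using integrable_scaleR_right[of "1 / c" M "\<lambda>x. c *\<^sub>R f x"] assms by simp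

lemma integrable_scaleR_iff:
  fixes f :: "'a \<Rightarrow> 'b::{banach, second_countable_topology}"
  assumes "c \<noteq> 0"
  shows "integrable M (\<lambda>x. c *\<^sub>R f x) \<longleftrightarrow> integrable M f"
  using integrable_scaleR_cancel[of M c f] integrable_scaleR_right[of c M f] assms by blast

lemma invertible_inverse_mult:
  fixes A :: "real^'n^'n"
  assumes "invertible A"
  shows "A ** matrix_inv A = mat 1" "matrix_inv A ** A = mat 1"
proof -
  have "A ** matrix_inv A = mat 1 \<and> matrix_inv A ** A = mat 1"
    using assms unfolding invertible_def matrix_inv_def by (rule someI_ex)
  then show "A ** matrix_inv A = mat 1" "matrix_inv A ** A = mat 1" by auto
qed

lemma borel_measurable_matrix_vector_mult [measurable]:
  fixes A :: "real^'n^'m"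
  shows "(*v) A \<in> borel_measurable borel"
  by (intro borel_measurable_continuous_onI matrix_vector_mult_linear_continuous_on)

text \<open>Fubini isolates coordinate \<open>m\<close>. With the other coordinates fixed,
  coordinate \<open>n\<close> is a constant, so the shear is a translation in the inner
  integral.\<close>

lemma nn_integral_lborel_shear:
  fixes m n :: "'n::finite" and g :: "real^'n \<Rightarrow> ennreal"
  assumes mn: "m \<noteq> n" and [measurable]: "g \<in> borel_measurable borel"
  shows "(\<integral>\<^sup>+x. g (\<chi> i. if i = m then x$m + x$n else x$i) \<partial>lborel) = (\<integral>\<^sup>+x. g x \<partial>lborel)"
proof -
  interpret product_sigma_finite "\<lambda>_::real^'n. lborel :: real measure" ..
  let ?e = "axis m 1 :: real^'n" and ?f = "axis n 1 :: real^'n"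
  let ?B = "Basis - {?e}"
  let ?h = "\<lambda>x::real^'n. \<chi> i. if i = m then x$m + x$n else x$i"
  let ?S = "\<lambda>p::real^'n \<Rightarrow> real. \<Sum>b\<in>Basis. p b *\<^sub>R b"
  have hx: "?h x = x + (x $ n) *\<^sub>R ?e" for x
    by (auto simp: vec_eq_iff axis_def)
  have eB: "?e \<in> Basis" and fB: "?f \<in> ?B" using mn by (auto simp: axis_eq_axis)
  have B: "Basis = insert ?e ?B" using eB by auto
  have [measurable]: "?h \<in> borel_measurable borel"
    unfolding hx by (intro borel_measurable_continuous_onI continuous_intros)
  have S: "?S (p(?e := y)) = (\<Sum>b\<in>?B. p b *\<^sub>R b) + y *\<^sub>R ?e" for p y
    by (subst sum.remove[OF finite_Basis eB]) (simp add: add.commute)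
  have Sn: "?S p $ n = p ?f" for p
  proof -
    have "?S p $ n = ?S p \<bullet> ?f" by (simp add: inner_axis)
    also have "\<dots> = p ?f" using fB by (intro inner_sum_left_Basis) auto
    finally show ?thesis .
  qed
  have hS: "?h (?S (p(?e := y))) = (\<Sum>b\<in>?B. p b *\<^sub>R b) + (p ?f + y) *\<^sub>R ?e" for p y
  proof -
    have q: "?S (p(?e := y)) $ n = p ?f" unfolding Sn using fB by auto
    show ?thesis by (subst hx, subst q, simp only: S, simp add: algebra_simps)
  qed
  have gen: "(\<integral>\<^sup>+x. k x \<partial>lborel) = (\<integral>\<^sup>+p. (\<integral>\<^sup>+y. k (?S (p(?e := y))) \<partial>lborel) \<partial>(\<Pi>\<^sub>M b\<in>?B. lborel))"
    if [measurable]: "k \<in> borel_measurable borel" for k :: "real^'n \<Rightarrow> ennreal"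
  proof -
    have "(\<integral>\<^sup>+x. k x \<partial>lborel) = (\<integral>\<^sup>+p. k (?S p) \<partial>(\<Pi>\<^sub>M b\<in>Basis. lborel))"
      by (subst lborel_eq) (simp add: nn_integral_distr)
    also have "\<dots> = (\<integral>\<^sup>+p. k (?S p) \<partial>(\<Pi>\<^sub>M b\<in>insert ?e ?B. lborel))"
      using B by simp
    also have "\<dots> = (\<integral>\<^sup>+p. (\<integral>\<^sup>+y. k (?S (p(?e := y))) \<partial>lborel) \<partial>(\<Pi>\<^sub>M b\<in>?B. lborel))"
      by (rule product_nn_integral_insert) (auto simp: B[symmetric])
    finally show ?thesis .
  qed
  have "(\<integral>\<^sup>+x. g (?h x) \<partial>lborel)
      = (\<integral>\<^sup>+p. (\<integral>\<^sup>+y. g ((\<Sum>b\<in>?B. p b *\<^sub>R b) + (p ?f + y) *\<^sub>R ?e) \<partial>lborel) \<partial>(\<Pi>\<^sub>M b\<in>?B. lborel))"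
    by (subst gen, measurable) (simp only: hS)
  also have "\<dots> = (\<integral>\<^sup>+p. (\<integral>\<^sup>+y. g ((\<Sum>b\<in>?B. p b *\<^sub>R b) + y *\<^sub>R ?e) \<partial>lborel) \<partial>(\<Pi>\<^sub>M b\<in>?B. lborel))"
  proof (rule nn_integral_cong)
    fix p
    show "(\<integral>\<^sup>+y. g ((\<Sum>b\<in>?B. p b *\<^sub>R b) + (p ?f + y) *\<^sub>R ?e) \<partial>lborel)
      = (\<integral>\<^sup>+y. g ((\<Sum>b\<in>?B. p b *\<^sub>R b) + y *\<^sub>R ?e) \<partial>lborel)"
      by (subst lborel_distr_plus[of "p ?f", symmetric]) (subst nn_integral_distr, auto)
  qed
  also have "\<dots> = (\<integral>\<^sup>+x. g x \<partial>lborel)"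
    by (subst gen, measurable) (simp only: S)
  finally show ?thesis .
qed

lemma nn_integral_lborel_stretch:
  fixes c :: "'n::finite \<Rightarrow> real" and g :: "real^'n \<Rightarrow> ennreal"
  assumes c: "\<And>i. c i \<noteq> 0" and [measurable]: "g \<in> borel_measurable borel"
  shows "(\<integral>\<^sup>+x. g x \<partial>lborel) = ennreal (\<Prod>i\<in>UNIV. \<bar>c i\<bar>) * (\<integral>\<^sup>+x. g (\<chi> i. c i * x$i) \<partial>lborel)"
proof -
  \<comment> \<open>The affine formula for \<open>lborel\<close> takes its factors indexed by basis
    vectors, so \<open>c\<close> is transported along the bijection between indices and
    \<open>axis i 1\<close>.\<close>
  define c' where "c' b = c (SOME i. b = axis i (1::real))" for b :: "real^'n"
  have c'[simp]: "c' (axis i 1) = c i" for i by (simp add: c'_def axis_eq_axis)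
  have Bas: "(Basis :: (real^'n) set) = (\<lambda>i. axis i 1) ` UNIV" by (auto simp: Basis_vec_def)
  have inj: "inj (\<lambda>i. axis i (1::real) :: real^'n)" by (auto simp: inj_on_def axis_eq_axis)
  have eq: "0 + (\<Sum>j\<in>Basis. (c' j * (x \<bullet> j)) *\<^sub>R j) = (\<chi> i. c i * x$i)" for x :: "real^'n"
    unfolding Bas sum.reindex[OF inj]
    by (simp add: vec_eq_iff inner_axis) (simp add: axis_def if_distrib cong: if_cong)
  have pr: "(\<Prod>j\<in>Basis. \<bar>c' j\<bar>) = (\<Prod>i\<in>UNIV. \<bar>c i\<bar>)"
    unfolding Bas prod.reindex[OF inj] by simp
  have [measurable]: "(\<lambda>x::real^'n. \<chi> i. c i * x$i) \<in> borel_measurable borel"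
    by (intro borel_measurable_continuous_onI continuous_intros)
  have "lborel = density (distr lborel borel (\<lambda>x::real^'n. \<chi> i. c i * x$i)) (\<lambda>x. ennreal (\<Prod>i\<in>UNIV. \<bar>c i\<bar>))"
    unfolding eq[symmetric] pr[symmetric] by (rule lborel_affine_euclidean) (auto simp: Bas c)
  then have "(\<integral>\<^sup>+x. g x \<partial>lborel) = (\<integral>\<^sup>+x. g x \<partial>density (distr lborel borel (\<lambda>x::real^'n. \<chi> i. c i * x$i)) (\<lambda>x. ennreal (\<Prod>i\<in>UNIV. \<bar>c i\<bar>)))"
    by simp
  then show ?thesis by (simp add: nn_integral_density nn_integral_distr nn_integral_cmult)
qed

text \<open>Lebesgue measure is determined by its values on boxes, and exchanging two coordinates
  only permutes the side lengths in the product.\<close>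

lemma nn_integral_lborel_swap:
  fixes m n :: "'n::finite" and g :: "real^'n \<Rightarrow> ennreal"
  assumes [measurable]: "g \<in> borel_measurable borel"
  shows "(\<integral>\<^sup>+x. g (\<chi> i. x $ Transposition.transpose m n i) \<partial>lborel) = (\<integral>\<^sup>+x. g x \<partial>lborel)"
proof -
  let ?t = "Transposition.transpose m n"
  let ?h = "\<lambda>x::real^'n. \<chi> i. x $ ?t i"
  have [measurable]: "?h \<in> borel_measurable borel"
    by (intro borel_measurable_continuous_onI continuous_intros)
  have Bas: "(Basis :: (real^'n) set) = (\<lambda>i. axis i 1) ` UNIV" by (auto simp: Basis_vec_def)
  have inj: "inj (\<lambda>i. axis i (1::real) :: real^'n)" by (auto simp: inj_on_def axis_eq_axis)
  have pr: "prod ((\<bullet>) x) Basis = (\<Prod>i\<in>UNIV. x $ i)" for x :: "real^'n"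
    unfolding Bas prod.reindex[OF inj] by (simp add: inner_axis)
  have "lborel = distr lborel borel ?h"
  proof (rule lborel_eqI)
    fix l u :: "real^'n" assume lu: "\<And>b. b \<in> Basis \<Longrightarrow> l \<bullet> b \<le> u \<bullet> b"
    then have lu': "l $ i \<le> u $ i" for i
      using lu[of "axis i 1"] by (simp add: Bas inner_axis)
    have "?h -` box l u = box (?h l) (?h u)"
      by (auto simp: mem_box_cart) (metis transpose_involutory)+
    then have "emeasure (distr lborel borel ?h) (box l u) = emeasure lborel (box (?h l) (?h u))"
      by (simp add: emeasure_distr)
    also have "\<dots> = ennreal (prod ((\<bullet>) (?h u - ?h l)) Basis)"
      using lu' by (subst emeasure_lborel_box_eq) (auto simp: Bas inner_axis)
    also have "prod ((\<bullet>) (?h u - ?h l)) Basis = (\<Prod>i\<in>UNIV. (u - l) $ ?t i)"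
      by (simp add: pr)
    also have "\<dots> = prod ((\<bullet>) (u - l)) Basis"
      unfolding pr by (rule prod.reindex_bij_betw) (rule permutes_bij[OF permutes_swap_id[OF UNIV_I UNIV_I]])
    finally show "emeasure (distr lborel borel ?h) (box l u) = ennreal (prod ((\<bullet>) (u - l)) Basis)" .
  qed simp
  then have "(\<integral>\<^sup>+x. g x \<partial>lborel) = (\<integral>\<^sup>+x. g x \<partial>distr lborel borel ?h)" by simp
  then show ?thesis by (simp add: nn_integral_distr)
qed

text \<open>The change of variables theorems of the library assume a well-ordered index type.\<close>

lemma nn_integral_lborel_linear:
  fixes f :: "real^'n \<Rightarrow> real^'n"
  assumes "linear f" "det (matrix f) \<noteq> 0" "g \<in> borel_measurable borel"
  shows "(\<integral>\<^sup>+x. g x \<partial>lborel) = ennreal \<bar>det (matrix f)\<bar> * (\<integral>\<^sup>+x. g (f x) \<partial>lborel)"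
  using assms(2,3)
proof (induction arbitrary: g rule: induct_linear_elementary[OF assms(1)])
  case (1 f h)
  have [measurable]: "g \<in> borel_measurable borel" by fact
  have [measurable]: "f \<in> borel_measurable borel"
    using 1(1) by (intro borel_measurable_continuous_onI linear_continuous_on linear_conv_bounded_linear[THEN iffD1])
  have d: "det (matrix (f \<circ> h)) = det (matrix f) * det (matrix h)"
    using 1(1,2) by (simp add: matrix_compose det_mul)
  then have nz: "det (matrix f) \<noteq> 0" "det (matrix h) \<noteq> 0" using 1(5) by (metis mult_zero_left, metis mult_zero_right)
  have "(\<integral>\<^sup>+x. g x \<partial>lborel) = ennreal \<bar>det (matrix f)\<bar> * (\<integral>\<^sup>+x. g (f x) \<partial>lborel)"
    by (rule 1(3)[OF nz(1)]) simp
  also have "(\<integral>\<^sup>+x. g (f x) \<partial>lborel) = ennreal \<bar>det (matrix h)\<bar> * (\<integral>\<^sup>+x. g (f (h x)) \<partial>lborel)"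
    by (rule 1(4)[OF nz(2)]) simp
  finally show ?case unfolding d by (simp add: abs_mult ennreal_mult mult.assoc)
next
  case (2 f i)
  \<comment> \<open>A map with a vanishing component is not onto, hence singular, which the
    condition on the determinant excludes.\<close>
  have "\<not> surj f"
    using 2(2) by (metis one_neq_zero surjE vec_component)
  then have "det (matrix f) = 0"
    using det_nz_iff_inj[OF 2(1)] linear_injective_imp_surjective[OF 2(1)] by blast
  then show ?case using 2 by simp
next
  case (3 c)
  have d: "det (matrix (\<lambda>x. \<chi> i. c i * x $ i)) = (\<Prod>i\<in>UNIV. c i)"
    by (subst det_diagonal) (auto simp: matrix_def axis_def)
  then have "c i \<noteq> 0" for i using 3 by auto
  then show ?case using 3(2) unfolding d abs_prod by (rule nn_integral_lborel_stretch)
next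
  case (4 m n)
  let ?h = "\<lambda>x::real^'n. \<chi> i. x $ Transposition.transpose m n i"
  have "matrix ?h = (\<chi> i. (mat 1 :: real^'n^'n) $ Transposition.transpose m n i)"
    by (auto simp: matrix_def vec_eq_iff mat_def axis_def)
  \<comment> \<open>The sign of the determinant depends on whether \<open>m = n\<close>; its
    absolute value does not.\<close>
  then have "\<bar>det (matrix ?h)\<bar> = 1"
    using det_permute_rows[of "Transposition.transpose m n" "mat 1 :: real^'n^'n"]
    by (simp add: permutes_swap_id sign_swap_id abs_mult)
  then show ?case using nn_integral_lborel_swap[OF 4(3)] by simp
next
  case (5 m n)
  let ?h = "\<lambda>x::real^'n. \<chi> i. if i = m then x$m + x$n else x$i"
  have "matrix ?h = (\<chi> k. if k = m then row m (mat 1) + 1 *s row n (mat 1) else row k (mat 1))"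
    by (auto simp: matrix_def vec_eq_iff mat_def axis_def row_def)
  then have "det (matrix ?h) = 1"
    using det_row_operation[OF 5(1), of "mat 1" 1] by simp
  then show ?case using nn_integral_lborel_shear[OF 5(1) 5(3)] by simp
qed

lemma lborel_matrix:
  fixes A :: "real^'n^'n"
  assumes "invertible A"
  shows "lborel = density (distr lborel borel ((*v) A)) (\<lambda>_. ennreal \<bar>det A\<bar>)"
proof (rule measure_eqI)
  fix S :: "(real^'n) set" assume "S \<in> sets lborel"
  then have [measurable]: "S \<in> sets borel" by simp
  have "emeasure lborel S = (\<integral>\<^sup>+x. indicator S x \<partial>lborel)" by simp
  also have "\<dots> = ennreal \<bar>det A\<bar> * (\<integral>\<^sup>+x. indicator S (A *v x) \<partial>lborel)"
    using assms nn_integral_lborel_linear[of "(*v) A" "indicator S"] by (simp add: invertible_det_nz)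
  also have "\<dots> = emeasure (density (distr lborel borel ((*v) A)) (\<lambda>_. ennreal \<bar>det A\<bar>)) S"
    by (simp add: emeasure_density nn_integral_cmult nn_integral_distr del: nn_integral_indicator)
  finally show "emeasure lborel S = emeasure (density (distr lborel borel ((*v) A)) (\<lambda>_. ennreal \<bar>det A\<bar>)) S" .
qed simp

lemma integral_lborel_matrix:
  fixes A :: "real^'n^'n" and f :: "real^'n \<Rightarrow> 'b::{banach, second_countable_topology}"
  assumes "invertible A" and [measurable]: "f \<in> borel_measurable borel"
  shows "integral\<^sup>L lborel f = \<bar>det A\<bar> *\<^sub>R (LINT x|lborel. f (A *v x))"
  by (subst lborel_matrix[OF assms(1)])
     (simp add: integral_density integral_distr)

lemma integrable_lborel_matrix:
  fixes A :: "real^'n^'n" and f :: "real^'n \<Rightarrow> 'b::{banach, second_countable_topology}"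
  assumes "invertible A" and f: "integrable lborel f"
  shows "integrable lborel (\<lambda>x. f (A *v x))"
proof -
  have [measurable]: "f \<in> borel_measurable borel" using borel_measurable_integrable[OF f] by simp
  have d: "det A \<noteq> 0" using assms(1) invertible_det_nz by blast
  have "integrable (density (distr lborel borel ((*v) A)) (\<lambda>_. ennreal \<bar>det A\<bar>)) f"
    using f lborel_matrix[OF assms(1)] by simp
  then show ?thesis using d
    by (subst (asm) integrable_density)
       (auto simp: integrable_distr_eq dest: integrable_scaleR_cancel)
qed

lemma integral_lborel_scaleR:
  fixes f :: "'a::euclidean_space \<Rightarrow> 'b::{banach, second_countable_topology}"
  assumes "c \<noteq> 0" and [measurable]: "f \<in> borel_measurable borel"
  shows "integral\<^sup>L lborel f = \<bar>c\<bar> ^ DIM('a) *\<^sub>R (LINT x|lborel. f (c *\<^sub>R x))"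
  by (subst lborel_affine[OF assms(1), of 0]) (simp add: integral_density integral_distr)

lemma integrable_lborel_scaleR:
  fixes f :: "'a::euclidean_space \<Rightarrow> 'b::{banach, second_countable_topology}"
  assumes "c \<noteq> 0" and f: "integrable lborel f"
  shows "integrable lborel (\<lambda>x. f (c *\<^sub>R x))"
proof -
  have [measurable]: "f \<in> borel_measurable borel" using borel_measurable_integrable[OF f] by simp
  have "integrable (density (distr lborel borel (\<lambda>x. 0 + c *\<^sub>R x)) (\<lambda>_. ennreal (\<bar>c\<bar> ^ DIM('a)))) f"
    using f by (subst lborel_affine[OF assms(1), of 0, symmetric])
  then show ?thesis using assms(1)
    by (subst (asm) integrable_density)
       (auto simp: integrable_distr_eq dest: integrable_scaleR_cancel)
qed

lemma integral_lborel_translate: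
  fixes f :: "'a::euclidean_space \<Rightarrow> 'b::{banach, second_countable_topology}"
  assumes [measurable]: "f \<in> borel_measurable borel"
  shows "integral\<^sup>L lborel f = (LINT x|lborel. f (t + x))"
  by (subst lborel_distr_plus[of t, symmetric]) (simp add: integral_distr)

lemma integrable_lborel_translate:
  fixes f :: "'a::euclidean_space \<Rightarrow> 'b::{banach, second_countable_topology}"
  assumes f: "integrable lborel f"
  shows "integrable lborel (\<lambda>x. f (t + x))"
proof -
  have [measurable]: "f \<in> borel_measurable borel" using borel_measurable_integrable[OF f] by simp
  have "integrable (distr lborel borel ((+) t)) f"
    using f by (simp add: lborel_distr_plus)
  then show ?thesis 
    by (auto simp: integrable_distr_eq)
qed

section \<open>Gaussians and radial functions\<close>

abbreviation phase :: "'a::real_inner \<Rightarrow> 'a \<Rightarrow> complex" where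
  "phase x \<xi> \<equiv> cis (- (2 * pi * (x \<bullet> \<xi>)))"

abbreviation gauss :: "'a::real_normed_vector \<Rightarrow> real" where
  "gauss x \<equiv> exp (- (pi * (norm x)\<^sup>2))"

lemma borel_measurable_cis [measurable]: "cis \<in> borel_measurable borel"
  unfolding cis_conv_exp by (intro borel_measurable_continuous_onI continuous_intros)

text \<open>The Gaussian is a standard normal density in the variable
  \<open>sqrt (2 * pi) * x\<close>, so its transform is the normal characteristic function evaluated
  at \<open>t / sqrt (2 * pi)\<close>.\<close>

lemma gaussian_fourier_real:
  fixes t :: real
  shows "integrable lborel (\<lambda>x::real. of_real (exp (- (pi * x\<^sup>2))) * cis (t * x))"
    and "(LINT x|lborel. of_real (exp (- (pi * x\<^sup>2))) * cis (t * x)) = of_real (exp (- (t\<^sup>2 / (4 * pi))))"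
proof -
  let ?c = "sqrt (2 * pi)"
  let ?s = "t / ?c"
  have c: "?c > 0" "?c\<^sup>2 = 2 * pi" by auto
  have "integrable std_normal_distribution (\<lambda>x. iexp (?s * x))"
    by (rule prob_space.integrable_iexp) (auto intro: real_dist_normal_dist real_distribution.axioms(1))
  then have i: "integrable lborel (\<lambda>x. std_normal_density x *\<^sub>R iexp (?s * x))"
    by (subst (asm) integrable_density) auto
  have e: "std_normal_density (0 + ?c * x) *\<^sub>R iexp (?s * (0 + ?c * x)) = (1 / ?c) *\<^sub>R (of_real (exp (- (pi * x\<^sup>2))) * cis (t * x))" for x
  proof -
    have "(?c * x)\<^sup>2 = 2 * (pi * x\<^sup>2)" by (simp add: power_mult_distrib)
    then show ?thesis by (simp add: std_normal_density_def cis_conv_exp scaleR_conv_of_real)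
  qed
  have "integrable lborel (\<lambda>x. std_normal_density (0 + ?c * x) *\<^sub>R iexp (?s * (0 + ?c * x)))"
    using c by (intro lborel_integrable_real_affine[OF i]) auto
  then have "integrable lborel (\<lambda>x. (1 / ?c) *\<^sub>R (of_real (exp (- (pi * x\<^sup>2))) * cis (t * x)))"
    unfolding e .
  then show "integrable lborel (\<lambda>x::real. of_real (exp (- (pi * x\<^sup>2))) * cis (t * x))"
    by (rule integrable_scaleR_cancel) (use c in auto)
  have "of_real (exp (- (?s\<^sup>2 / 2))) = (LINT x|lborel. std_normal_density x *\<^sub>R iexp (?s * x))"
    using fun_cong[OF char_std_normal_distribution, of ?s]
    by (simp add: char_def integral_density)
  also have "\<dots> = \<bar>?c\<bar> *\<^sub>R (LINT x|lborel. std_normal_density (0 + ?c * x) *\<^sub>R iexp (?s * (0 + ?c * x)))"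
    using c by (intro lborel_integral_real_affine) auto
  also have "\<dots> = (LINT x|lborel. of_real (exp (- (pi * x\<^sup>2))) * cis (t * x))"
    unfolding e integral_scaleR_right using c by simp
  finally show "(LINT x|lborel. of_real (exp (- (pi * x\<^sup>2))) * cis (t * x)) = of_real (exp (- (t\<^sup>2 / (4 * pi))))"
    by (simp add: power_divide)
qed

text \<open>The integrand is a product over the coordinates, which reduces everything to dimension
  one. With \<open>pi\<close> in the exponent the Gaussian is its own transform and has mass 1, so
  duality introduces no constants.\<close>

lemma gaussian_fourier:
  fixes \<xi> :: "'a::euclidean_space"
  shows "integrable lborel (\<lambda>x::'a. of_real (gauss x) * phase x \<xi>)" (is ?A)
    and "(LINT x|lborel. of_real (gauss x) * phase x \<xi>) = of_real (gauss \<xi>)" (is ?B)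
proof -
  interpret product_sigma_finite "\<lambda>_::'a. lborel :: real measure" ..
  define f where "f b x = complex_of_real (exp (- (pi * x\<^sup>2))) * cis (- (2 * pi * (b \<bullet> \<xi>)) * x)" for b :: 'a and x
  let ?P = "\<Pi>\<^sub>M b\<in>(Basis::'a set). (lborel :: real measure)"
  let ?S = "\<lambda>g. \<Sum>b\<in>(Basis::'a set). g b *\<^sub>R b"
  let ?F = "\<lambda>x::'a. of_real (gauss x) * phase x \<xi>"
  have fac: "?F (?S g) = (\<Prod>b\<in>Basis. f b (g b))" for g
  proof -
    have 1: "(norm (?S g))\<^sup>2 = (\<Sum>b\<in>Basis. (g b)\<^sup>2)"
      by (subst power2_norm_eq_inner, subst euclidean_inner) (simp add: power2_eq_square)
    have 2: "(?S g) \<bullet> \<xi> = (\<Sum>b\<in>Basis. g b * (b \<bullet> \<xi>))"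
      by (simp add: inner_sum_left)
    have "?F (?S g) = exp (\<Sum>b\<in>Basis. - of_real (pi * (g b)\<^sup>2) + \<i> * of_real (- (2 * pi * (b \<bullet> \<xi>)) * g b))"
      unfolding 1 2 cis_conv_exp exp_of_real[symmetric] mult_exp_exp
      by (simp add: sum_subtractf sum_distrib_left sum_negf mult_ac del: exp_of_real)
    also have "\<dots> = (\<Prod>b\<in>Basis. f b (g b))"
      unfolding f_def cis_conv_exp exp_of_real[symmetric] mult_exp_exp
      by (simp add: exp_sum)
    finally show ?thesis .
  qed
  have fi: "integrable lborel (f b)" for b
    unfolding f_def by (rule gaussian_fourier_real)
  have [measurable]: "?F \<in> borel_measurable borel"
    by (intro borel_measurable_continuous_onI continuous_intros)
  show ?A
    by (subst lborel_eq) (subst integrable_distr_eq, simp, simp,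
      unfold fac, intro product_integrable_prod finite_Basis fi)
  have "integral\<^sup>L lborel ?F = (LINT g|?P. ?F (?S g))"
    by (subst lborel_eq) (rule integral_distr; simp)
  also have "\<dots> = (\<Prod>b\<in>Basis. integral\<^sup>L lborel (f b))"
    unfolding fac by (intro product_integral_prod finite_Basis fi)
  also have "\<dots> = (\<Prod>b\<in>Basis. exp (of_real (- (pi * (b \<bullet> \<xi>)\<^sup>2))))"
    unfolding f_def gaussian_fourier_real(2)
    by (intro prod.cong refl) (simp add: power2_eq_square exp_of_real[symmetric] mult_ac)
  also have "\<dots> = exp (\<Sum>b\<in>Basis. of_real (- (pi * (b \<bullet> \<xi>)\<^sup>2)))"
    by (simp add: exp_sum)
  also have "(\<Sum>b\<in>(Basis::'a set). complex_of_real (- (pi * (b \<bullet> \<xi>)\<^sup>2))) = of_real (- (pi * (norm \<xi>)\<^sup>2))"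
    by (subst power2_norm_eq_inner, subst euclidean_inner)
       (simp add: sum_distrib_left sum_negf inner_commute power2_eq_square)
  finally show ?B by (simp only: exp_of_real)
qed

text \<open>Polar coordinates for radial functions without a surface measure: both measures assign
  to \<open>{..a}\<close> the volume of the ball of radius \<open>a\<close>, and these half-lines
  form an intersection-stable generator. The density is the derivative of that volume.\<close>

lemma distr_norm_lborel:
  "distr (lborel :: 'a::euclidean_space measure) borel norm
    = density lborel (\<lambda>\<rho>. ennreal ((DIM('a) * unit_ball_vol DIM('a)) * (\<rho> ^ (DIM('a) - 1) * indicator {0<..} \<rho>)))"
  (is "?M = density lborel (\<lambda>\<rho>. ennreal (?w \<rho>))")
proof -
  let ?d = "DIM('a)"
  let ?K = "unit_ball_vol ?d" and ?N = "density lborel (\<lambda>\<rho>. ennreal (?w \<rho>))"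
  have K: "?K > 0" by simp
  have em: "emeasure ?M {..a} = (if a < 0 then 0 else ennreal (?K * a ^ ?d))" for a
  proof -
    have "norm -` {..a} = (cball 0 a :: 'a set)" by (auto simp: dist_norm)
    then show ?thesis by (simp add: emeasure_distr emeasure_cball)
  qed
  have en: "emeasure ?N {..a} = (if a < 0 then 0 else ennreal (?K * a ^ ?d))" for a
  proof -
    have "emeasure ?N {..a} = (\<integral>\<^sup>+x. ennreal (?w x) * indicator {..a} x \<partial>lborel)"
      by (subst emeasure_density) auto
    \<comment> \<open>The null set at 0 is added so that the fundamental theorem of calculus applies
      on a closed interval.\<close>
    also have "\<dots> = (\<integral>\<^sup>+x. ennreal (?d * ?K * x ^ (?d - 1)) * indicator {0..a} x \<partial>lborel)"
      using AE_lborel_singleton[of 0] by (intro nn_integral_cong_AE) (auto simp: indicator_def)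
    also have "\<dots> = (if a < 0 then 0 else ennreal (?K * a ^ ?d - ?K * 0 ^ ?d))"
    proof (cases "a < 0")
      case False
      then have "(\<integral>\<^sup>+x. ennreal (?d * ?K * x ^ (?d - 1)) * indicator {0..a} x \<partial>lborel) = ennreal (?K * a ^ ?d - ?K * 0 ^ ?d)"
        using K by (intro nn_integral_FTC_Icc) (auto intro!: derivative_eq_intros)
      then show ?thesis using False by simp
    qed simp
    finally show ?thesis by simp
  qed
  have bs: "sets borel = sigma_sets UNIV (range (atMost :: real \<Rightarrow> _))"
    by (subst borel_eq_atMost) simp
  show "?M = ?N"
  proof (rule measure_eqI_generator_eq[where E="range atMost" and \<Omega>=UNIV and A="\<lambda>n. {..real n}"])
    show "Int_stable (range (atMost :: real \<Rightarrow> _))" by (auto simp: Int_stable_def)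
    show "(\<Union>n. {..real n}) = UNIV" using real_arch_simple by auto
    show "emeasure ?M X = emeasure ?N X" if "X \<in> range atMost" for X
      using that em en by auto
    show "emeasure ?M {..real i} \<noteq> \<infinity>" for i unfolding em by simp
  qed (simp_all add: bs, auto)
qed

lemma
  fixes f :: "real \<Rightarrow> real"
  assumes [measurable]: "f \<in> borel_measurable borel"
  shows integrable_radial: "integrable (lborel :: 'a::euclidean_space measure) (\<lambda>x. f (norm x))
      \<longleftrightarrow> set_integrable lborel {0<..} (\<lambda>\<rho>. \<rho> ^ (DIM('a) - 1) * f \<rho>)" (is ?A)
    and integral_radial: "(LINT x|(lborel :: 'a measure). f (norm x))
      = DIM('a) * unit_ball_vol DIM('a) * (LINT \<rho>:{0<..}|lborel. \<rho> ^ (DIM('a) - 1) * f \<rho>)" (is ?B)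
proof -
  let ?d = "DIM('a)"
  let ?K = "unit_ball_vol ?d"
  let ?M = "distr (lborel :: 'a measure) borel norm"
  let ?w = "\<lambda>\<rho>. (?d * ?K) * (\<rho> ^ (?d - 1) * indicator {0<..} \<rho>)"
  have K: "?d * ?K > 0" by simp
  then have nn: "0 \<le> ?w \<rho>" for \<rho> by (auto simp: indicator_def)
  have eq: "?w \<rho> *\<^sub>R f \<rho> = (?d * ?K) *\<^sub>R (indicator {0<..} \<rho> *\<^sub>R (\<rho> ^ (?d - 1) * f \<rho>))" for \<rho> by simp
  have "integrable (lborel :: 'a measure) (\<lambda>x. f (norm x)) \<longleftrightarrow> integrable ?M f"
    by (subst integrable_distr_eq) auto
  also have "\<dots> \<longleftrightarrow> integrable lborel (\<lambda>\<rho>. ?w \<rho> *\<^sub>R f \<rho>)"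
    unfolding distr_norm_lborel using nn by (intro integrable_density) auto
  also have "\<dots> \<longleftrightarrow> set_integrable lborel {0<..} (\<lambda>\<rho>. \<rho> ^ (DIM('a) - 1) * f \<rho>)"
    unfolding eq set_integrable_def using less_imp_neq[OF K] by (intro integrable_scaleR_iff) simp
  finally show ?A .
  have "(LINT x|(lborel :: 'a measure). f (norm x)) = integral\<^sup>L ?M f"
    by (subst integral_distr) auto
  also have "\<dots> = (LINT \<rho>|lborel. ?w \<rho> *\<^sub>R f \<rho>)"
    unfolding distr_norm_lborel using nn by (intro integral_density) auto
  also have "\<dots> = ?d * ?K * (LINT \<rho>:{0<..}|lborel. \<rho> ^ (?d - 1) * f \<rho>)"
    unfolding eq set_lebesgue_integral_def by simp
  finally show ?B .
qed

section \<open>Parseval's identity on the unit cube\<close>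

text \<open>For an indicator, regularity encloses the set between a compact and an open set of
  nearly equal measure, and a Urysohn function between them errs only on their difference; sums and
  dominated limits do the rest. General finite Borel measures are needed because the lemma is
  applied to two image measures: that of the cube on the torus and that of a weighted half-line
  under a Gaussian.\<close>

lemma integrable_approx_continuous:
  fixes f :: "'a::euclidean_space \<Rightarrow> real"
  assumes M: "finite_measure M" "sets M = sets borel" and f: "integrable M f" and "0 < e"
  shows "\<exists>g. continuous_on UNIV g \<and> integrable M g \<and> (LINT x|M. \<bar>f x - g x\<bar>) < e"
  using f \<open>0 < e\<close>
proof (induction arbitrary: e rule: integrable_induct)
  case (base A c)
  interpret finite_measure M by fact
  have sp: "space M = UNIV" using sets_eq_imp_space_eq[OF M(2)] by simp
  have [measurable_cong]: "sets M = sets borel" by fact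
  have A[measurable]: "A \<in> sets borel" using base M by simp
  have fin: "emeasure M (space M) \<noteq> \<infinity>" by simp
  define d where "d = e / (\<bar>c\<bar> + 1)"
  have d: "d > 0" using base by (simp add: d_def)
  have em: "emeasure M S = ennreal (measure M S)" for S by (rule emeasure_eq_measure)
  obtain K where K: "compact K" "K \<subseteq> A" "measure M A < measure M K + d / 2"
  proof -
    have "emeasure M A < emeasure M A + ennreal (d / 2)"
      unfolding em using d by (simp add: ennreal_plus[symmetric] ennreal_less_iff del: ennreal_plus)
    also have "\<dots> = (\<Squnion>K\<in>{K. K \<subseteq> A \<and> compact K}. emeasure M K) + ennreal (d / 2)"
      by (subst inner_regular[OF M(2) fin A]) simp
    also have "\<dots> = (\<Squnion>K\<in>{K. K \<subseteq> A \<and> compact K}. emeasure M K + ennreal (d / 2))"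
      by (intro ennreal_SUP_add_left[symmetric]) auto
    finally obtain K where "K \<subseteq> A" "compact K" "emeasure M A < emeasure M K + ennreal (d / 2)"
      unfolding less_SUP_iff by auto
    then show thesis using that d unfolding em
      by (simp add: ennreal_plus[symmetric] ennreal_less_iff del: ennreal_plus)
  qed
  obtain U where U: "open U" "A \<subseteq> U" "measure M U < measure M A + d / 2"
  proof -
    have "(\<Sqinter>U\<in>{U. A \<subseteq> U \<and> open U}. emeasure M U) < emeasure M A + ennreal (d / 2)"
      unfolding outer_regular[OF M(2) fin A, symmetric] unfolding em using d
      by (simp add: ennreal_plus[symmetric] ennreal_less_iff del: ennreal_plus)
    then obtain U where "A \<subseteq> U" "open U" "emeasure M U < emeasure M A + ennreal (d / 2)"
      unfolding INF_less_iff by auto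
    then show thesis using that d unfolding em
      by (simp add: ennreal_plus[symmetric] ennreal_less_iff del: ennreal_plus)
  qed
  have KU: "K \<inter> - U = {}" "closed K" "closed (- U)"
    using K U by (auto simp: compact_imp_closed)
  obtain h :: "'a \<Rightarrow> real" where h: "continuous_on UNIV h" "\<And>x. h x \<in> closed_segment 1 0"
      "\<And>x. x \<in> K \<Longrightarrow> h x = 1" "\<And>x. x \<in> - U \<Longrightarrow> h x = 0"
    using Urysohn[OF KU(2,3,1)] by metis
  have h01: "0 \<le> h x" "h x \<le> 1" for x using h(2)[of x] by (auto simp: closed_segment_eq_real_ivl)
  have [measurable]: "h \<in> borel_measurable borel" "U \<in> sets borel" "K \<in> sets borel"
    using h(1) U K by (auto intro: borel_measurable_continuous_onI simp: borel_compact)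
  have hi: "integrable M h"
    by (rule integrable_const_bound[of _ 1]) (use h01 in auto)
  have UK: "measure M (U - K) < d"
    using K U by (subst finite_measure_Diff) auto
  have "(LINT x|M. \<bar>indicator A x *\<^sub>R c - c * h x\<bar>) \<le> (LINT x|M. \<bar>c\<bar> * indicator (U - K) x)"
  proof (rule integral_mono)
    show "integrable M (\<lambda>x. \<bar>indicator A x *\<^sub>R c - c * h x\<bar>)"
    proof -
      have "integrable M (indicat_real A)" by (rule integrable_const_bound[of _ 1]) auto
      then show ?thesis using hi by (intro integrable_abs Bochner_Integration.integrable_diff) auto
    qed
    show "\<bar>indicator A x *\<^sub>R c - c * h x\<bar> \<le> \<bar>c\<bar> * indicator (U - K) x" for x
    proof -
      have "\<bar>indicator A x *\<^sub>R c - c * h x\<bar> = \<bar>c\<bar> * \<bar>indicator A x - h x\<bar>"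
        by (simp add: abs_mult[symmetric] algebra_simps)
      also have "\<bar>indicator A x - h x\<bar> \<le> indicator (U - K) x"
        using h01[of x] h(3,4)[of x] K(2) U(2) by (auto simp: indicator_def)
      finally show ?thesis by (simp add: mult_left_mono)
    qed
    have "integrable M (indicat_real (U - K))" by (rule integrable_const_bound[of _ 1]) auto
    then show "integrable M (\<lambda>x. \<bar>c\<bar> * indicator (U - K) x)" by simp
  qed
  also have "\<dots> = \<bar>c\<bar> * measure M (U - K)" by (simp add: sp)
  also have "\<dots> \<le> \<bar>c\<bar> * d" using UK by (intro mult_left_mono) auto
  also have "\<dots> < e" using base by (simp add: d_def field_simps)
  finally show ?case
    using h hi by (intro exI[of _ "\<lambda>x. c * h x"]) (auto intro!: continuous_intros)
next
  case (add f g)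
  obtain f' where f': "continuous_on UNIV f'" "integrable M f'" "(LINT x|M. \<bar>f x - f' x\<bar>) < e / 2"
    using add(3)[of "e / 2"] add(5) by auto
  obtain g' where g': "continuous_on UNIV g'" "integrable M g'" "(LINT x|M. \<bar>g x - g' x\<bar>) < e / 2"
    using add(4)[of "e / 2"] add(5) by auto
  have "(LINT x|M. \<bar>f x + g x - (f' x + g' x)\<bar>) \<le> (LINT x|M. \<bar>f x - f' x\<bar> + \<bar>g x - g' x\<bar>)"
    using add f' g' by (intro integral_mono) auto
  also have "\<dots> < e" using add f' g' by (subst Bochner_Integration.integral_add) auto
  finally show ?case
    using f' g' by (intro exI[of _ "\<lambda>x. f' x + g' x"]) (auto intro!: continuous_intros)
next
  case (lim f s)
  have lim_f: "(\<lambda>i. s i x) \<longlonglongrightarrow> f x" if "x \<in> space M" for x using lim that by blast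
  have lim_b: "norm (s i x) \<le> 2 * norm (f x)" if "x \<in> space M" for i x using lim that by blast
  have "(\<lambda>i. LINT x|M. \<bar>f x - s i x\<bar>) \<longlonglongrightarrow> (LINT x|M. 0)"
  proof (rule integral_dominated_convergence[where w="\<lambda>x. 3 * \<bar>f x\<bar>"])
    show "AE x in M. (\<lambda>i. \<bar>f x - s i x\<bar>) \<longlonglongrightarrow> 0"
    proof (intro AE_I2 tendsto_rabs_zero)
      fix x assume "x \<in> space M"
      from tendsto_diff[OF tendsto_const lim_f[OF this], of "f x"]
      show "(\<lambda>i. f x - s i x) \<longlonglongrightarrow> 0" by simp
    qed
    show "AE x in M. norm \<bar>f x - s i x\<bar> \<le> 3 * \<bar>f x\<bar>" for i
      using lim_b[of _ i] by (intro AE_I2) force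
  qed (use lim in auto)
  then have "eventually (\<lambda>i. (LINT x|M. \<bar>f x - s i x\<bar>) < e / 2) sequentially"
    using \<open>0 < e\<close> by (intro order_tendstoD) auto
  then obtain i where i: "(LINT x|M. \<bar>f x - s i x\<bar>) < e / 2"
    by (auto simp: eventually_sequentially)
  obtain g where g: "continuous_on UNIV g" "integrable M g" "(LINT x|M. \<bar>s i x - g x\<bar>) < e / 2"
  proof -
    have "\<exists>g. continuous_on UNIV g \<and> integrable M g \<and> (LINT x|M. \<bar>s i x - g x\<bar>) < e / 2"
      by (rule lim) (use \<open>0 < e\<close> in simp)
    then show thesis using that by blast
  qed
  have "(LINT x|M. \<bar>f x - g x\<bar>) \<le> (LINT x|M. \<bar>f x - s i x\<bar> + \<bar>s i x - g x\<bar>)"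
    using lim g by (intro integral_mono) auto
  also have "\<dots> < e" using lim g i by (subst Bochner_Integration.integral_add) auto
  finally show ?case using g by auto
qed

text \<open>Clamping an L^1 approximant to \<open>[-B, B]\<close> brings it no farther from
  \<open>f\<close> and keeps the difference below \<open>2 * B\<close>, so the squared error is at
  most \<open>2 * B\<close> times the L^1 error.\<close>

lemma bounded_approx_continuous:
  fixes f :: "'a::euclidean_space \<Rightarrow> real"
  assumes M: "finite_measure M" "sets M = sets borel"
    and f: "f \<in> borel_measurable M" "\<And>x. \<bar>f x\<bar> \<le> B" and "0 < e"
  shows "\<exists>g. continuous_on UNIV g \<and> (\<forall>x. \<bar>g x\<bar> \<le> \<bar>B\<bar>) \<and> (LINT x|M. (f x - g x)\<^sup>2) < e"
proof -
  interpret finite_measure M by fact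
  have [measurable_cong]: "sets M = sets borel" by fact
  have B: "B \<ge> 0" using f(2)[of undefined] by simp
  have fi: "integrable M f" by (rule integrable_const_bound[of _ B]) (use f in auto)
  obtain g where g: "continuous_on UNIV g" "integrable M g" "(LINT x|M. \<bar>f x - g x\<bar>) < e / (2 * B + 1)"
    using integrable_approx_continuous[OF M fi, of "e / (2 * B + 1)"] B \<open>0 < e\<close> by auto
  define h where "h x = max (- B) (min B (g x))" for x
  have h: "continuous_on UNIV h" unfolding h_def using g by (intro continuous_intros)
  have hB: "\<bar>h x\<bar> \<le> B" for x using B by (auto simp: h_def)
  have [measurable]: "h \<in> borel_measurable borel" using h by (rule borel_measurable_continuous_onI)
  have [measurable]: "f \<in> borel_measurable borel" using f(1) M(2) by simp
  have le: "(f x - h x)\<^sup>2 \<le> 2 * B * \<bar>f x - g x\<bar>" for x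
  proof -
    have 1: "\<bar>f x - h x\<bar> \<le> \<bar>f x - g x\<bar>" using f(2)[of x] B by (auto simp: h_def)
    have 2: "\<bar>f x - h x\<bar> \<le> 2 * B" using f(2)[of x] hB[of x] by linarith
    have "(f x - h x)\<^sup>2 = \<bar>f x - h x\<bar> * \<bar>f x - h x\<bar>" by (simp add: power2_eq_square)
    also have "\<dots> \<le> 2 * B * \<bar>f x - g x\<bar>" using 1 2 B by (intro mult_mono) auto
    finally show ?thesis .
  qed
  have "(LINT x|M. (f x - h x)\<^sup>2) \<le> (LINT x|M. 2 * B * \<bar>f x - g x\<bar>)"
  proof (rule integral_mono)
    show "integrable M (\<lambda>x. (f x - h x)\<^sup>2)"
    proof (rule integrable_const_bound[of _ "(2 * B)\<^sup>2"])
      have "\<bar>f x - h x\<bar> \<le> 2 * B" for x using f(2)[of x] hB[of x] by linarith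
      then have "(f x - h x)\<^sup>2 \<le> (2 * B)\<^sup>2" for x using abs_le_square_iff B by (metis abs_of_nonneg mult_nonneg_nonneg zero_le_numeral)
      then show "AE x in M. norm ((f x - h x)\<^sup>2) \<le> (2 * B)\<^sup>2" by auto
    qed measurable
  qed (use le fi g in auto)
  also have "\<dots> = 2 * B * (LINT x|M. \<bar>f x - g x\<bar>)" by simp
  also have "\<dots> \<le> 2 * B * (e / (2 * B + 1))" using g(3) B by (intro mult_left_mono) auto
  also have "\<dots> < e" using B \<open>0 < e\<close> by (simp add: field_simps)
  finally show ?thesis using h hB B by (intro exI[of _ h]) auto
qed

section \<open>Trigonometric polynomials and their density\<close>

definition unit_cube :: "(real^'n) set" where
  "unit_cube = {z. \<forall>i. 0 \<le> z $ i \<and> z $ i < 1}"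

definition torus_char :: "real^'n \<Rightarrow> real^'n \<Rightarrow> complex" where
  "torus_char k z = cis (2 * pi * (k \<bullet> z))"

text \<open>Values are real so that the real Stone-Weierstrass theorem applies; coefficients are
  complex because sine and cosine are combinations of two characters.\<close>

definition trig_polynomial :: "(real^'n \<Rightarrow> real) \<Rightarrow> bool" where
  "trig_polynomial f \<longleftrightarrow> (\<exists>K a. finite K \<and> K \<subseteq> int_vectors \<and>
     (\<forall>z. complex_of_real (f z) = (\<Sum>k\<in>K. a k * torus_char k z)))"

lemma torus_char_add: "torus_char (k + l) z = torus_char k z * torus_char l z"
  by (simp add: torus_char_def cis_mult algebra_simps)

lemma norm_torus_char [simp]: "norm (torus_char k z) = 1"
  by (simp add: torus_char_def)

lemma int_vectors_add: "k \<in> int_vectors \<Longrightarrow> l \<in> int_vectors \<Longrightarrow> k + l \<in> int_vectors"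
  by (simp add: int_vectors_def)

lemma trig_polynomial_const: "trig_polynomial (\<lambda>_. c)"
  unfolding trig_polynomial_def
  by (intro exI[of _ "{0}"] exI[of _ "\<lambda>_. of_real c"]) (simp add: torus_char_def int_vectors_def)

lemma trig_polynomial_add:
  assumes "trig_polynomial f" "trig_polynomial g"
  shows "trig_polynomial (\<lambda>z. f z + g z)"
proof -
  obtain K a where K: "finite K" "K \<subseteq> int_vectors" "\<And>z. complex_of_real (f z) = (\<Sum>k\<in>K. a k * torus_char k z)"
    using assms by (auto simp: trig_polynomial_def)
  obtain L b where L: "finite L" "L \<subseteq> int_vectors" "\<And>z. complex_of_real (g z) = (\<Sum>k\<in>L. b k * torus_char k z)"
    using assms by (auto simp: trig_polynomial_def)
  have "complex_of_real (f z + g z) = (\<Sum>k\<in>K\<union>L. ((if k \<in> K then a k else 0) + (if k \<in> L then b k else 0)) * torus_char k z)" for z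
    using K(1) L(1)
    by (simp add: K(3) L(3) distrib_right sum.distrib if_distrib[of "\<lambda>x. x * _"] sum.If_cases Int_absorb1 cong: if_cong)
  with K L show ?thesis unfolding trig_polynomial_def
    by (intro exI[of _ "K \<union> L"] exI[of _ "\<lambda>k. (if k \<in> K then a k else 0) + (if k \<in> L then b k else 0)"]) auto
qed

text \<open>The coefficients of a product are a convolution: pairs of frequencies are grouped by
  their sum.\<close>

lemma trig_polynomial_mult:
  assumes "trig_polynomial f" "trig_polynomial g"
  shows "trig_polynomial (\<lambda>z. f z * g z)"
proof -
  obtain K a where K: "finite K" "K \<subseteq> int_vectors" "\<And>z. complex_of_real (f z) = (\<Sum>k\<in>K. a k * torus_char k z)"
    using assms by (auto simp: trig_polynomial_def)
  obtain L b where L: "finite L" "L \<subseteq> int_vectors" "\<And>z. complex_of_real (g z) = (\<Sum>k\<in>L. b k * torus_char k z)"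
    using assms by (auto simp: trig_polynomial_def)
  let ?s = "\<lambda>(k, l). k + l :: real^'a"
  let ?c = "\<lambda>m. \<Sum>x\<in>{x\<in>K \<times> L. ?s x = m}. a (fst x) * b (snd x)"
  have "complex_of_real (f z * g z) = (\<Sum>m\<in>?s ` (K \<times> L). ?c m * torus_char m z)" for z
  proof -
    have "complex_of_real (f z * g z) = (\<Sum>x\<in>K \<times> L. a (fst x) * b (snd x) * torus_char (?s x) z)"
      by (simp add: K(3) L(3) sum_product sum.cartesian_product torus_char_add split_def mult_ac)
    also have "\<dots> = (\<Sum>m\<in>?s ` (K \<times> L). \<Sum>x\<in>{x\<in>K \<times> L. ?s x = m}. a (fst x) * b (snd x) * torus_char (?s x) z)"
      using K(1) L(1) by (intro sum.image_gen) simp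
    also have "\<dots> = (\<Sum>m\<in>?s ` (K \<times> L). ?c m * torus_char m z)"
      unfolding sum_distrib_right by (intro sum.cong refl) auto
    finally show ?thesis .
  qed
  moreover have "?s ` (K \<times> L) \<subseteq> int_vectors" using K(2) L(2) by (auto intro!: int_vectors_add)
  ultimately show ?thesis unfolding trig_polynomial_def using K(1) L(1)
    by (intro exI[of _ "?s ` (K \<times> L)"] exI[of _ ?c]) auto
qed

lemma axis_int_vectors: "a \<in> \<int> \<Longrightarrow> axis i a \<in> int_vectors"
  by (auto simp: int_vectors_def axis_def)

lemma trig_polynomial_cos: "trig_polynomial (\<lambda>z. cos (2 * pi * z $ i))"
proof -
  have "complex_of_real (cos (2 * pi * z $ i)) =
      (\<Sum>k\<in>{axis i 1, axis i (-1)}. 1 / 2 * torus_char k z)" for z :: "real^'a"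
    by (subst sum.insert)
       (auto simp: axis_eq_axis torus_char_def inner_axis' complex_eq_iff)
  then show ?thesis unfolding trig_polynomial_def
    by (intro exI[of _ "{axis i 1, axis i (-1)}"] exI[of _ "\<lambda>_. 1 / 2"]) (auto intro!: axis_int_vectors)
qed

lemma trig_polynomial_sin: "trig_polynomial (\<lambda>z. sin (2 * pi * z $ i))"
proof -
  let ?a = "\<lambda>k. if k = axis i 1 then - \<i> / 2 else \<i> / 2"
  have "complex_of_real (sin (2 * pi * z $ i)) =
      (\<Sum>k\<in>{axis i 1, axis i (-1)}. ?a k * torus_char k z)" for z :: "real^'a"
    by (subst sum.insert)
       (auto simp: axis_eq_axis torus_char_def inner_axis' complex_eq_iff)
  then show ?thesis unfolding trig_polynomial_def
    by (intro exI[of _ "{axis i 1, axis i (-1)}"] exI[of _ ?a]) (auto intro!: axis_int_vectors)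
qed

definition torus_embedding :: "real^'n \<Rightarrow> complex^'n" where
  "torus_embedding z = (\<chi> i. cis (2 * pi * z $ i))"

definition torus :: "(complex^'n) set" where
  "torus = {w. \<forall>i. norm (w $ i) = 1}"

text \<open>A Borel left inverse of \<open>t \<mapsto> cis (2 * pi * t)\<close> on
  \<open>[0, 1)\<close>: the arccosine yields the angle up to reflection, and the sign of the
  imaginary part decides. Clamping the real part makes the arccosine continuous on the whole
  plane.\<close>

definition circle_angle :: "complex \<Rightarrow> real" where
  "circle_angle w = (let \<theta> = arccos (max (-1) (min 1 (Re w))) / (2 * pi)
     in if Im w \<ge> 0 then \<theta> else 1 - \<theta>)"

lemma circle_angle_cis:
  assumes "0 \<le> t" "t < 1"
  shows "circle_angle (cis (2 * pi * t)) = t"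
proof (cases "t \<le> 1 / 2")
  case True
  then have "2 * pi * t \<le> pi" by (simp add: field_simps)
  moreover have "0 \<le> 2 * pi * t" using assms by simp
  ultimately show ?thesis
    by (simp add: circle_angle_def Let_def arccos_cos sin_ge_zero)
next
  case False
  \<comment> \<open>On the lower half circle the arccosine returns the reflected angle
    \<open>2 * pi - 2 * pi * t\<close>; the second branch of \<open>circle_angle\<close> undoes the
    reflection.\<close>
  have *: "0 < 2 * pi - 2 * pi * t" "2 * pi - 2 * pi * t < pi"
    using assms False by (auto simp: field_simps)
  have "sin (2 * pi - 2 * pi * t) > 0" using * by (intro sin_gt_zero) auto
  then have "sin (2 * pi * t) < 0" by (simp add: sin_diff)
  moreover have "cos (2 * pi * t) = cos (2 * pi - 2 * pi * t)" by (simp add: cos_diff)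
  then have "arccos (cos (2 * pi * t)) = 2 * pi - 2 * pi * t"
    using * by (simp add: arccos_cos del: cos_2pi_minus)
  ultimately show ?thesis
    by (simp add: circle_angle_def Let_def field_simps)
qed

lemma circle_angle_measurable [measurable]: "circle_angle \<in> borel_measurable borel"
proof -
  have "(\<lambda>w. arccos (max (-1) (min 1 (Re w)))) \<in> borel_measurable borel"
    by (intro borel_measurable_continuous_onI continuous_intros) auto
  then show ?thesis unfolding circle_angle_def Let_def by measurable
qed

lemma borel_measurable_vec_lambda:
  fixes f :: "'a \<Rightarrow> 'n::finite \<Rightarrow> real"
  assumes "\<And>i. (\<lambda>x. f x i) \<in> borel_measurable M"
  shows "(\<lambda>x. \<chi> i. f x i) \<in> borel_measurable M"
proof (subst borel_measurable_euclidean_space, rule ballI)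
  fix b :: "real^'n" assume "b \<in> Basis"
  then obtain i where "b = axis i 1" by (auto simp: Basis_vec_def)
  then show "(\<lambda>x. (\<chi> i. f x i) \<bullet> b) \<in> borel_measurable M"
    using assms[of i] by (simp add: inner_axis)
qed

lemma compact_torus: "compact (torus :: (complex^'n) set)"
proof -
  have "bounded (torus :: (complex^'n) set)"
  proof (rule boundedI)
    fix w :: "complex^'n" assume "w \<in> torus"
    then have "norm w \<le> (\<Sum>i\<in>(UNIV::'n set). 1)"
      unfolding norm_vec_def using L2_set_le_sum[of UNIV "\<lambda>i. norm (w $ i)"] by (simp add: torus_def)
    then show "norm w \<le> real CARD('n)" by simp
  qed
  moreover have "closed (torus :: (complex^'n) set)"
    unfolding torus_def by (intro closed_Collect_all closed_Collect_eq continuous_intros)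
  ultimately show ?thesis by (simp add: compact_eq_bounded_closed)
qed

lemma unit_cube_borel [measurable]: "unit_cube \<in> sets borel"
proof -
  have "unit_cube = (\<Inter>i. {z::real^'n. 0 \<le> z $ i} \<inter> {z. z $ i < 1})"
    by (auto simp: unit_cube_def)
  also have "\<dots> \<in> sets borel"
    by (intro sets.countable_INT'' sets.Int borel_closed borel_open closed_Collect_le open_Collect_less continuous_intros) auto
  finally show ?thesis .
qed

lemma emeasure_unit_cube: "emeasure lborel (unit_cube :: (real^'n) set) = 1"
proof (rule antisym)
  have "unit_cube \<subseteq> (cbox 0 1 :: (real^'n) set)"
    by (auto simp: unit_cube_def mem_box_cart less_imp_le)
  then have "emeasure lborel (unit_cube :: (real^'n) set) \<le> emeasure lborel (cbox 0 1 :: (real^'n) set)"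
    by (intro emeasure_mono) auto
  also have "emeasure lborel (cbox 0 1 :: (real^'n) set) = 1"
    by (subst emeasure_lborel_cbox) (auto simp: Basis_vec_def inner_axis intro!: prod.neutral)
  finally show "emeasure lborel (unit_cube :: (real^'n) set) \<le> 1" .
  have "1 = emeasure lborel (box 0 1 :: (real^'n) set)"
    by (subst emeasure_lborel_box) (auto simp: Basis_vec_def inner_axis intro!: prod.neutral)
  also have "(box 0 1 :: (real^'n) set) \<subseteq> unit_cube"
    by (auto simp: unit_cube_def mem_box_cart less_imp_le)
  then have "emeasure lborel (box 0 1 :: (real^'n) set) \<le> emeasure lborel (unit_cube :: (real^'n) set)"
    by (intro emeasure_mono) auto
  finally show "1 \<le> emeasure lborel (unit_cube :: (real^'n) set)" .
qed

definition cube_measure :: "(real^'n) measure" where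
  "cube_measure = restrict_space lborel unit_cube"

lemma prob_space_cube_measure: "prob_space cube_measure"
  by (rule prob_spaceI) (simp add: cube_measure_def emeasure_restrict_space emeasure_unit_cube)

lemma space_cube_measure [simp]: "space cube_measure = unit_cube"
  by (simp add: cube_measure_def)

lemma cube_measure_measurable: "f \<in> borel_measurable borel \<Longrightarrow> f \<in> borel_measurable cube_measure"
  unfolding cube_measure_def by (intro measurable_restrict_space1) simp

lemma integral_cube_measure:
  fixes f :: "real^'n \<Rightarrow> 'b::{banach, second_countable_topology}"
  shows "integral\<^sup>L cube_measure f = (LINT z:unit_cube|lborel. f z)"
  by (simp add: cube_measure_def integral_restrict_space set_lebesgue_integral_def)

text \<open>Through the embedding into the compact torus, approximation by trigonometric polynomials
  becomes approximation by continuous functions (for the image measure), followed by the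
  Stone-Weierstrass theorem.\<close>

lemma trig_polynomial_dense:
  fixes f :: "real^'n \<Rightarrow> real"
  assumes [measurable]: "f \<in> borel_measurable borel" and B: "\<And>z. \<bar>f z\<bar> \<le> B" and "0 < e"
  shows "\<exists>p. trig_polynomial p \<and> (LINT z|cube_measure. (f z - p z)\<^sup>2) < e"
proof -
  interpret C: prob_space "cube_measure :: (real^'n) measure" by (rule prob_space_cube_measure)
  let ?w = "torus_embedding :: real^'n \<Rightarrow> complex^'n"
  \<comment> \<open>\<open>u\<close> inverts the embedding on the cube. It is only Borel, since the
    torus glues opposite faces of the cube together, but measurability of \<open>f\<close> composed
    with \<open>u\<close> is what the approximation asks for.\<close>
  define u :: "complex^'n \<Rightarrow> real^'n" where "u w = (\<chi> i. circle_angle (w $ i))" for w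
  have uw: "u (?w z) = z" if "z \<in> unit_cube" for z
    using that by (auto simp: u_def torus_embedding_def unit_cube_def circle_angle_cis vec_eq_iff)
  have cw: "continuous_on UNIV ?w"
    unfolding torus_embedding_def cis_conv_exp by (intro continuous_intros)
  have [measurable]: "?w \<in> borel_measurable borel" using cw by (rule borel_measurable_continuous_onI)
  have [measurable]: "?w \<in> borel_measurable cube_measure" by (intro cube_measure_measurable) simp
  have [measurable]: "u \<in> borel_measurable borel" unfolding u_def
    by (intro borel_measurable_vec_lambda measurable_compose[OF _ circle_angle_measurable]
         borel_measurable_continuous_onI continuous_intros)
  define M where "M = distr cube_measure borel ?w"
  have "finite_measure M" unfolding M_def by (intro C.finite_measure_distr) simp
  moreover have "sets M = sets borel" by (simp add: M_def)
  ultimately obtain g where g: "continuous_on UNIV g" "\<And>x. \<bar>g x\<bar> \<le> \<bar>B\<bar>" "(LINT x|M. (f (u x) - g x)\<^sup>2) < e / 4"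
    using bounded_approx_continuous[of M "\<lambda>w. f (u w)" B "e / 4"] B \<open>0 < e\<close> by (auto simp: M_def)
  have [measurable]: "g \<in> borel_measurable borel" using g(1) by (rule borel_measurable_continuous_onI)
  \<comment> \<open>Both squared errors enter with factor 2: the continuous approximation stays
    below \<open>e / 4\<close> and the uniform one contributes \<open>d\<^sup>2 = e / 4\<close>, so
    the total stays below \<open>e\<close>.\<close>
  define d where "d = sqrt (e / 4)"
  have d: "d > 0" "d\<^sup>2 = e / 4" using \<open>0 < e\<close> by (auto simp: d_def)
  \<comment> \<open>Members of the algebra carry the shape of their pullback with them, so the
    approximant found on the torus is a trigonometric polynomial on the cube by
    construction.\<close>
  define P where "P h \<longleftrightarrow> continuous_on UNIV h \<and> trig_polynomial (\<lambda>z. h (?w z))" for h :: "complex^'n \<Rightarrow> real"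
  have "\<exists>h. P h \<and> (\<forall>x\<in>torus. \<bar>g x - h x\<bar> < d)"
  proof (rule Stone_Weierstrass_HOL)
    show "compact (torus :: (complex^'n) set)" by (rule compact_torus)
    show "P (\<lambda>_. c)" for c by (auto simp: P_def trig_polynomial_const)
    show "continuous_on torus f" if "P f" for f using that by (auto simp: P_def intro: continuous_on_subset)
    show "P (\<lambda>x. f x + g x)" if "P f \<and> P g" for f g
      using that by (auto simp: P_def trig_polynomial_add intro!: continuous_intros)
    show "P (\<lambda>x. f x * g x)" if "P f \<and> P g" for f g
      using that by (auto simp: P_def trig_polynomial_mult intro!: continuous_intros)
    show "\<exists>f. P f \<and> f x \<noteq> f y" if xy: "x \<in> torus \<and> y \<in> torus \<and> x \<noteq> y" for x y
    proof -
      obtain i where "x $ i \<noteq> y $ i" using xy unfolding vec_eq_iff by blast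
      then consider "Re (x $ i) \<noteq> Re (y $ i)" | "Im (x $ i) \<noteq> Im (y $ i)" by (auto simp: complex_eq_iff)
      then show ?thesis
      proof cases
        case 1
        have "P (\<lambda>w. Re (w $ i))"
          using trig_polynomial_cos[of i]
          by (auto simp: P_def torus_embedding_def intro!: continuous_intros)
        with 1 show ?thesis by blast
      next
        case 2
        have "P (\<lambda>w. Im (w $ i))"
          using trig_polynomial_sin[of i]
          by (auto simp: P_def torus_embedding_def intro!: continuous_intros)
        with 2 show ?thesis by blast
      qed
    qed
    show "continuous_on torus g" using g(1) by (rule continuous_on_subset) simp
  qed (use d in auto)
  then obtain h where h: "continuous_on UNIV h" "trig_polynomial (\<lambda>z. h (?w z))" "\<And>x. x \<in> torus \<Longrightarrow> \<bar>g x - h x\<bar> < d"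
    by (auto simp: P_def)
  have [measurable]: "h \<in> borel_measurable borel" using h(1) by (rule borel_measurable_continuous_onI)
  have wt: "?w z \<in> torus" for z by (simp add: torus_embedding_def torus_def)
  have gi: "integrable cube_measure (\<lambda>z. 2 * (f z - g (?w z))\<^sup>2)"
  proof (rule C.integrable_const_bound[of _ "2 * (2 * \<bar>B\<bar>)\<^sup>2"])
    have "\<bar>f z - g (?w z)\<bar> \<le> 2 * \<bar>B\<bar>" for z using B[of z] g(2)[of "?w z"] by linarith
    then have "(f z - g (?w z))\<^sup>2 \<le> (2 * \<bar>B\<bar>)\<^sup>2" for z
      by (rule power2_le_iff_abs_le[THEN iffD2, rotated]) simp
    then show "AE z in cube_measure. norm (2 * (f z - g (?w z))\<^sup>2) \<le> 2 * (2 * \<bar>B\<bar>)\<^sup>2" by auto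
  qed (intro cube_measure_measurable, measurable)
  have le: "(f z - h (?w z))\<^sup>2 \<le> 2 * (f z - g (?w z))\<^sup>2 + 2 * d\<^sup>2" for z
  proof -
    have "(g (?w z) - h (?w z))\<^sup>2 \<le> d\<^sup>2"
      using h(3)[OF wt, of z] d by (intro power2_le_iff_abs_le[THEN iffD2]) auto
    moreover have "(f z - h (?w z))\<^sup>2 \<le> 2 * (f z - g (?w z))\<^sup>2 + 2 * (g (?w z) - h (?w z))\<^sup>2"
      using zero_le_power2[of "(f z - g (?w z)) - (g (?w z) - h (?w z))"]
      by (simp add: power2_eq_square algebra_simps)
    ultimately show ?thesis by linarith
  qed
  have "(LINT z|cube_measure. (f z - h (?w z))\<^sup>2) \<le> (LINT z|cube_measure. 2 * (f z - g (?w z))\<^sup>2 + 2 * d\<^sup>2)"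
  proof (rule integral_mono')
    show "integrable cube_measure (\<lambda>z. 2 * (f z - g (?w z))\<^sup>2 + 2 * d\<^sup>2)" using gi by simp
  qed (use le in auto)
  also have "\<dots> = 2 * (LINT z|cube_measure. (f z - g (?w z))\<^sup>2) + 2 * d\<^sup>2"
    using gi by (subst Bochner_Integration.integral_add) (auto simp: C.prob_space[simplified])
  also have "(LINT z|cube_measure. (f z - g (?w z))\<^sup>2) = (LINT z|cube_measure. (f (u (?w z)) - g (?w z))\<^sup>2)"
    by (intro Bochner_Integration.integral_cong refl) (simp add: uw)
  also have "\<dots> = (LINT x|M. (f (u x) - g x)\<^sup>2)"
    unfolding M_def by (subst integral_distr) auto
  finally have "(LINT z|cube_measure. (f z - h (?w z))\<^sup>2) < e"
    using g(3) d by linarith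
  with h(2) show ?thesis by blast
qed

section \<open>Integer translates of the unit cube\<close>

definition floor_vec :: "real^'n \<Rightarrow> real^'n" where
  "floor_vec z = (\<chi> i. of_int \<lfloor>z $ i\<rfloor>)"

lemma floor_vec_eq_iff:
  assumes "m \<in> int_vectors"
  shows "floor_vec z = m \<longleftrightarrow> z - m \<in> unit_cube"
proof -
  have "of_int \<lfloor>z $ i\<rfloor> = m $ i \<longleftrightarrow> 0 \<le> (z - m) $ i \<and> (z - m) $ i < 1" for i
  proof -
    obtain j where j: "m $ i = of_int j" using assms by (auto simp: int_vectors_def elim: Ints_cases)
    show ?thesis unfolding j by (simp add: j floor_eq_iff) linarith
  qed
  then show ?thesis by (simp add: floor_vec_def unit_cube_def vec_eq_iff)
qed

lemma floor_vec_int [simp]: "floor_vec z \<in> int_vectors"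
  by (simp add: floor_vec_def int_vectors_def)

text \<open>A ball in the maximum norm. It is finite and symmetric, and for large \<open>R\<close>
  it contains the integer parts of all points of a given bounded set, so the lattice sums met in
  unfolding are finite.\<close>

definition int_ball :: "nat \<Rightarrow> (real^'n) set" where
  "int_ball R = {m \<in> int_vectors. \<forall>i. \<bar>m $ i\<bar> \<le> real R}"

lemma int_ball_subset: "int_ball R \<subseteq> int_vectors"
  by (auto simp: int_ball_def)

lemma finite_int_ball [simp]: "finite (int_ball R :: (real^'n) set)"
proof (rule finite_subset)
  let ?P = "(UNIV :: 'n set) \<rightarrow>\<^sub>E {- int R..int R}"
  show "int_ball R \<subseteq> (\<lambda>f. \<chi> i. real_of_int (f i)) ` ?P"
  proof
    fix m :: "real^'n" assume m: "m \<in> int_ball R"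
    then have "m = (\<chi> i. real_of_int \<lfloor>m $ i\<rfloor>)"
      by (auto simp: int_ball_def int_vectors_def vec_eq_iff elim: Ints_cases)
    moreover have "(\<lambda>i. \<lfloor>m $ i\<rfloor>) \<in> ?P"
    proof -
      have "\<lfloor>m $ i\<rfloor> \<in> {- int R..int R}" for i
      proof -
        have "m $ i \<in> \<int>" "\<bar>m $ i\<bar> \<le> real R" using m by (auto simp: int_ball_def int_vectors_def)
        then show ?thesis by (auto elim!: Ints_cases)
      qed
      then show ?thesis by (auto simp: PiE_UNIV_domain)
    qed
    ultimately show "m \<in> (\<lambda>f. \<chi> i. real_of_int (f i)) ` ?P" by (rule image_eqI)
  qed
  show "finite ((\<lambda>f. \<chi> i. real_of_int (f i) :: real^'n) ` ?P)"
    by (intro finite_imageI finite_PiE) auto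
qed

lemma int_ball_uminus: "m \<in> int_ball R \<Longrightarrow> - m \<in> int_ball R"
  by (auto simp: int_ball_def int_vectors_def)

lemma bounded_floor_int_ball:
  fixes S :: "(real^'n) set"
  assumes "bounded S"
  obtains R where "\<And>y. y \<in> S \<Longrightarrow> floor_vec y \<in> int_ball R"
proof -
  obtain b where b: "\<And>y. y \<in> S \<Longrightarrow> norm y \<le> b" using assms by (auto simp: bounded_iff)
  \<comment> \<open>The extra 1 is for negative coordinates, whose floor may lie almost 1 below
    \<open>- b\<close>.\<close>
  obtain R :: nat where R: "b + 1 \<le> R" using real_arch_simple by blast
  have "floor_vec y \<in> int_ball R" if "y \<in> S" for y
  proof -
    have "\<bar>of_int \<lfloor>y $ i\<rfloor>\<bar> \<le> real R" for i
    proof -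
      have "\<bar>y $ i\<bar> \<le> b" using b[OF that] component_le_norm_cart[of y i] by linarith
      then show ?thesis using R by linarith
    qed
    then show ?thesis by (simp add: int_ball_def) (simp add: floor_vec_def)
  qed
  then show thesis by (rule that)
qed

lemma countable_int_vectors: "countable (int_vectors :: (real^'n) set)"
proof -
  have "int_vectors \<subseteq> (\<Union>R. int_ball R :: (real^'n) set)"
  proof
    fix m :: "real^'n" assume m: "m \<in> int_vectors"
    obtain R where "\<And>y. y \<in> {m} \<Longrightarrow> floor_vec y \<in> int_ball R"
      using bounded_floor_int_ball[of "{m}"] by auto
    moreover have "floor_vec m = m" using m by (simp add: floor_vec_eq_iff unit_cube_def)
    ultimately show "m \<in> (\<Union>R. int_ball R)" by auto
  qed
  then show ?thesis by (rule countable_subset) (rule countable_UN, auto intro: countable_finite)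
qed

text \<open>The integer translates of the half-open cube tile the space, each \<open>y\<close> lying
  in the translate by \<open>floor_vec y\<close>. The support condition leaves finitely many of
  them, so sum and integral commute without a convergence argument.\<close>

lemma integral_unfold_cube:
  fixes f :: "real^'n \<Rightarrow> 'b::{banach, second_countable_topology}"
  assumes f: "integrable lborel f" and K: "finite K" "K \<subseteq> int_vectors"
    and supp: "\<And>y. f y \<noteq> 0 \<Longrightarrow> floor_vec y \<in> K"
  shows "integral\<^sup>L lborel f = (LINT z|cube_measure. (\<Sum>m\<in>K. f (z + m)))"
proof -
  have [measurable]: "f \<in> borel_measurable borel" using borel_measurable_integrable[OF f] by simp
  have fy: "f y = (\<Sum>m\<in>K. indicator unit_cube (y - m) *\<^sub>R f y)" for y
  proof -
    have "(\<Sum>m\<in>K. indicator unit_cube (y - m) *\<^sub>R f y) = (\<Sum>m\<in>K. if m = floor_vec y then f y else 0)"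
      using K(2) by (intro sum.cong refl) (auto simp: indicator_def floor_vec_eq_iff[symmetric])
    then show ?thesis using K(1) supp[of y] by auto
  qed
  have i: "integrable lborel (\<lambda>y. indicator unit_cube (y - m) *\<^sub>R f y)" for m
    using f by (rule Bochner_Integration.integrable_bound) (auto simp: indicator_def)
  have shift: "indicator unit_cube (m + z - m) *\<^sub>R f (m + z) = indicator unit_cube z *\<^sub>R f (z + m)" for m z
    by (simp add: add.commute)
  have im: "integrable cube_measure (\<lambda>z. f (z + m))" for m
    using integrable_lborel_translate[OF i, of m m] unfolding shift
    by (simp add: cube_measure_def integrable_restrict_space)
  have "integral\<^sup>L lborel f = (\<Sum>m\<in>K. LINT y|lborel. indicator unit_cube (y - m) *\<^sub>R f y)"
    by (subst fy[abs_def], subst Bochner_Integration.integral_sum) (auto intro: i)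
  also have "\<dots> = (\<Sum>m\<in>K. LINT z|cube_measure. f (z + m))"
  proof (intro sum.cong refl)
    fix m
    have "(LINT y|lborel. indicator unit_cube (y - m) *\<^sub>R f y) = (LINT z|lborel. indicator unit_cube (m + z - m) *\<^sub>R f (m + z))"
      by (rule integral_lborel_translate) measurable
    then show "(LINT y|lborel. indicator unit_cube (y - m) *\<^sub>R f y) = (LINT z|cube_measure. f (z + m))"
      unfolding shift by (simp add: cube_measure_def integral_restrict_space)
  qed
  also have "\<dots> = (LINT z|cube_measure. (\<Sum>m\<in>K. f (z + m)))"
    by (rule Bochner_Integration.integral_sum[symmetric]) (rule im)
  finally show ?thesis .
qed

lemma borel_measurable_torus_char [measurable]: "torus_char k \<in> borel_measurable borel"
  unfolding torus_char_def by measurable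

lemma torus_char_int:
  assumes "k \<in> int_vectors" "m \<in> int_vectors"
  shows "torus_char k m = 1"
proof -
  have "k \<bullet> m \<in> \<int>"
    unfolding inner_vec_def using assms by (intro Ints_sum) (auto simp: int_vectors_def)
  then show ?thesis by (auto simp: torus_char_def elim!: Ints_cases intro: cis_multiple_2pi)
qed

lemma torus_char_plus: "torus_char k (z + m) = torus_char k z * torus_char k m"
  by (simp add: torus_char_def cis_mult inner_add_right distrib_left)

lemma torus_char_uminus: "torus_char (- k) z = cnj (torus_char k z)"
  by (simp add: torus_char_def cis_cnj)

lemma borel_measurable_cnj_torus_char [measurable]: "(\<lambda>z. cnj (torus_char k z)) \<in> borel_measurable borel"
  by (simp flip: torus_char_uminus)

lemma integrable_cube_bounded:
  fixes f :: "real^'n \<Rightarrow> 'b::{banach, second_countable_topology}"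
  assumes "f \<in> borel_measurable borel" "\<And>z. norm (f z) \<le> B"
  shows "integrable cube_measure f"
proof -
  interpret C: prob_space "cube_measure :: (real^'n) measure" by (rule prob_space_cube_measure)
  show ?thesis
    using assms by (intro C.integrable_const_bound[of _ B] cube_measure_measurable) auto
qed

lemma bounded_unit_cube: "bounded (unit_cube :: (real^'n) set)"
proof (rule bounded_subset[OF bounded_cbox])
  show "unit_cube \<subseteq> cbox 0 (1 :: real^'n)"
    by (auto simp: unit_cube_def mem_box_cart less_imp_le)
qed

text \<open>Translation by half a period of the character changes its sign.\<close>

lemma integral_torus_char:
  assumes k: "k \<in> int_vectors" and "k \<noteq> 0"
  shows "(LINT z|cube_measure. torus_char k z) = 0"
proof -
  obtain j where j: "k $ j \<noteq> 0" using \<open>k \<noteq> 0\<close> by (auto simp: vec_eq_iff)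
  define v where "v = axis j (1 / (2 * k $ j))"
  have kv: "torus_char k v = -1" using j by (simp add: torus_char_def v_def inner_axis)
  \<comment> \<open>The integral of the character over the cube shifted by \<open>v\<close> is
    computed twice: translation gives minus the integral over the cube, unfolding and periodicity
    give plus that integral.\<close>
  let ?f = "\<lambda>y. indicator unit_cube (y - v) *\<^sub>R torus_char k y"
  have "bounded ((\<lambda>y. v + y) ` unit_cube)" by (intro bounded_translation bounded_unit_cube)
  then obtain R where R: "\<And>y. y \<in> (\<lambda>y. v + y) ` unit_cube \<Longrightarrow> floor_vec y \<in> int_ball R"
    using bounded_floor_int_ball by blast
  have supp: "floor_vec y \<in> int_ball R" if "y - v \<in> unit_cube" for y
  proof (rule R)
    have "y = v + (y - v)" by simp
    then show "y \<in> (\<lambda>y. v + y) ` unit_cube" using that by (rule image_eqI)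
  qed
  have fi: "integrable lborel (\<lambda>z. indicator unit_cube z *\<^sub>R torus_char k z)"
    using integrable_cube_bounded[of "torus_char k" 1] by (simp add: cube_measure_def integrable_restrict_space)
  have shift: "?f (v + z) = torus_char k v * (indicator unit_cube z *\<^sub>R torus_char k z)" for z
    by (simp add: torus_char_plus)
  have ff: "?f (v + (- v + y)) = ?f y" for y by simp
  have "integrable lborel (\<lambda>z. ?f (v + z))" unfolding shift by (rule integrable_mult_right) (rule fi)
  from integrable_lborel_translate[OF this, of "- v"] have i: "integrable lborel ?f" unfolding ff .
  have "(LINT y|lborel. ?f y) = (LINT z|lborel. ?f (v + z))"
    by (rule integral_lborel_translate) measurable
  also have "\<dots> = - (LINT z|cube_measure. torus_char k z)"
    unfolding shift kv by (simp add: cube_measure_def integral_restrict_space)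
  finally have 1: "(LINT y|lborel. ?f y) = - (LINT z|cube_measure. torus_char k z)" .
  have "(LINT y|lborel. ?f y) = (LINT z|cube_measure. (\<Sum>m\<in>int_ball R. ?f (z + m)))"
    by (rule integral_unfold_cube[OF i]) (auto simp: int_ball_subset indicator_def split: if_splits intro: supp)
  also have "\<dots> = (LINT z|cube_measure. torus_char k z)"
  proof (rule Bochner_Integration.integral_cong[OF refl])
    fix z :: "real^'a" assume "z \<in> space cube_measure"
    then have z: "z \<in> unit_cube" by simp
    \<comment> \<open>This is the only integer vector whose translate carries \<open>z\<close> into
      the shifted cube.\<close>
    define m0 where "m0 = - floor_vec (z - v)"
    have m0i: "m0 \<in> int_vectors" unfolding m0_def using floor_vec_int[of "z - v"]
      by (simp add: int_vectors_def)
    have eq: "z + m - v \<in> unit_cube \<longleftrightarrow> m = m0" if "m \<in> int_vectors" for m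
    proof -
      have "- m \<in> int_vectors" using that by (simp add: int_vectors_def)
      from floor_vec_eq_iff[OF this, of "z - v"] show ?thesis
        by (auto simp: m0_def algebra_simps)
    qed
    have "floor_vec (z + m0) \<in> int_ball R" using eq[OF m0i] by (intro supp) simp
    moreover have "floor_vec (z + m0) = m0" using z m0i by (simp add: floor_vec_eq_iff)
    ultimately have m0R: "m0 \<in> int_ball R" by simp
    have "(\<Sum>m\<in>int_ball R. ?f (z + m)) = (\<Sum>m\<in>int_ball R. if m = m0 then torus_char k z else 0)"
    proof (intro sum.cong refl)
      fix m :: "real^'a" assume "m \<in> int_ball R"
      then have m: "m \<in> int_vectors" using int_ball_subset by blast
      show "?f (z + m) = (if m = m0 then torus_char k z else 0)"
        using eq[OF m] by (auto simp: torus_char_plus torus_char_int[OF k m])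
    qed
    then show "(\<Sum>m\<in>int_ball R. ?f (z + m)) = torus_char k z" using m0R by simp
  qed
  finally show ?thesis using 1 by (simp add: eq_neg_iff_add_eq_0)
qed

lemma integral_torus_char_cnj:
  assumes "k \<in> int_vectors" "l \<in> int_vectors"
  shows "(LINT z|cube_measure. torus_char k z * cnj (torus_char l z)) = (if k = l then 1 else 0)"
proof -
  interpret C: prob_space "cube_measure :: (real^'a) measure" by (rule prob_space_cube_measure)
  have eq: "torus_char k z * cnj (torus_char l z) = torus_char (k - l) z" for z
    using torus_char_add[of k "- l" z] by (simp add: torus_char_uminus)
  have "k - l \<in> int_vectors" using assms by (simp add: int_vectors_def)
  then show ?thesis
    unfolding eq using integral_torus_char[of "k - l"] C.prob_space by (auto simp: torus_char_def[of 0])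
qed

section \<open>Bessel's inequality and Parseval's identity\<close>

context
  fixes f :: "real^'n \<Rightarrow> real" and B :: real and c :: "real^'n \<Rightarrow> complex"
  assumes f [measurable]: "f \<in> borel_measurable borel" and B: "\<And>z. \<bar>f z\<bar> \<le> B"
  defines "c \<equiv> \<lambda>k. LINT z|cube_measure. of_real (f z) * cnj (torus_char k z)"
begin

text \<open>Expand the square, use orthonormality of the characters and complete the square in the
  coefficients. With \<open>a = c\<close> this is Bessel's inequality; for every other choice the
  last sum is the excess over the minimal distance.\<close>

lemma trig_distance:
  assumes K: "finite K" "K \<subseteq> int_vectors"
  shows "(LINT z|cube_measure. (norm (of_real (f z) - (\<Sum>k\<in>K. a k * torus_char k z)))\<^sup>2)
    = (LINT z|cube_measure. (f z)\<^sup>2) - (\<Sum>k\<in>K. (norm (c k))\<^sup>2) + (\<Sum>k\<in>K. (norm (c k - a k))\<^sup>2)"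
proof -
  let ?I = "integral\<^sup>L cube_measure :: _ \<Rightarrow> complex"
  have B0: "0 \<le> B" using B[of 0] by simp
  have i1: "integrable cube_measure (\<lambda>z. complex_of_real ((f z)\<^sup>2))"
    using B power_mono[OF B abs_ge_zero, of _ 2] by (intro integrable_cube_bounded[of _ "B\<^sup>2"]) (auto simp: norm_power)
  have i2: "integrable cube_measure (\<lambda>z. of_real (f z) * cnj (torus_char k z))" for k
    using B by (intro integrable_cube_bounded[of _ B]) (auto simp: norm_mult)
  have i3: "integrable cube_measure (\<lambda>z. of_real (f z) * torus_char k z)" for k
    using B by (intro integrable_cube_bounded[of _ B]) (auto simp: norm_mult)
  have i4: "integrable cube_measure (\<lambda>z. torus_char k z * cnj (torus_char l z))" for k l
    by (intro integrable_cube_bounded[of _ 1]) (auto simp: norm_mult)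
  have c': "?I (\<lambda>z. of_real (f z) * torus_char k z) = cnj (c k)" for k
    using Bochner_Integration.integral_cnj[of cube_measure "\<lambda>z. of_real (f z) * cnj (torus_char k z)"] by (simp add: c_def)
  have ex: "complex_of_real ((norm (of_real (f z) - (\<Sum>k\<in>K. a k * torus_char k z)))\<^sup>2)
      = of_real ((f z)\<^sup>2) - (\<Sum>k\<in>K. cnj (a k) * (of_real (f z) * cnj (torus_char k z)))
        - (\<Sum>k\<in>K. a k * (of_real (f z) * torus_char k z))
        + (\<Sum>k\<in>K. \<Sum>l\<in>K. a k * cnj (a l) * (torus_char k z * cnj (torus_char l z)))" for z
    unfolding complex_norm_square
    by (simp add: algebra_simps sum_product sum_distrib_left power2_eq_square) (rule sum.swap)
  have "complex_of_real (LINT z|cube_measure. (norm (of_real (f z) - (\<Sum>k\<in>K. a k * torus_char k z)))\<^sup>2)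
      = ?I (\<lambda>z. complex_of_real ((norm (of_real (f z) - (\<Sum>k\<in>K. a k * torus_char k z)))\<^sup>2))"
    by (rule integral_complex_of_real[symmetric])
  also have "\<dots> = ?I (\<lambda>z. of_real ((f z)\<^sup>2)) - (\<Sum>k\<in>K. cnj (a k) * c k) - (\<Sum>k\<in>K. a k * cnj (c k))
      + (\<Sum>k\<in>K. \<Sum>l\<in>K. a k * cnj (a l) * (if k = l then 1 else 0))"
    unfolding ex
  proof (rule has_bochner_integral_integral_eq,
      intro has_bochner_integral_add has_bochner_integral_diff has_bochner_integral_sum has_bochner_integral_mult_right)
    show "has_bochner_integral cube_measure (\<lambda>z. complex_of_real ((f z)\<^sup>2)) (?I (\<lambda>z. of_real ((f z)\<^sup>2)))"
      using i1 by (rule has_bochner_integral_integrable)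
    show "has_bochner_integral cube_measure (\<lambda>z. of_real (f z) * cnj (torus_char k z)) (c k)" for k
      unfolding c_def using i2 by (rule has_bochner_integral_integrable)
    show "has_bochner_integral cube_measure (\<lambda>z. of_real (f z) * torus_char k z) (cnj (c k))" for k
      using has_bochner_integral_integrable[OF i3] unfolding c' .
    show "has_bochner_integral cube_measure (\<lambda>z. torus_char k z * cnj (torus_char l z)) (if k = l then 1 else 0)"
      if "k \<in> K" "l \<in> K" for k l
      using has_bochner_integral_integrable[OF i4, of k l] integral_torus_char_cnj[of k l] that subsetD[OF K(2)] by simp
  qed
  also have "\<dots> = of_real ((LINT z|cube_measure. (f z)\<^sup>2) - (\<Sum>k\<in>K. (norm (c k))\<^sup>2) + (\<Sum>k\<in>K. (norm (c k - a k))\<^sup>2))"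
    using K(1)
    by (simp add: complex_norm_square algebra_simps sum.distrib sum_subtractf if_distrib cong: if_cong del: of_real_power)
  finally show ?thesis by (simp only: of_real_eq_iff)
qed

text \<open>Bessel bounds all finite sums from above. A trigonometric polynomial close to
  \<open>f\<close> provides a finite set \<open>K\<close> whose sum is within \<open>e\<close> of
  the full norm, and monotonicity extends this to every finite set containing
  \<open>K\<close>.\<close>

lemma parseval_cube:
  "((\<lambda>k. (norm (c k))\<^sup>2) has_sum (LINT z|cube_measure. (f z)\<^sup>2)) int_vectors"
proof -
  let ?S = "LINT z|cube_measure. (f z)\<^sup>2"
  have bessel: "(\<Sum>k\<in>K. (norm (c k))\<^sup>2) \<le> ?S" if "finite K" "K \<subseteq> int_vectors" for K
  proof -
    have "0 \<le> (LINT z|cube_measure. (norm (of_real (f z) - (\<Sum>k\<in>K. c k * torus_char k z)))\<^sup>2)" by simp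
    also have "\<dots> = ?S - (\<Sum>k\<in>K. (norm (c k))\<^sup>2)" using trig_distance[OF that, of c] by simp
    finally show ?thesis by simp
  qed
  show ?thesis
    unfolding has_sum_def
  proof (rule tendstoI)
    fix e :: real assume "e > 0"
    then obtain p where p: "trig_polynomial p" "(LINT z|cube_measure. (f z - p z)\<^sup>2) < e"
      using trig_polynomial_dense[OF f B] by blast
    then obtain K a where K: "finite K" "K \<subseteq> int_vectors" "\<And>z. complex_of_real (p z) = (\<Sum>k\<in>K. a k * torus_char k z)"
      by (auto simp: trig_polynomial_def)
    have "(norm (of_real (f z) - (\<Sum>k\<in>K. a k * torus_char k z)))\<^sup>2 = (f z - p z)\<^sup>2" for z
      unfolding K(3)[symmetric] by (simp flip: of_real_diff)
    then have "?S - (\<Sum>k\<in>K. (norm (c k))\<^sup>2) + (\<Sum>k\<in>K. (norm (c k - a k))\<^sup>2) < e"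
      using p(2) trig_distance[OF K(1,2), of a] by simp
    moreover have "(\<Sum>k\<in>K. (norm (c k - a k))\<^sup>2) \<ge> 0" by (intro sum_nonneg) simp
    ultimately have lower: "?S - (\<Sum>k\<in>K. (norm (c k))\<^sup>2) < e" by linarith
    show "\<forall>\<^sub>F L in finite_subsets_at_top int_vectors. dist (\<Sum>k\<in>L. (norm (c k))\<^sup>2) ?S < e"
      unfolding eventually_finite_subsets_at_top
    proof (intro exI[of _ K] conjI allI impI K(1,2))
      fix L assume L: "finite L \<and> K \<subseteq> L \<and> L \<subseteq> int_vectors"
      then have "(\<Sum>k\<in>K. (norm (c k))\<^sup>2) \<le> (\<Sum>k\<in>L. (norm (c k))\<^sup>2)" by (intro sum_mono2) auto
      with bessel[of L] L lower show "dist (\<Sum>k\<in>L. (norm (c k))\<^sup>2) ?S < e"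
        by (auto simp: dist_real_def)
    qed
  qed
qed

end

lemma matrix_vector_mult_minus: "A *v (- x) = - (A *v x)" for A :: "real^'n^'m"
  by (rule linear_neg[OF matrix_vector_mul_linear])

section \<open>The Fourier transform of a set and the variance of lattice counts\<close>

definition ft_indicator :: "'a::euclidean_space set \<Rightarrow> 'a \<Rightarrow> complex" where
  "ft_indicator D \<xi> = (LINT x|lborel. indicator D x * phase x \<xi>)"

lemma integrable_indicator_cis:
  fixes D :: "'a::euclidean_space set"
  assumes "bounded D" "D \<in> sets borel"
  shows "integrable lborel (\<lambda>x. indicator D x * phase x \<xi> :: complex)"
proof -
  have "emeasure lborel D < \<infinity>" using assms(1) by (rule emeasure_bounded_finite)
  then have "integrable lborel (\<lambda>x. indicator D x :: real)"
    using assms by (intro integrable_real_indicator) auto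
  moreover have "(\<lambda>x. indicator D x * phase x \<xi> :: complex) \<in> borel_measurable lborel"
    using assms(2) by measurable
  ultimately show ?thesis
    by (rule Bochner_Integration.integrable_bound) (auto simp: norm_mult indicator_def)
qed

lemma cnj_indicator: "cnj (indicator D x) = indicator D x"
  by (simp add: indicator_def)

lemma ft_indicator_uminus: "ft_indicator D (- \<xi>) = cnj (ft_indicator D \<xi>)"
  unfolding ft_indicator_def
  by (subst Bochner_Integration.integral_cnj[symmetric]) (simp add: cis_cnj cnj_indicator del: Bochner_Integration.integral_cnj)

text \<open>The Fourier coefficients of the periodic counting function are obtained by unfolding
  the integral over the unit cube to the whole space.\<close>

lemma
  fixes B :: "real^'n^'n" and D :: "(real^'n) set"
  assumes B: "invertible B" and D: "bounded D" "D \<in> sets borel"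
  defines "N \<equiv> \<lambda>z. real (card {m \<in> int_vectors. B *v (m - z) \<in> D})"
  defines "\<beta> \<equiv> inverse \<bar>det B\<bar>"
  shows lattice_count_measurable: "\<exists>f\<in>borel_measurable borel. \<forall>z\<in>unit_cube. N z = f z" (is ?A)
    and lattice_variance: "((\<lambda>k. \<beta>\<^sup>2 * (norm (ft_indicator D (k v* matrix_inv B)))\<^sup>2)
      has_sum (LINT z|cube_measure. (N z - \<beta> * measure lborel D)\<^sup>2)) (int_vectors - {0})" (is ?B)
proof -
  interpret C: prob_space "cube_measure :: (real^'n) measure" by (rule prob_space_cube_measure)
  have [measurable]: "D \<in> sets borel" by fact
  note inv = invertible_inverse_mult[OF B]
  have detB: "det B \<noteq> 0" using B invertible_det_nz by blast
  \<comment> \<open>The preimage of \<open>D\<close> under \<open>y \<mapsto> - (B *v y)\<close>. It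
    is bounded, so it meets only finitely many integer translates of the cube.\<close>
  let ?S = "(\<lambda>x. - (matrix_inv B *v x)) ` D"
  have "bounded ?S"
    using bounded_linear_image[OF D(1), of "\<lambda>x. - (matrix_inv B *v x)"]
    by (simp add: bounded_linear_minus matrix_vector_mul_bounded_linear)
  then obtain R where R: "\<And>y. y \<in> ?S \<Longrightarrow> floor_vec y \<in> int_ball R"
    using bounded_floor_int_ball by blast
  have supp: "floor_vec y \<in> int_ball R" if "- (B *v y) \<in> D" for y
  proof (rule R)
    have "y = - (matrix_inv B *v (- (B *v y)))"
      by (simp add: matrix_vector_mul_assoc inv matrix_vector_mult_minus)
    then show "y \<in> ?S" using that by (rule image_eqI)
  qed
  let ?K = "int_ball R :: (real^'n) set"
  \<comment> \<open>A finite sum of indicators, bounded and Borel on the whole space. It is compared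
    with the count on the unit cube only, since \<open>?K\<close> is chosen for that cube.\<close>
  define f where "f z = (\<Sum>m\<in>?K. indicat_real D (B *v (m - z)))" for z
  have [measurable]: "f \<in> borel_measurable borel" unfolding f_def by measurable
  have f0: "0 \<le> f z" for z unfolding f_def by (intro sum_nonneg) auto
  have "f z \<le> (\<Sum>m\<in>?K. 1)" for z unfolding f_def by (intro sum_mono) (auto simp: indicator_def)
  then have fB: "\<bar>f z\<bar> \<le> real (card ?K)" for z using f0[of z] by simp
  have Nf: "N z = f z" if z: "z \<in> unit_cube" for z
  proof -
    have "m \<in> ?K" if "m \<in> int_vectors" "B *v (m - z) \<in> D" for m
    proof -
      have mi: "- m \<in> int_vectors" using that by (simp add: int_vectors_def)
      have "floor_vec (z - m) \<in> ?K"
        using that by (intro supp) (simp add: matrix_vector_mult_diff_distrib)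
      moreover have "floor_vec (z - m) = - m" using floor_vec_eq_iff[OF mi, of "z - m"] z by simp
      ultimately show ?thesis using int_ball_uminus[of "- m" R] by simp
    qed
    then have "{m \<in> int_vectors. B *v (m - z) \<in> D} = {m \<in> ?K. B *v (m - z) \<in> D}"
      using int_ball_subset by auto
    then show ?thesis
      by (simp add: N_def f_def indicator_def sum.If_cases Int_def)
  qed
  show ?A using Nf by (intro bexI[of _ f]) auto
  define c where "c k = (LINT z|cube_measure. of_real (f z) * cnj (torus_char k z))" for k
  have c: "c k = \<beta> * cnj (ft_indicator D (k v* matrix_inv B))" if k: "k \<in> int_vectors" for k
  proof -
    let ?g = "\<lambda>x. indicator D x * phase x (- (k v* matrix_inv B)) :: complex"
    \<comment> \<open>A hit is a condition on \<open>m - z\<close>, while unfolding produces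
      \<open>z + m\<close>. The reflection in \<open>?h\<close>, together with reindexing the sum by
      \<open>- m\<close>, reconciles the two.\<close>
    let ?h = "\<lambda>y. indicator D (- (B *v y)) * cnj (torus_char k y) :: complex"
    have gi: "integrable lborel ?g" by (rule integrable_indicator_cis) (use D in auto)
    then have gm[measurable]: "?g \<in> borel_measurable borel" using borel_measurable_integrable by force
    have gh: "?g (B *v ((-1) *\<^sub>R y)) = ?h y" for y
    proof -
      have "(B *v y) \<bullet> (k v* matrix_inv B) = y \<bullet> k"
        by (subst inner_commute, subst dot_lmul_matrix) (simp add: matrix_vector_mul_assoc inv inner_commute)
      then show ?thesis
        by (simp add: matrix_vector_mult_minus torus_char_def cis_cnj inner_commute)
    qed
    have Bi: "integrable lborel (\<lambda>y. ?g (B *v y))" by (rule integrable_lborel_matrix[OF B gi])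
    have hi: "integrable lborel ?h"
      using integrable_lborel_scaleR[of "-1", OF _ Bi] unfolding gh by simp
    have m[measurable]: "(\<lambda>y. ?g (B *v y)) \<in> borel_measurable borel" by measurable
    have "c k = (LINT z|cube_measure. (\<Sum>m\<in>?K. ?h (z + m)))"
      unfolding c_def
    proof (rule Bochner_Integration.integral_cong[OF refl])
      fix z :: "real^'n"
      have "of_real (f z) * cnj (torus_char k z) = (\<Sum>m\<in>?K. indicator D (B *v (m - z)) * cnj (torus_char k z))"
        unfolding f_def of_real_sum sum_distrib_right by (simp only: of_real_indicator)
      also have "\<dots> = (\<Sum>m\<in>?K. indicator D (B *v (- m - z)) * cnj (torus_char k z))"
        by (rule sum.reindex_bij_witness[of _ uminus uminus]) (auto intro: int_ball_uminus)
      also have "\<dots> = (\<Sum>m\<in>?K. ?h (z + m))"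
      proof (intro sum.cong refl)
        fix m assume "m \<in> ?K"
        then have "m \<in> int_vectors" using int_ball_subset by blast
        moreover have "B *v (- m - z) = - (B *v (z + m))"
          unfolding matrix_vector_mult_minus[symmetric] by (rule arg_cong[of _ _ "(*v) B"]) simp
        ultimately show "indicator D (B *v (- m - z)) * cnj (torus_char k z) = ?h (z + m)"
          using k by (simp add: torus_char_plus torus_char_int)
      qed
      finally show "of_real (f z) * cnj (torus_char k z) = (\<Sum>m\<in>?K. ?h (z + m))" .
    qed
    also have "\<dots> = integral\<^sup>L lborel ?h"
      by (rule integral_unfold_cube[OF hi, symmetric])
         (auto simp: int_ball_subset indicator_def split: if_splits intro: supp)
    also have "\<dots> = (LINT y|lborel. ?g (B *v y))"
      using integral_lborel_scaleR[of "-1", OF _ m] unfolding gh by simp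
    also have "\<dots> = \<beta> * integral\<^sup>L lborel ?g"
      using detB by (subst integral_lborel_matrix[OF B gm]) (simp_all add: \<beta>_def scaleR_conv_of_real)
    also have "integral\<^sup>L lborel ?g = cnj (ft_indicator D (k v* matrix_inv B))"
      by (simp only: ft_indicator_uminus[symmetric]) (simp add: ft_indicator_def)
    finally show ?thesis .
  qed
  have ft0: "ft_indicator D 0 = measure lborel D"
  proof -
    have "ft_indicator D 0 = (LINT x|lborel. complex_of_real (indicat_real D x))"
      unfolding ft_indicator_def of_real_indicator by simp
    then show ?thesis unfolding integral_complex_of_real by simp
  qed
  have zero: "(0::real^'n) \<in> int_vectors" by (simp add: int_vectors_def)
  have c0: "c 0 = of_real (\<beta> * measure lborel D)"
    using c[OF zero] by (simp add: ft0)
  have If: "(LINT z|cube_measure. f z) = \<beta> * measure lborel D"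
  proof -
    have "complex_of_real (LINT z|cube_measure. f z) = c 0"
      unfolding c_def by (simp add: torus_char_def)
    then show ?thesis unfolding c0 by (simp only: of_real_eq_iff)
  qed
  have "((\<lambda>k. (norm (c k))\<^sup>2) has_sum (LINT z|cube_measure. (f z)\<^sup>2)) int_vectors"
    unfolding c_def by (rule parseval_cube[OF _ fB]) simp
  \<comment> \<open>The coefficient at 0 is the mean of the count, so removing it subtracts the
    squared mean and leaves the variance.\<close>
  then have "((\<lambda>k. (norm (c k))\<^sup>2) has_sum ((LINT z|cube_measure. (f z)\<^sup>2) - (\<beta> * measure lborel D)\<^sup>2)) (int_vectors - {0})"
    using zero by (intro has_sum_Diff) (auto simp: c0 has_sum_finite_iff norm_mult power_mult_distrib)
  moreover have "(LINT z|cube_measure. (f z)\<^sup>2) - (\<beta> * measure lborel D)\<^sup>2 = (LINT z|cube_measure. (N z - \<beta> * measure lborel D)\<^sup>2)"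
  proof -
    have i1: "integrable cube_measure (\<lambda>z. (f z)\<^sup>2)"
      using power_mono[OF fB abs_ge_zero, of _ 2] by (intro integrable_cube_bounded[of _ "(real (card ?K))\<^sup>2"]) auto
    have i2: "integrable cube_measure f"
      using fB by (intro integrable_cube_bounded[of _ "real (card ?K)"]) auto
    have "(LINT z|cube_measure. (N z - \<beta> * measure lborel D)\<^sup>2)
        = (LINT z|cube_measure. (f z)\<^sup>2 - 2 * (\<beta> * measure lborel D) * f z + (\<beta> * measure lborel D)\<^sup>2)"
      by (intro Bochner_Integration.integral_cong refl) (simp add: Nf power2_diff algebra_simps)
    also have "\<dots> = (LINT z|cube_measure. (f z)\<^sup>2) - 2 * (\<beta> * measure lborel D) * (LINT z|cube_measure. f z) + (\<beta> * measure lborel D)\<^sup>2"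
      using i1 i2 C.prob_space by (simp del: space_cube_measure)
    finally show ?thesis unfolding If by (simp add: power2_eq_square)
  qed
  moreover have "(norm (c k))\<^sup>2 = \<beta>\<^sup>2 * (norm (ft_indicator D (k v* matrix_inv B)))\<^sup>2" if "k \<in> int_vectors - {0}" for k
    using that by (simp add: c norm_mult power_mult_distrib)
  then have "((\<lambda>k. (norm (c k))\<^sup>2) has_sum S) (int_vectors - {0})
      \<longleftrightarrow> ((\<lambda>k. \<beta>\<^sup>2 * (norm (ft_indicator D (k v* matrix_inv B)))\<^sup>2) has_sum S) (int_vectors - {0})" for S
    by (rule has_sum_cong)
  ultimately show ?B by simp
qed

section \<open>A Tauberian theorem for Gaussian kernels\<close>

lemma integrable_gaussian: "integrable lborel (\<lambda>x::'a::euclidean_space. gauss x)"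
  and integral_gaussian: "(LINT x|lborel. gauss (x::'a)) = 1"
proof -
  have i: "integrable lborel (\<lambda>x::'a. complex_of_real (gauss x))"
    using gaussian_fourier(1)[of "0::'a"] by simp
  then show "integrable lborel (\<lambda>x::'a. gauss x)"
    using integrable_Re[OF i] by simp
  have "complex_of_real (LINT x|lborel. gauss (x::'a)) = 1"
    using gaussian_fourier(2)[of "0::'a"] by (simp flip: integral_complex_of_real)
  then show "(LINT x|lborel. gauss (x::'a)) = 1"
    by (simp only: of_real_eq_1_iff)
qed

text \<open>Half of the full Gaussian integral after scaling by \<open>sqrt a\<close>. Pushing
  forward under the norm of the line performs the folding; the factor 2 is the length of the
  one-dimensional unit ball.\<close>

lemma nn_integral_gaussian_half_line:
  assumes "0 < a"
  shows "(\<integral>\<^sup>+s. ennreal (exp (- (pi * a * s\<^sup>2))) * indicator {0<..} s \<partial>lborel) = ennreal (1 / (2 * sqrt a))"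
proof -
  define I where "I = (\<integral>\<^sup>+s. ennreal (exp (- (pi * a * s\<^sup>2))) * indicator {0<..} s \<partial>lborel)"
  have "(\<integral>\<^sup>+x. ennreal (gauss (x::real)) \<partial>lborel) = 1"
    by (subst nn_integral_eq_integral) (auto simp: integrable_gaussian[where 'a=real, simplified] integral_gaussian[where 'a=real, simplified])
  then have "1 = \<bar>sqrt a\<bar> * (\<integral>\<^sup>+x. ennreal (gauss (0 + sqrt a * x :: real)) \<partial>lborel)"
    using assms by (subst (asm) nn_integral_real_affine[where c="sqrt a" and t=0]) auto
  also have "(\<integral>\<^sup>+x. ennreal (gauss (0 + sqrt a * x :: real)) \<partial>lborel)
      = (\<integral>\<^sup>+x. ennreal (exp (- (pi * a * (norm (x::real))\<^sup>2))) \<partial>lborel)"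
    using assms by (simp add: power_mult_distrib mult_ac)
  also have "\<dots> = (\<integral>\<^sup>+s. 2 * (ennreal (exp (- (pi * a * s\<^sup>2))) * indicator {0<..} s) \<partial>lborel)"
  proof -
    have "(\<integral>\<^sup>+x. ennreal (exp (- (pi * a * (norm (x::real))\<^sup>2))) \<partial>lborel)
        = (\<integral>\<^sup>+s. ennreal (exp (- (pi * a * s\<^sup>2))) \<partial>distr (lborel :: real measure) borel norm)"
      by (subst nn_integral_distr) auto
    also have "\<dots> = (\<integral>\<^sup>+s. 2 * (ennreal (exp (- (pi * a * s\<^sup>2))) * indicator {0<..} s) \<partial>lborel)"
      unfolding distr_norm_lborel
      by (subst nn_integral_density) (auto intro!: nn_integral_cong simp: ennreal_mult mult_ac indicator_def)
    finally show ?thesis .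
  qed
  also have "\<dots> = 2 * I" unfolding I_def by (rule nn_integral_cmult) simp
  finally have *: "1 = ennreal (2 * sqrt a) * I"
    using assms by (simp add: ennreal_mult mult_ac)
  have "ennreal (1 / (2 * sqrt a)) = ennreal (1 / (2 * sqrt a)) * (ennreal (2 * sqrt a) * I)"
    using * by simp
  also have "\<dots> = I"
    using assms by (simp add: mult.assoc[symmetric] ennreal_mult[symmetric])
  finally show ?thesis by (simp add: I_def)
qed

abbreviation pos_lborel :: "real measure" where
  "pos_lborel \<equiv> restrict_space lborel {0<..}"

lemma integrable_pos_indicator: "integrable pos_lborel (indicat_real {0<..1})"
  and integral_pos_indicator: "(LINT s|pos_lborel. indicat_real {0<..1} s) = 1"
proof -
  have eq: "indicat_real {0<..} s * indicat_real {0<..1} s = indicat_real {0<..1} s" for s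
    by (simp add: indicator_def)
  show "integrable pos_lborel (indicat_real {0<..1})"
    by (subst integrable_restrict_space) (auto simp: eq intro!: integrable_real_indicator)
  show "(LINT s|pos_lborel. indicat_real {0<..1} s) = 1"
    by (subst integral_restrict_space) (auto simp: eq)
qed

text \<open>The denominator is the price for raising the radial power from \<open>d - 1\<close> to
  \<open>d + 1\<close>. The difference in the numerator makes the kernel bounded near 0, where it
  tends to \<open>pi * (b - a)\<close>; the value 0 at \<open>s = 0\<close> itself is an artefact of
  division by zero and lies outside the half-line of integration.\<close>

definition gauss_kernel :: "real \<Rightarrow> real \<Rightarrow> real \<Rightarrow> real" where
  "gauss_kernel a b s = (exp (- (pi * a * s\<^sup>2)) - exp (- (pi * b * s\<^sup>2))) / s\<^sup>2"

lemma borel_measurable_gauss_kernel [measurable]: "gauss_kernel a b \<in> borel_measurable borel"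
  unfolding gauss_kernel_def by measurable

lemma pos_lborel_measurable: "f \<in> borel_measurable borel \<Longrightarrow> f \<in> borel_measurable pos_lborel"
  by (intro measurable_restrict_space1) simp

lemma gauss_kernel_nonneg: "a \<le> b \<Longrightarrow> 0 \<le> gauss_kernel a b s"
  by (auto simp: gauss_kernel_def intro!: divide_nonneg_nonneg mult_right_mono mult_left_mono)

text \<open>The kernel is the integral of \<open>pi * exp (- (pi * \<sigma> * s\<^sup>2))\<close>
  over \<sigma> from \<open>a\<close> to \<open>b\<close>. By Tonelli the half-line Gaussian
  integral \<open>1 / (2 * sqrt \<sigma>)\<close> appears inside, and its primitive in \<sigma> is
  \<open>sqrt \<sigma>\<close>.\<close>

lemma
  assumes "0 < a" "a \<le> b"
  shows integrable_gauss_kernel: "integrable pos_lborel (gauss_kernel a b)" (is ?A)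
    and integral_gauss_kernel: "(LINT s|pos_lborel. gauss_kernel a b s) = pi * (sqrt b - sqrt a)" (is ?B)
proof -
  have 1: "ennreal (gauss_kernel a b s) = (\<integral>\<^sup>+\<sigma>. ennreal (pi * exp (- (pi * \<sigma> * s\<^sup>2))) * indicator {a..b} \<sigma> \<partial>lborel)"
    if "s > 0" for s
  proof -
    have "(\<integral>\<^sup>+\<sigma>. ennreal (pi * exp (- (pi * \<sigma> * s\<^sup>2))) * indicator {a..b} \<sigma> \<partial>lborel)
      = ennreal (- exp (- (pi * b * s\<^sup>2)) / s\<^sup>2 - - exp (- (pi * a * s\<^sup>2)) / s\<^sup>2)"
      using that assms by (intro nn_integral_FTC_Icc) (auto intro!: derivative_eq_intros simp: field_simps)
    then show ?thesis by (simp add: gauss_kernel_def diff_divide_distrib)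
  qed
  have "(\<integral>\<^sup>+s. ennreal (gauss_kernel a b s) \<partial>pos_lborel)
      = (\<integral>\<^sup>+s. (\<integral>\<^sup>+\<sigma>. ennreal (pi * exp (- (pi * \<sigma> * s\<^sup>2))) * indicator {a..b} \<sigma> * indicator {0<..} s \<partial>lborel) \<partial>lborel)"
    by (subst nn_integral_restrict_space) (auto intro!: nn_integral_cong simp: 1 indicator_def)
  also have "\<dots> = (\<integral>\<^sup>+\<sigma>. (\<integral>\<^sup>+s. ennreal (pi * exp (- (pi * \<sigma> * s\<^sup>2))) * indicator {a..b} \<sigma> * indicator {0<..} s \<partial>lborel) \<partial>lborel)"
    by (rule lborel_pair.Fubini') measurable
  also have "\<dots> = (\<integral>\<^sup>+\<sigma>. ennreal (pi / (2 * sqrt \<sigma>)) * indicator {a..b} \<sigma> \<partial>lborel)"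
  proof (rule nn_integral_cong)
    fix \<sigma>
    have "(\<integral>\<^sup>+s. ennreal (pi * exp (- (pi * \<sigma> * s\<^sup>2))) * indicator {a..b} \<sigma> * indicator {0<..} s \<partial>lborel)
        = (\<integral>\<^sup>+s. (ennreal pi * indicator {a..b} \<sigma>) * (ennreal (exp (- (pi * \<sigma> * s\<^sup>2))) * indicator {0<..} s) \<partial>lborel)"
      by (intro nn_integral_cong) (simp add: ennreal_mult mult_ac)
    also have "\<dots> = (ennreal pi * indicator {a..b} \<sigma>) * (\<integral>\<^sup>+s. ennreal (exp (- (pi * \<sigma> * s\<^sup>2))) * indicator {0<..} s \<partial>lborel)"
      by (rule nn_integral_cmult) measurable
    also have "\<dots> = ennreal (pi / (2 * sqrt \<sigma>)) * indicator {a..b} \<sigma>"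
    proof (cases "\<sigma> \<in> {a..b}")
      case True
      then have "0 < \<sigma>" using assms by auto
      then show ?thesis using True by (simp add: nn_integral_gaussian_half_line ennreal_mult[symmetric])
    qed simp
    finally show "(\<integral>\<^sup>+s. ennreal (pi * exp (- (pi * \<sigma> * s\<^sup>2))) * indicator {a..b} \<sigma> * indicator {0<..} s \<partial>lborel)
        = ennreal (pi / (2 * sqrt \<sigma>)) * indicator {a..b} \<sigma>" .
  qed
  also have "\<dots> = ennreal (pi * sqrt b - pi * sqrt a)"
    using assms by (intro nn_integral_FTC_Icc) (auto intro!: derivative_eq_intros simp: field_simps)
  finally have I: "(\<integral>\<^sup>+s. ennreal (gauss_kernel a b s) \<partial>pos_lborel) = ennreal (pi * (sqrt b - sqrt a))"
    by (simp add: right_diff_distrib)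
  have m: "gauss_kernel a b \<in> borel_measurable pos_lborel" by (intro pos_lborel_measurable) simp
  show ?A using m assms I gauss_kernel_nonneg[OF assms(2)]
    by (intro integrableI_nonneg) auto
  show ?B using m assms I gauss_kernel_nonneg[OF assms(2)]
    by (subst integral_eq_nn_integral) auto
qed

text \<open>The difference kernels are \<open>v\<^sup>n w\<close> with \<open>v = exp (-\<pi>s\<^sup>2)\<close> and a fixed weight \<open>w\<close>, so by
  Weierstrass their span is dense in \<open>L\<^sup>1\<close>.\<close>

lemma indicator_approx_gauss_kernels:
  assumes "0 < e"
  shows "\<exists>N a. (LINT s|pos_lborel. \<bar>indicator {0<..1} s - (\<Sum>i\<le>(N::nat). a i * gauss_kernel (real (Suc i)) (real (Suc i) + 1) s)\<bar>) < e"
proof -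
  let ?M = pos_lborel
  define v :: "real \<Rightarrow> real" where "v s = exp (- (pi * s\<^sup>2))" for s
  let ?k = "gauss_kernel 1 2"
  \<comment> \<open>Multiplication by \<open>v s\<close> raises both Gaussian parameters by 1.
    Starting from the pair 1, 2 keeps them positive, so the monomial of degree \<open>i\<close>
    belongs to the kernel with index \<open>i + 1\<close>.\<close>
  have vk: "gauss_kernel (real (Suc i)) (real (Suc i) + 1) s = v s ^ i * ?k s" for i s
    by (simp add: gauss_kernel_def v_def exp_of_nat_mult[symmetric] mult_exp_exp algebra_simps diff_divide_distrib add_divide_distrib)
  have kpos: "0 < ?k s" if "s > 0" for s
    using that by (auto simp: gauss_kernel_def intro!: divide_pos_pos)
  have k0: "0 \<le> ?k s" for s by (rule gauss_kernel_nonneg) simp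
  have ki: "integrable ?M ?k" by (rule integrable_gauss_kernel) auto
  have [measurable]: "?k \<in> borel_measurable ?M" "v \<in> borel_measurable ?M" 
    by (auto intro!: pos_lborel_measurable simp: v_def[abs_def])
  have v01: "0 \<le> v s" "v s \<le> 1" for s by (auto simp: v_def)
  define W where "W = (LINT s|?M. ?k s)"
  have W0: "0 \<le> W" unfolding W_def using k0 by simp
  \<comment> \<open>Under this image measure of the half-line weighted by \<open>?k\<close>,
    polynomials in \<open>x = v s\<close> correspond exactly to combinations of the kernels, and L^1
    distances are preserved.\<close>
  define \<nu> where "\<nu> = distr (density ?M (\<lambda>s. ennreal (?k s))) borel v"
  have dens: "integral\<^sup>L \<nu> f = (LINT s|?M. ?k s * f (v s))" (is ?I)
    "integrable \<nu> f \<longleftrightarrow> integrable ?M (\<lambda>s. ?k s * f (v s))" (is ?J)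
    if [measurable]: "f \<in> borel_measurable borel" for f :: "real \<Rightarrow> real"
  proof -
    show ?I unfolding \<nu>_def
      by (subst integral_distr, simp, simp, subst integral_density) (auto simp: k0)
    show ?J unfolding \<nu>_def
      by (subst integrable_distr_eq, simp, simp, subst integrable_density) (auto simp: k0)
  qed
  have "finite_measure \<nu>"
  proof (rule finite_measureI)
    have "emeasure \<nu> (space \<nu>) = emeasure (density ?M (\<lambda>s. ennreal (?k s))) (space ?M)"
      unfolding \<nu>_def by (subst emeasure_distr) auto
    also have "\<dots> = (\<integral>\<^sup>+s. ennreal (?k s) * indicator (space ?M) s \<partial>?M)"
      by (rule emeasure_density[OF _ sets.top]) simp
    also have "\<dots> = (\<integral>\<^sup>+s. ennreal (?k s) \<partial>?M)"
      by (intro nn_integral_cong) auto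
    also have "\<dots> = ennreal W" unfolding W_def using ki k0 by (intro nn_integral_eq_integral) auto
    finally show "emeasure \<nu> (space \<nu>) \<noteq> \<infinity>" by simp
  qed
  moreover have "sets \<nu> = sets borel" by (simp add: \<nu>_def)
  moreover
  \<comment> \<open>The target is divided by the weight \<open>?k\<close>, which is positive for
    \<open>s > 0\<close>, and \<open>f\<close> rewrites the quotient in the variable
    \<open>x\<close> by means of \<open>sqrt (- ln x / pi)\<close>, the inverse of \<open>v\<close>
    on the half-line.\<close>
  define h :: "real \<Rightarrow> real" where "h s = indicator {0<..1} s / ?k s" for s
  define f where "f x = h (sqrt (- ln x / pi))" for x
  have [measurable]: "f \<in> borel_measurable borel" unfolding f_def h_def by measurable
  have fv: "f (v s) = h s" if "s > 0" for s using that by (simp add: f_def v_def)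
  have kf: "?k s * f (v s) = indicator {0<..1} s" if "s > 0" for s
    using that kpos[OF that] by (simp add: fv h_def)
  have ind: "integrable ?M (\<lambda>s. indicator {0<..1} s :: real)"
    by (rule integrable_pos_indicator)
  have "integrable ?M (\<lambda>s. ?k s * f (v s)) \<longleftrightarrow> integrable ?M (\<lambda>s. indicator {0<..1} s :: real)"
    by (intro Bochner_Integration.integrable_cong refl) (simp add: kf)
  then have "integrable \<nu> f" using ind by (simp add: dens)
  ultimately obtain g where g: "continuous_on UNIV g" "integrable \<nu> g" "(LINT x|\<nu>. \<bar>f x - g x\<bar>) < e / 2"
    using integrable_approx_continuous[of \<nu> f "e / 2"] assms by auto
  have [measurable]: "g \<in> borel_measurable borel" using g(1) by (rule borel_measurable_continuous_onI)
  \<comment> \<open>A uniform error \<open>d\<close> on \<open>[0, 1]\<close> costs at most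
    \<open>W * d\<close> in the weighted norm, \<open>W\<close> being the mass of the
    weight.\<close>
  define d where "d = e / (2 * (W + 1))"
  have d: "0 < d" using W0 assms by (simp add: d_def)
  obtain p where p: "real_polynomial_function p" "\<And>x. x \<in> {0..1} \<Longrightarrow> \<bar>g x - p x\<bar> < d"
    using Stone_Weierstrass_real_polynomial_function[of "{0..1}" g d] g(1) d
    by (auto intro: continuous_on_subset)
  obtain a N where pa: "p = (\<lambda>x. \<Sum>i\<le>(N::nat). a i * x ^ i)"
    using real_polynomial_function_imp_sum[OF p(1)] by auto
  let ?K = "\<lambda>s. \<Sum>i\<le>N. a i * gauss_kernel (real (Suc i)) (real (Suc i) + 1) s"
  have Kp: "?K s = ?k s * p (v s)" for s
    unfolding vk pa by (simp add: sum_distrib_left mult_ac)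
  have Ki: "integrable ?M ?K"
    by (intro Bochner_Integration.integrable_sum integrable_mult_right integrable_gauss_kernel) auto
  have gi: "integrable ?M (\<lambda>s. ?k s * \<bar>f (v s) - g (v s)\<bar>)"
    using dens(2)[of "\<lambda>x. \<bar>f x - g x\<bar>"] g(2) \<open>integrable \<nu> f\<close> by simp
  have "(LINT s|?M. \<bar>indicator {0<..1} s - ?K s\<bar>) \<le> (LINT s|?M. ?k s * \<bar>f (v s) - g (v s)\<bar> + ?k s * d)"
  proof (rule integral_mono)
    fix s assume "s \<in> space ?M"
    then have s: "s > 0" by (simp add: space_restrict_space)
    have "\<bar>indicator {0<..1} s - ?K s\<bar> = \<bar>?k s * (f (v s) - p (v s))\<bar>"
      unfolding Kp kf[OF s, symmetric] by (simp add: right_diff_distrib)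
    also have "\<dots> = ?k s * \<bar>f (v s) - p (v s)\<bar>" using k0 by (simp add: abs_mult)
    also have "\<dots> \<le> ?k s * (\<bar>f (v s) - g (v s)\<bar> + d)"
      using p(2)[of "v s"] v01[of s] by (intro mult_left_mono k0) auto
    finally show "\<bar>indicator {0<..1} s - ?K s\<bar> \<le> ?k s * \<bar>f (v s) - g (v s)\<bar> + ?k s * d"
      by (simp add: distrib_left)
  qed (use ind Ki gi ki in auto)
  also have "\<dots> = (LINT x|\<nu>. \<bar>f x - g x\<bar>) + W * d"
    using gi ki by (subst Bochner_Integration.integral_add) (auto simp: dens W_def)
  also have "\<dots> < e"
  proof -
    have "W * d \<le> e / 2" using W0 assms by (simp add: d_def field_simps)
    then show ?thesis using g(3) by linarith
  qed
  finally show ?thesis by blast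
qed

text \<open>Since \<open>G\<close> is bounded by \<open>C\<close>, the functionals sending
  \<open>k\<close> to the integral of \<open>G (T * s) * k s\<close> are Lipschitz in the L^1 norm
  with the same constant for all positive \<open>T\<close>. Convergence on the kernels therefore
  passes to linear combinations and then to the L^1 limit \<open>indicator {0<..1}\<close>, which
  has mass 1.\<close>

theorem gauss_kernel_tauberian:
  fixes G :: "real \<Rightarrow> real"
  assumes [measurable]: "G \<in> borel_measurable borel" and C: "\<And>\<rho>. 0 < \<rho> \<Longrightarrow> \<bar>G \<rho>\<bar> \<le> C"
    and lim: "\<And>n::nat. 0 < n \<Longrightarrow>
      ((\<lambda>T. LINT s|pos_lborel. G (T * s) * gauss_kernel (real n) (real n + 1) s)
        \<longlongrightarrow> c * (LINT s|pos_lborel. gauss_kernel (real n) (real n + 1) s)) at_top"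
  shows "((\<lambda>T. LINT s|pos_lborel. G (T * s) * indicator {0<..1} s) \<longlongrightarrow> c) at_top"
proof (rule tendstoI)
  fix e :: real assume e: "0 < e"
  let ?M = pos_lborel
  have C0: "0 \<le> C" using C[of 1] by simp
  \<comment> \<open>The approximation is paid for twice: \<open>C * d\<close> for replacing the
    indicator under \<open>G\<close>, and \<open>\<bar>c\<bar> * d\<close> because the mass of the
    combination differs from 1. Together they use half of \<open>e\<close>.\<close>
  define d where "d = e / (2 * (C + \<bar>c\<bar> + 1))"
  have d: "0 < d" using C0 e by (simp add: d_def)
  obtain N a where Na: "(LINT s|?M. \<bar>indicator {0<..1} s - (\<Sum>i\<le>(N::nat). a i * gauss_kernel (real (Suc i)) (real (Suc i) + 1) s)\<bar>) < d"
    using indicator_approx_gauss_kernels[OF d] by blast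
  let ?g = "\<lambda>i. gauss_kernel (real (Suc i)) (real (Suc i) + 1)"
  let ?K = "\<lambda>s. \<Sum>i\<le>N. a i * ?g i s"
  have ind: "integrable ?M (\<lambda>s. indicator {0<..1} s :: real)"
    by (rule integrable_pos_indicator)
  have ind1: "(LINT s|?M. indicator {0<..1} s :: real) = 1"
    by (rule integral_pos_indicator)
  have gi: "integrable ?M (?g i)" for i by (rule integrable_gauss_kernel) auto
  have Ki: "integrable ?M ?K"
    by (intro Bochner_Integration.integrable_sum integrable_mult_right gi)
  have Gm: "(\<lambda>s. G (T * s)) \<in> borel_measurable ?M" for T
    by (intro pos_lborel_measurable) measurable
  have Gi: "integrable ?M (\<lambda>s. G (T * s) * k s)" if "integrable ?M k" "0 < T" for T k
  proof (rule Bochner_Integration.integrable_bound[where f="\<lambda>s. C * k s"])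
    show "AE s in ?M. norm (G (T * s) * k s) \<le> norm (C * k s)"
    proof (rule AE_I2)
      fix s assume "s \<in> space ?M"
      then have "\<bar>G (T * s)\<bar> \<le> C" using that by (intro C) (simp add: space_restrict_space)
      then show "norm (G (T * s) * k s) \<le> norm (C * k s)" using C0 by (auto simp: abs_mult intro!: mult_right_mono)
    qed
  qed (use that Gm in \<open>auto intro!: borel_measurable_times\<close>)
  have "((\<lambda>T. \<Sum>i\<le>N. a i * (LINT s|?M. G (T * s) * ?g i s)) \<longlongrightarrow> (\<Sum>i\<le>N. a i * (c * (LINT s|?M. ?g i s)))) at_top"
    by (intro tendsto_sum tendsto_mult tendsto_const lim) simp
  moreover have "(\<Sum>i\<le>N. a i * (c * (LINT s|?M. ?g i s))) = c * (LINT s|?M. ?K s)"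
    using gi by (subst Bochner_Integration.integral_sum) (auto simp: sum_distrib_left mult_ac)
  ultimately have "eventually (\<lambda>T. dist (\<Sum>i\<le>N. a i * (LINT s|?M. G (T * s) * ?g i s)) (c * (LINT s|?M. ?K s)) < e / 2) at_top"
    using e by (intro tendstoD) auto
  then show "eventually (\<lambda>T. dist (LINT s|?M. G (T * s) * indicator {0<..1} s) c < e) at_top"
    using eventually_gt_at_top[of 0]
  proof eventually_elim
    case (elim T)
    have "(\<Sum>i\<le>N. a i * (LINT s|?M. G (T * s) * ?g i s)) = (LINT s|?M. (\<Sum>i\<le>N. a i * (G (T * s) * ?g i s)))"
      using Gi[OF gi elim(2)] by (subst Bochner_Integration.integral_sum) auto
    also have "\<dots> = (LINT s|?M. G (T * s) * ?K s)"
      by (simp add: sum_distrib_left mult_ac)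
    finally have 1: "\<bar>(LINT s|?M. G (T * s) * ?K s) - c * (LINT s|?M. ?K s)\<bar> < e / 2"
      using elim(1) by (simp add: dist_real_def)
    have "(LINT s|?M. G (T * s) * indicator {0<..1} s) - (LINT s|?M. G (T * s) * ?K s)
        = (LINT s|?M. G (T * s) * (indicator {0<..1} s - ?K s))"
      using Gi[OF ind elim(2)] Gi[OF Ki elim(2)]
      by (subst Bochner_Integration.integral_diff[symmetric]) (auto simp: right_diff_distrib)
    also have "\<bar>\<dots>\<bar> \<le> (LINT s|?M. C * \<bar>indicator {0<..1} s - ?K s\<bar>)"
    proof (rule integral_abs_bound_integral)
      fix s assume "s \<in> space ?M"
      then have "\<bar>G (T * s)\<bar> \<le> C" using elim(2) by (intro C) (simp add: space_restrict_space)
      then show "\<bar>G (T * s) * (indicator {0<..1} s - ?K s)\<bar> \<le> C * \<bar>indicator {0<..1} s - ?K s\<bar>"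
        by (auto simp: abs_mult intro!: mult_right_mono)
    qed (use Gi[OF Bochner_Integration.integrable_diff[OF ind Ki] elim(2)] ind Ki in auto)
    also have "\<dots> \<le> C * d" using Na C0 by (simp add: mult_left_mono)
    finally have 2: "\<bar>(LINT s|?M. G (T * s) * indicator {0<..1} s) - (LINT s|?M. G (T * s) * ?K s)\<bar> \<le> C * d" .
    have "\<bar>(LINT s|?M. ?K s) - 1\<bar> \<le> d"
    proof -
      have "(LINT s|?M. ?K s) - 1 = - (LINT s|?M. indicator {0<..1} s - ?K s)"
        using ind Ki ind1 by (subst Bochner_Integration.integral_diff) auto
      then have "\<bar>(LINT s|?M. ?K s) - 1\<bar> \<le> (LINT s|?M. \<bar>indicator {0<..1} s - ?K s\<bar>)"
        using integral_abs_bound[of ?M "\<lambda>s. indicator {0<..1} s - ?K s"] by simp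
      then show ?thesis using Na by simp
    qed
    then have 3: "\<bar>c * (LINT s|?M. ?K s) - c\<bar> \<le> \<bar>c\<bar> * d"
      using mult_left_mono[of "\<bar>(LINT s|?M. ?K s) - 1\<bar>" d "\<bar>c\<bar>"] by (simp add: abs_mult[symmetric] right_diff_distrib)
    have "(C + \<bar>c\<bar>) * d \<le> e / 2" using C0 e by (simp add: d_def field_simps)
    then have 4: "C * d + \<bar>c\<bar> * d \<le> e / 2" by (simp only: distrib_right)
    show ?case using 1 2 3 4 unfolding dist_real_def by linarith
  qed
qed

section \<open>Radial Fourier transforms and the right derivative at 0\<close>

text \<open>The functional equation of the Gamma function at \<open>x = (d + 1) / 2\<close>. It
  trades the sphere in dimension \<open>d + 1\<close>, which the first moment of the Gaussian
  produces, for the ball in dimension \<open>d - 1\<close> of the final constant.\<close>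

lemma unit_ball_vol_recurrence:
  assumes "0 < d"
  shows "real (d + 1) * unit_ball_vol (real (d + 1)) = 2 * pi * unit_ball_vol (real (d - 1))"
proof -
  define x where "x = (real d + 1) / 2"
  have x: "0 < x" by (simp add: x_def)
  have G: "Gamma (x + 1) = x * Gamma x"
    using x by (intro Gamma_plus1) (auto simp: nonpos_Ints_def)
  have e1: "real (d + 1) / 2 = x" "real (d - 1) / 2 + 1 = x" "real (d - 1) / 2 = x - 1" "real (d + 1) = 2 * x"
    using assms by (auto simp: x_def field_simps of_nat_diff)
  have "pi powr x = pi * pi powr (x - 1)" by (simp add: powr_diff)
  then show ?thesis
    unfolding unit_ball_vol_def e1 G using x Gamma_real_pos[OF x] by (simp add: divide_simps G)
qed

text \<open>In polar coordinates the first moment of the Gaussian on \<open>'a\<close> is the total mass of the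
  Gaussian on \<open>'a \<times> real\<close>.\<close>

lemma
  shows integrable_norm_gaussian: "integrable lborel (\<lambda>y::'a::euclidean_space. norm y * gauss y)" (is ?A)
    and integral_norm_gaussian: "(LINT y|lborel. norm (y::'a) * gauss y)
      = DIM('a) * unit_ball_vol DIM('a) / (2 * pi * unit_ball_vol (real (DIM('a) - 1)))" (is ?B)
proof -
  let ?d = "DIM('a)"
  let ?f = "\<lambda>\<rho>::real. \<rho> * exp (- (pi * \<rho>\<^sup>2))"
  let ?e = "\<lambda>\<rho>::real. exp (- (pi * \<rho>\<^sup>2))"
  have eq: "\<rho> ^ (?d - 1) * ?f \<rho> = \<rho> ^ (DIM('a \<times> real) - 1) * ?e \<rho>" for \<rho>
    using power_Suc[of \<rho> "?d - 1"] DIM_positive[where 'a='a] by (simp add: mult_ac)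
  have "set_integrable lborel {0<..} (\<lambda>\<rho>. \<rho> ^ (DIM('a \<times> real) - 1) * ?e \<rho>)"
    using integrable_radial[where 'a="'a \<times> real", of ?e] integrable_gaussian[where 'a="'a \<times> real"] by simp
  then show ?A using integrable_radial[where 'a='a, of ?f] unfolding eq by simp
  have "1 = DIM('a \<times> real) * unit_ball_vol DIM('a \<times> real) * (LINT \<rho>:{0<..}|lborel. \<rho> ^ (DIM('a \<times> real) - 1) * ?e \<rho>)"
    using integral_radial[where 'a="'a \<times> real", of ?e] integral_gaussian[where 'a="'a \<times> real"] by simp
  also have "DIM('a \<times> real) * unit_ball_vol DIM('a \<times> real) = 2 * pi * unit_ball_vol (real (?d - 1))"
    using unit_ball_vol_recurrence[of ?d] by simp
  finally have "(LINT \<rho>:{0<..}|lborel. \<rho> ^ (?d - 1) * ?f \<rho>) = 1 / (2 * pi * unit_ball_vol (real (?d - 1)))"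
    unfolding eq by (subst eq_divide_eq) (auto simp: mult_ac)
  then show ?B using integral_radial[where 'a='a, of ?f] by simp
qed

text \<open>Near 0 the difference quotient is within 1 of its limit; beyond some \<delta> the
  trivial bound \<open>2 * B\<close> is at most \<open>(2 * B / \<delta>) * u\<close>. The linear
  bound dominates the rescaled differences in the limit at infinity.\<close>

lemma right_derivative_linear_bound:
  fixes g :: "real \<Rightarrow> real"
  assumes der: "(g has_real_derivative \<gamma>) (at_right 0)" and B: "\<And>u. 0 \<le> u \<Longrightarrow> \<bar>g u\<bar> \<le> B"
  shows "\<exists>L. \<forall>u\<ge>0. \<bar>g u - g 0\<bar> \<le> L * u"
proof -
  have "((\<lambda>u. (g u - g 0) / u) \<longlongrightarrow> \<gamma>) (at_right 0)"
    using der by (simp add: has_field_derivative_iff)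
  then have "eventually (\<lambda>u. dist ((g u - g 0) / u) \<gamma> < 1) (at_right 0)"
    by (rule tendstoD) simp
  then obtain \<delta> where \<delta>: "\<delta> > 0" "\<And>u. 0 < u \<Longrightarrow> u < \<delta> \<Longrightarrow> dist ((g u - g 0) / u) \<gamma> < 1"
    unfolding eventually_at_right_field by auto
  have B0: "0 \<le> B" using B[of 0] by simp
  have "\<bar>g u - g 0\<bar> \<le> (\<bar>\<gamma>\<bar> + 1 + 2 * B / \<delta>) * u" if "u \<ge> 0" for u
  proof -
    consider "u = 0" | "0 < u" "u < \<delta>" | "u \<ge> \<delta>" using \<open>u \<ge> 0\<close> by linarith
    then show ?thesis
    proof cases
      case 2
      then have "\<bar>(g u - g 0) / u\<bar> \<le> \<bar>\<gamma>\<bar> + 1" using \<delta>(2)[of u] by (auto simp: dist_real_def)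
      then have "\<bar>g u - g 0\<bar> \<le> (\<bar>\<gamma>\<bar> + 1) * u" using 2 by (simp add: field_simps)
      also have "\<dots> \<le> (\<bar>\<gamma>\<bar> + 1 + 2 * B / \<delta>) * u"
        using 2 \<delta>(1) B0 by (intro mult_right_mono) auto
      finally show ?thesis .
    next
      case 3
      have "\<bar>g u - g 0\<bar> \<le> 2 * B" using B[of u] B[of 0] \<open>u \<ge> 0\<close> by linarith
      also have "\<dots> \<le> (2 * B / \<delta>) * u" using 3 \<delta>(1) B0 by (simp add: field_simps mult_mono)
      also have "\<dots> \<le> (\<bar>\<gamma>\<bar> + 1 + 2 * B / \<delta>) * u" using \<open>u \<ge> 0\<close> by (intro mult_right_mono) auto
      finally show ?thesis .
    qed simp
  qed
  then show ?thesis by blast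
qed

section \<open>Gaussian means of a radial function and of its transform\<close>

context
  fixes g h :: "real \<Rightarrow> real" and B :: real
  assumes gi: "integrable lborel (\<lambda>x::'a::euclidean_space. g (norm x))"
    and gB: "\<And>u. 0 \<le> u \<Longrightarrow> \<bar>g u\<bar> \<le> B"
    and hm [measurable]: "h \<in> borel_measurable borel"
    and ft: "\<And>\<xi>::'a. complex_of_real (h (norm \<xi>)) = (LINT x|lborel. of_real (g (norm x)) * phase x \<xi>)"
begin

text \<open>The Gaussian mean of the profile \<open>g\<close> at scale \<open>1 / \<tau>\<close>.
  For large \<tau> it depends on \<open>g\<close> essentially near 0, where the derivative is
  known.\<close>

definition R where
  "R \<tau> = (LINT y|lborel. g (norm (y::'a) / \<tau>) * gauss y)"

lemma gm [measurable]: "(\<lambda>x::'a. g (norm x)) \<in> borel_measurable borel"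
  using borel_measurable_integrable[OF gi] by simp

text \<open>Measurability is available for \<open>g\<close> composed with the norm, so the scaling
  is moved inside the norm.\<close>

lemma g_scale_measurable:
  assumes "0 < \<tau>"
  shows "(\<lambda>y::'a. g (norm y / \<tau>)) \<in> borel_measurable borel"
proof -
  have "(\<lambda>y::'a. g (norm ((1 / \<tau>) *\<^sub>R y))) \<in> borel_measurable borel" by measurable
  then show ?thesis using assms by simp
qed

text \<open>Fubini moves the transform from \<open>g\<close> to the Gaussian, which is self-dual;
  undoing the dilation by \<tau> yields the power of \<tau>.\<close>

lemma multiplication_formula:
  assumes "0 < \<tau>"
  shows "(LINT \<eta>|lborel. h (norm (\<tau> *\<^sub>R (\<eta>::'a))) * gauss \<eta>) = R \<tau> / \<tau> ^ DIM('a)"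
proof -
  let ?e = "\<lambda>\<eta>::'a. gauss \<eta>"
  let ?F = "\<lambda>(x::'a) (\<eta>::'a). complex_of_real (g (norm x)) * phase x (\<tau> *\<^sub>R \<eta>) * of_real (?e \<eta>)"
  have m[measurable]: "(\<lambda>(x, \<eta>). ?F x \<eta>) \<in> borel_measurable (lborel \<Otimes>\<^sub>M lborel)"
    unfolding split_def by measurable
  have nF: "norm (?F x \<eta>) = \<bar>g (norm x)\<bar> * ?e \<eta>" for x \<eta> by (simp add: norm_mult)
  have inti: "integrable lborel (?F x)" for x
  proof (rule Bochner_Integration.integrable_bound[where f="\<lambda>\<eta>. \<bar>g (norm x)\<bar> * ?e \<eta>"])
    show "?F x \<in> borel_measurable lborel" using measurable_Pair2[OF m, of x] by simp
  qed (use integrable_gaussian[where 'a='a] in \<open>auto simp: norm_mult\<close>)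
  have int: "integrable (lborel \<Otimes>\<^sub>M lborel) (\<lambda>(x, \<eta>). ?F x \<eta>)"
  proof (rule lborel_pair.Fubini_integrable[OF m])
    show "integrable lborel (\<lambda>x. LINT \<eta>|lborel. norm (case (x, \<eta>) of (x, \<eta>) \<Rightarrow> ?F x \<eta>))"
      unfolding prod.case nF using gi by (simp add: integral_gaussian)
  qed (use inti in auto)
  have "complex_of_real (LINT \<eta>|lborel. h (norm (\<tau> *\<^sub>R \<eta>)) * ?e \<eta>)
      = (LINT \<eta>|lborel. complex_of_real (h (norm (\<tau> *\<^sub>R \<eta>))) * of_real (?e \<eta>))"
    by (subst integral_complex_of_real[symmetric]) simp
  also have "\<dots> = (LINT \<eta>|lborel. LINT x|lborel. ?F x \<eta>)"
    unfolding ft by simp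
  also have "\<dots> = (LINT x|lborel. LINT \<eta>|lborel. ?F x \<eta>)"
    by (rule lborel_pair.Fubini_integral[OF int])
  also have "\<dots> = (LINT x|lborel. of_real (g (norm x)) * (LINT \<eta>|lborel. of_real (?e \<eta>) * phase \<eta> (\<tau> *\<^sub>R x)))"
    by (subst Bochner_Integration.integral_mult_right_zero[symmetric])
       (simp add: mult_ac inner_commute)
  also have "\<dots> = (LINT x|lborel. complex_of_real (g (norm (x::'a)) * gauss (\<tau> *\<^sub>R x)))"
    by (subst gaussian_fourier(2)) simp
  also have "\<dots> = complex_of_real (LINT x|lborel. g (norm x) * gauss (\<tau> *\<^sub>R (x::'a)))"
    by (rule integral_complex_of_real)
  finally have "(LINT \<eta>|lborel. h (norm (\<tau> *\<^sub>R \<eta>)) * ?e \<eta>) = (LINT x|lborel. g (norm x) * gauss (\<tau> *\<^sub>R (x::'a)))"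
    by (simp only: of_real_eq_iff)
  also have "\<dots> = \<bar>1 / \<tau>\<bar> ^ DIM('a) *\<^sub>R (LINT y|lborel. g (norm ((1 / \<tau>) *\<^sub>R y)) * gauss (\<tau> *\<^sub>R ((1 / \<tau>) *\<^sub>R (y::'a))))"
    using assms by (intro integral_lborel_scaleR) auto
  also have "\<dots> = R \<tau> / \<tau> ^ DIM('a)"
    using assms by (simp add: R_def power_inverse divide_inverse mult_ac)
  finally show ?thesis .
qed

lemma integral_gaussian_ft:
  assumes "0 < a" "0 < T"
  shows "(LINT \<xi>|lborel. h (norm (T *\<^sub>R (\<xi>::'a))) * exp (- (pi * a * (norm \<xi>)\<^sup>2))) = R (T / sqrt a) / T ^ DIM('a)"
proof -
  let ?f = "\<lambda>\<eta>::'a. h (norm ((T / sqrt a) *\<^sub>R \<eta>)) * gauss \<eta>"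
  have "R (T / sqrt a) / (T / sqrt a) ^ DIM('a) = integral\<^sup>L lborel ?f"
    using assms by (intro multiplication_formula[symmetric]) simp
  also have "\<dots> = \<bar>sqrt a\<bar> ^ DIM('a) *\<^sub>R (LINT \<xi>|lborel. ?f (sqrt a *\<^sub>R \<xi>))"
    using assms by (intro integral_lborel_scaleR) auto
  also have "(\<lambda>\<xi>. ?f (sqrt a *\<^sub>R \<xi>)) = (\<lambda>\<xi>. h (norm (T *\<^sub>R \<xi>)) * exp (- (pi * a * (norm \<xi>)\<^sup>2)))"
    using assms by (auto simp: power_mult_distrib mult_ac)
  finally show ?thesis using assms by (simp add: power_divide field_simps)
qed

text \<open>The bound by the L^1 norm makes \<open>h\<close> integrable against every
  Gaussian.\<close>

lemma h_bound: "\<bar>h (norm (\<xi>::'a))\<bar> \<le> (LINT x|lborel. \<bar>g (norm (x::'a))\<bar>)"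
proof -
  have "\<bar>h (norm \<xi>)\<bar> = norm (complex_of_real (h (norm \<xi>)))" by simp
  also have "\<dots> \<le> (LINT x|lborel. norm (complex_of_real (g (norm (x::'a))) * phase x \<xi>))"
    unfolding ft by (rule integral_norm_bound)
  finally show ?thesis by (simp add: norm_mult)
qed

text \<open>Polar coordinates applied to the difference of two Gaussian integrals of
  \<open>h\<close>. The normalisation of \<open>(T * s) ^ (d + 1)\<close> contributes
  \<open>T ^ (d + 1)\<close> and the dilation takes back \<open>T ^ d\<close>; the one surviving
  factor \<open>T\<close> is exactly the scale of a difference quotient at 0.\<close>

lemma gauss_kernel_integral:
  assumes a: "0 < a" "0 < b" and T: "0 < T"
  shows "(LINT s|pos_lborel. (T * s) ^ (DIM('a) + 1) * h (T * s) * gauss_kernel a b s)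
    = T / (DIM('a) * unit_ball_vol DIM('a)) * (R (T / sqrt a) - R (T / sqrt b))"
proof -
  let ?d = "DIM('a)"
  let ?e = "\<lambda>a \<rho>::real. exp (- (pi * a * \<rho>\<^sup>2))"
  let ?F = "\<lambda>\<rho>. h (T * \<rho>) * (?e a \<rho> - ?e b \<rho>)"
  have ei: "integrable lborel (\<lambda>\<xi>::'a. ?e a (norm \<xi>))" if "0 < a" for a
  proof -
    have "integrable lborel (\<lambda>\<xi>::'a. gauss (sqrt a *\<^sub>R \<xi>))"
      using that by (intro integrable_lborel_scaleR integrable_gaussian) auto
    then show ?thesis using that by (simp add: power_mult_distrib mult_ac)
  qed
  have hi: "integrable lborel (\<lambda>\<xi>::'a. h (norm (T *\<^sub>R \<xi>)) * ?e a (norm \<xi>))" if "0 < a" for a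
  proof (rule Bochner_Integration.integrable_bound)
    show "integrable lborel (\<lambda>\<xi>::'a. (LINT x|lborel. \<bar>g (norm (x::'a))\<bar>) * ?e a (norm \<xi>))"
      using ei[OF that] by simp
    show "AE \<xi>::'a in lborel. norm (h (norm (T *\<^sub>R \<xi>)) * ?e a (norm \<xi>)) \<le> norm ((LINT x|lborel. \<bar>g (norm (x::'a))\<bar>) * ?e a (norm \<xi>))"
      using h_bound by (intro AE_I2) (auto simp: abs_mult simp del: norm_scaleR intro!: mult_right_mono)
  qed simp
  have "(R (T / sqrt a) - R (T / sqrt b)) / T ^ ?d = (LINT \<xi>|lborel. ?F (norm (\<xi>::'a)))"
    unfolding diff_divide_distrib integral_gaussian_ft[OF a(1) T, symmetric] integral_gaussian_ft[OF a(2) T, symmetric]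
    using T hi a by (subst Bochner_Integration.integral_diff[symmetric]) (auto simp: right_diff_distrib)
  also have "\<dots> = ?d * unit_ball_vol ?d * (LINT \<rho>:{0<..}|lborel. \<rho> ^ (?d - 1) * ?F \<rho>)"
    by (rule integral_radial) measurable
  also have "(LINT \<rho>:{0<..}|lborel. \<rho> ^ (?d - 1) * ?F \<rho>) = (LINT \<rho>|pos_lborel. \<rho> ^ (?d - 1) * ?F \<rho>)"
    by (simp add: integral_restrict_space set_lebesgue_integral_def)
  also have "\<dots> = (LINT s|pos_lborel. (T * s) ^ (?d + 1) * h (T * s) * gauss_kernel a b s / T ^ (?d + 1))"
  proof (rule Bochner_Integration.integral_cong[OF refl])
    fix s assume "s \<in> space pos_lborel"
    then have s: "0 < s" by (simp add: space_restrict_space)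
    have "(T * s) ^ (?d + 1) = T ^ (?d + 1) * (s ^ (?d - 1) * s\<^sup>2)"
      unfolding power_mult_distrib using DIM_positive[where 'a='a] by (simp flip: power_add)
    then show "s ^ (?d - 1) * ?F s = (T * s) ^ (?d + 1) * h (T * s) * gauss_kernel a b s / T ^ (?d + 1)"
      using s T by (simp add: gauss_kernel_def del: power_Suc)
  qed
  also have "\<dots> = (LINT s|pos_lborel. (T * s) ^ (?d + 1) * h (T * s) * gauss_kernel a b s) / T ^ (?d + 1)"
    by (rule integral_divide_zero)
  finally have *: "(R (T / sqrt a) - R (T / sqrt b)) / T ^ ?d
    = ?d * unit_ball_vol ?d * ((LINT s|pos_lborel. (T * s) ^ (?d + 1) * h (T * s) * gauss_kernel a b s) / T ^ (?d + 1))" .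
  have "?d * unit_ball_vol ?d \<noteq> 0" by (rule less_imp_neq[THEN not_sym]) simp
  moreover have "I = T / K * A" if "A / T ^ ?d = K * (I / T ^ (?d + 1))" "K \<noteq> 0" for A I K :: real
    using that T by (simp add: field_simps)
  ultimately show ?thesis using * by blast
qed

text \<open>Under the Gaussian, \<open>T\<close> times the increment of \<open>g\<close> from 0 to
  \<open>sqrt a * norm y / T\<close> tends to \<open>\<gamma> * sqrt a * norm y\<close>. The linear
  bound on the increments provides the dominating function.\<close>

lemma R_asymptotics:
  assumes der: "(g has_real_derivative \<gamma>) (at_right 0)" and a: "0 < a"
  shows "((\<lambda>T. T * (R (T / sqrt a) - g 0)) \<longlongrightarrow> \<gamma> * sqrt a * (LINT y|lborel. norm (y::'a) * gauss y)) at_top"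
proof -
  let ?e = "\<lambda>y::'a. gauss y"
  obtain L where L: "\<And>u. u \<ge> 0 \<Longrightarrow> \<bar>g u - g 0\<bar> \<le> L * u"
    using right_derivative_linear_bound[OF der gB] by blast
  \<comment> \<open>Replacing \<open>T\<close> by \<open>max 1 T\<close> keeps the scale positive,
    so measurability and domination hold for every \<open>T\<close>; nothing changes for
    \<open>T \<ge> 1\<close>.\<close>
  let ?t = "\<lambda>T::real. max 1 T"
  let ?s = "\<lambda>T y. ?t T * (g (norm y / (?t T / sqrt a)) - g 0) * ?e y"
  have "((\<lambda>T. LINT y|lborel. ?s T y) \<longlongrightarrow> (LINT y|lborel. \<gamma> * sqrt a * (norm y * ?e y))) at_top"
  proof (rule integral_dominated_convergence_at_top)
    show "(\<lambda>y. ?s T y) \<in> borel_measurable lborel" for T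
    proof -
      have [measurable]: "(\<lambda>y::'a. g (norm y / (?t T / sqrt a))) \<in> borel_measurable borel"
        using a by (intro g_scale_measurable) (auto intro!: divide_pos_pos)
      show ?thesis by measurable
    qed
    show "integrable lborel (\<lambda>y. L * sqrt a * (norm (y::'a) * ?e y))"
      using integrable_norm_gaussian[where 'a='a] by simp
    show "AE y in lborel. ((\<lambda>T. ?s T y) \<longlongrightarrow> \<gamma> * sqrt a * (norm y * ?e y)) at_top"
    proof (rule AE_I2)
      fix y :: 'a
      show "((\<lambda>T. ?s T y) \<longlongrightarrow> \<gamma> * sqrt a * (norm y * ?e y)) at_top"
      proof (cases "y = 0")
        case False
        define c where "c = norm y * sqrt a"
        have c: "0 < c" using False a by (simp add: c_def)
        have "((\<lambda>u. (g u - g 0) / u) \<longlongrightarrow> \<gamma>) (at_right 0)"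
          using der by (simp add: has_field_derivative_iff)
        moreover have "filterlim (\<lambda>T. c / T) (at_right 0) at_top"
        proof -
          have "((\<lambda>T. c / T) \<longlongrightarrow> 0) at_top" by (intro tendsto_divide_0[OF tendsto_const] filterlim_at_top_imp_at_infinity filterlim_ident)
          moreover have "eventually (\<lambda>T. c / T \<in> {0<..}) at_top"
            using eventually_gt_at_top[of 0] by eventually_elim (use c in auto)
          ultimately show ?thesis using c
            by (auto simp: filterlim_at intro: eventually_mono[OF eventually_gt_at_top[of 0]])
        qed
        ultimately have "((\<lambda>T. (g (c / T) - g 0) / (c / T)) \<longlongrightarrow> \<gamma>) at_top"
          by (rule filterlim_compose)
        then have "((\<lambda>T. (g (c / T) - g 0) / (c / T) * (c * ?e y)) \<longlongrightarrow> \<gamma> * (c * ?e y)) at_top"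
          by (intro tendsto_intros)
        moreover have "eventually (\<lambda>T. (g (c / T) - g 0) / (c / T) * (c * ?e y) = ?s T y) at_top"
          using eventually_ge_at_top[of 1]
        proof eventually_elim
          case (elim T)
          have "norm y / (?t T / sqrt a) = c / T" using elim by (simp add: c_def max_def)
          moreover have "(g (c / T) - g 0) / (c / T) * (c * ?e y) = T * (g (c / T) - g 0) * ?e y"
            using c elim by (simp add: divide_simps)
          ultimately show ?case using elim by (simp add: max_def)
        qed
        ultimately have "((\<lambda>T. ?s T y) \<longlongrightarrow> \<gamma> * (c * ?e y)) at_top"
          by (rule Lim_transform_eventually)
        then show ?thesis by (simp add: c_def mult_ac)
      qed simp
    qed
    show "\<forall>\<^sub>F T in at_top. AE y in lborel. norm (?s T y) \<le> L * sqrt a * (norm y * ?e y)"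
    proof (intro always_eventually allI AE_I2)
      fix T and y :: 'a
      have "\<bar>g (norm y / (?t T / sqrt a)) - g 0\<bar> \<le> L * (norm y / (?t T / sqrt a))"
        using a by (intro L) (auto intro!: divide_nonneg_nonneg)
      then have "?t T * \<bar>g (norm y / (?t T / sqrt a)) - g 0\<bar> \<le> ?t T * (L * (norm y / (?t T / sqrt a)))"
        by (intro mult_left_mono) auto
      also have "\<dots> = L * sqrt a * norm y" using a by (simp add: field_simps max_def)
      finally have "?t T * \<bar>g (norm y / (?t T / sqrt a)) - g 0\<bar> * ?e y \<le> L * sqrt a * norm y * ?e y"
        by (intro mult_right_mono) auto
      then show "norm (?s T y) \<le> L * sqrt a * (norm y * ?e y)"
        by (simp add: abs_mult mult.assoc)
    qed
  qed simp
  moreover have "eventually (\<lambda>T. (LINT y|lborel. ?s T y) = T * (R (T / sqrt a) - g 0)) at_top"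
    using eventually_ge_at_top[of 1]
  proof eventually_elim
    case (elim T)
    then have t: "?t T = T" by (simp add: max_def)
    have [measurable]: "(\<lambda>y::'a. g (norm y / (T / sqrt a))) \<in> borel_measurable borel"
      using a elim by (intro g_scale_measurable) auto
    have m: "(\<lambda>y. g (norm y / (T / sqrt a)) * ?e y) \<in> borel_measurable lborel" by measurable
    have i: "integrable lborel (\<lambda>y. g (norm y / (T / sqrt a)) * ?e y)"
    proof (rule Bochner_Integration.integrable_bound)
      show "integrable lborel (\<lambda>y. B * ?e y)" using integrable_gaussian[where 'a='a] by simp
      have "\<bar>g (norm y / (T / sqrt a))\<bar> \<le> B" for y :: 'a
        using a elim by (intro gB) (auto intro!: divide_nonneg_nonneg)
      moreover have "0 \<le> B" using gB[of 0] by simp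
      ultimately show "AE y in lborel. norm (g (norm y / (T / sqrt a)) * ?e y) \<le> norm (B * ?e y)"
        by (intro AE_I2) (auto simp: abs_mult intro!: mult_right_mono)
    qed (rule m)
    have "(LINT y|lborel. ?s T y) = (LINT y|lborel. T * (g (norm y / (T / sqrt a)) * ?e y - g 0 * ?e y))"
      unfolding t by (simp add: algebra_simps)
    also have "\<dots> = T * (R (T / sqrt a) - g 0)"
      using i integrable_gaussian[where 'a='a] integral_gaussian[where 'a='a] by (simp add: R_def)
    finally show ?case .
  qed
  ultimately have "((\<lambda>T. T * (R (T / sqrt a) - g 0)) \<longlongrightarrow> (LINT y|lborel. \<gamma> * sqrt a * (norm (y::'a) * ?e y))) at_top"
    by (rule Lim_transform_eventually)
  then show ?thesis by simp
qed

text \<open>In the difference of two values of \<open>R\<close> the term \<open>g 0\<close> cancels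
  and the slope times \<open>sqrt n - sqrt (n + 1)\<close> remains. The mass of the kernel is
  \<open>pi * (sqrt (n + 1) - sqrt n)\<close>, so the quotient is independent of \<open>n\<close>,
  as the Tauberian theorem requires; one factor \<open>pi\<close> comes from this mass, the other
  from the first moment of the Gaussian.\<close>

theorem radial_fourier_mean:
  assumes der: "(g has_real_derivative \<gamma>) (at_right 0)"
    and C: "\<And>\<rho>. 0 < \<rho> \<Longrightarrow> \<bar>\<rho> ^ (DIM('a) + 1) * h \<rho>\<bar> \<le> C"
  shows "((\<lambda>T. LINT s|pos_lborel. ((T * s) ^ (DIM('a) + 1) * h (T * s)) * indicator {0<..1} s)
    \<longlongrightarrow> - \<gamma> / (2 * pi\<^sup>2 * unit_ball_vol (real (DIM('a) - 1)))) at_top"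
proof (rule gauss_kernel_tauberian[where G="\<lambda>\<rho>. \<rho> ^ (DIM('a) + 1) * h \<rho>", OF _ C])
  fix n :: nat assume n: "0 < n"
  let ?d = "DIM('a)" and ?a = "real n" and ?b = "real n + 1"
  let ?K = "?d * unit_ball_vol ?d" and ?k = "unit_ball_vol (real (?d - 1))"
  let ?E = "LINT y|lborel. norm (y::'a) * gauss y"
  have K: "0 < ?K" by simp
  have k: "0 < ?k" by simp
  have ub: "unit_ball_vol (real m) \<noteq> 0" for m
    by (rule less_imp_neq[THEN not_sym]) simp
  note nz = ub[of ?d] ub[of "?d - 1"]
  have "((\<lambda>T. (T * (R (T / sqrt ?a) - g 0) - T * (R (T / sqrt ?b) - g 0)) / ?K)
      \<longlongrightarrow> (\<gamma> * sqrt ?a * ?E - \<gamma> * sqrt ?b * ?E) / ?K) at_top"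
    using n nz by (intro tendsto_divide tendsto_diff R_asymptotics[OF der] tendsto_const) auto
  moreover have "eventually (\<lambda>T. (T * (R (T / sqrt ?a) - g 0) - T * (R (T / sqrt ?b) - g 0)) / ?K
      = (LINT s|pos_lborel. (T * s) ^ (?d + 1) * h (T * s) * gauss_kernel ?a ?b s)) at_top"
    using eventually_gt_at_top[of 0]
  proof eventually_elim
    case (elim T)
    show ?case
      by (subst gauss_kernel_integral) (use n elim in \<open>auto simp: right_diff_distrib diff_divide_distrib\<close>)
  qed
  ultimately have "((\<lambda>T. LINT s|pos_lborel. (T * s) ^ (?d + 1) * h (T * s) * gauss_kernel ?a ?b s)
      \<longlongrightarrow> (\<gamma> * sqrt ?a * ?E - \<gamma> * sqrt ?b * ?E) / ?K) at_top"
    by (rule Lim_transform_eventually)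
  also have "(\<gamma> * sqrt ?a * ?E - \<gamma> * sqrt ?b * ?E) / ?K = \<gamma> * (sqrt ?a - sqrt ?b) / (2 * pi * ?k)"
    using nz unfolding integral_norm_gaussian by (simp add: divide_simps) (simp add: algebra_simps)
  also have "\<dots> = - \<gamma> / (2 * pi\<^sup>2 * ?k) * (LINT s|pos_lborel. gauss_kernel ?a ?b s)"
    using n nz by (subst integral_gauss_kernel) (auto simp: divide_simps power2_eq_square algebra_simps)
  finally show "((\<lambda>T. LINT s|pos_lborel. (T * s) ^ (?d + 1) * h (T * s) * gauss_kernel ?a ?b s)
      \<longlongrightarrow> - \<gamma> / (2 * pi\<^sup>2 * ?k) * (LINT s|pos_lborel. gauss_kernel ?a ?b s)) at_top" .
qed simp_all

end

section \<open>Averages over rotations\<close>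

lemma SO_D:
  assumes "M \<in> SO"
  shows SO_transpose_mult: "transpose M ** M = mat 1" and SO_mult_transpose: "M ** transpose M = mat 1"
    and SO_det: "det M = 1"
  using assms by (auto simp: SO_def rotation_matrix_def orthogonal_matrix_def)

lemma SO_invertible:
  assumes "M \<in> SO"
  shows "invertible M" "invertible (transpose M)" "det (transpose M) = 1"
  using SO_D[OF assms] by (auto simp: invertible_def)

lemma SO_inner:
  assumes "M \<in> SO"
  shows "(x v* M) \<bullet> (y v* M) = x \<bullet> y"
proof -
  have "(x v* M) \<bullet> (y v* M) = x \<bullet> (M *v (transpose M *v y))"
    by (simp add: dot_lmul_matrix)
  then show ?thesis
    using SO_mult_transpose[OF assms] by (simp add: matrix_vector_mul_assoc del: transpose_matrix_vector)
qed

lemma SO_mult_vec: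
  assumes "M \<in> SO"
  shows "(M *v x) v* M = x" "M *v (x v* M) = x"
  using SO_transpose_mult[OF assms] SO_mult_transpose[OF assms]
  by (simp_all add: matrix_vector_mul_assoc flip: transpose_matrix_vector)

lemma SO_image_iff:
  assumes "M \<in> SO"
  shows "y \<in> (\<lambda>y. M *v y) ` D \<longleftrightarrow> y v* M \<in> D"
  using SO_mult_vec[OF assms] by (auto simp: image_iff) metis

lemma integral_lborel_SO:
  fixes f :: "real^'n \<Rightarrow> 'b::{banach, second_countable_topology}"
  assumes "M \<in> SO" "f \<in> borel_measurable borel"
  shows "(LINT x|lborel. f (x v* M)) = integral\<^sup>L lborel f"
  using integral_lborel_matrix[OF SO_invertible(2)[OF assms(1)] assms(2)] SO_invertible(3)[OF assms(1)] by simp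

lemma borel_measurable_transpose_mult:
  "(\<lambda>p. snd p v* fst p :: real^'n) \<in> borel_measurable (borel \<Otimes>\<^sub>M borel)"
proof -
  have "(\<lambda>p. snd p v* fst p :: real^'n) \<in> borel_measurable borel"
    unfolding vector_matrix_mult_def
    by (intro borel_measurable_continuous_onI continuous_intros)
  then show ?thesis by (simp add: borel_prod)
qed

context
  fixes \<mu> :: "(real^'n^'n) measure" and B :: real
  assumes haar: "is_haar_prob_SO \<mu>"
begin

lemma prob_space_haar: "prob_space \<mu>"
  and sets_haar: "sets \<mu> = sets (restrict_space borel SO)"
  and haar_invariant: "N \<in> SO \<Longrightarrow> distr \<mu> \<mu> (\<lambda>M. N ** M) = \<mu>"
  using haar by (auto simp: is_haar_prob_SO_def)

lemma space_haar: "space \<mu> = SO"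
  using sets_eq_imp_space_eq[OF sets_haar] by (simp add: space_restrict_space)

lemma haar_measurable: "f \<in> borel_measurable borel \<Longrightarrow> f \<in> borel_measurable \<mu>"
  by (subst measurable_cong_sets[OF sets_haar refl]) (rule measurable_restrict_space1)

lemma transpose_mult_measurable: "(\<lambda>M. x v* M) \<in> borel_measurable \<mu>"
proof (rule haar_measurable)
  show "(\<lambda>M. x v* M) \<in> borel_measurable borel"
    unfolding vector_matrix_mult_def
    by (intro borel_measurable_continuous_onI continuous_intros)
qed

lemma transpose_mult_measurable_pair:
  "(\<lambda>p. snd p v* fst p :: real^'n) \<in> borel_measurable (\<mu> \<Otimes>\<^sub>M borel)"
proof -
  have i: "(\<lambda>M. M) \<in> measurable \<mu> borel"
    by (subst measurable_cong_sets[OF sets_haar refl]) (intro measurable_restrict_space1 measurable_ident_sets refl)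
  have "(\<lambda>p. (fst p, snd p)) \<in> measurable (\<mu> \<Otimes>\<^sub>M borel) (borel \<Otimes>\<^sub>M borel)"
    by (intro measurable_Pair measurable_compose[OF measurable_fst i] measurable_snd)
  from measurable_compose[OF this borel_measurable_transpose_mult] show ?thesis by simp
qed

text \<open>For a rotation \<open>M\<close>, the vector \<open>x v* M\<close> is \<open>x\<close>
  rotated by the inverse of \<open>M\<close>. This matches membership in a rotated set, and left
  translation of \<open>M\<close> by \<open>N\<close> then acts on the argument first.\<close>

definition rotation_average :: "(real^'n \<Rightarrow> real) \<Rightarrow> real^'n \<Rightarrow> real" where
  "rotation_average f x = (LINT M|\<mu>. f (x v* M))"

text \<open>In dimension one the rotation group is trivial, and evenness takes its role.\<close>

lemma rotation_average_radial:
  assumes f: "f \<in> borel_measurable borel" "\<And>x. f (- x) = f x" and n: "norm x = norm y"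
  shows "rotation_average f x = rotation_average f y"
proof (cases "2 \<le> CARD('n)")
  case True
  \<comment> \<open>A rotation carrying \<open>x\<close> to \<open>y\<close>. Translating the
    measure by it replaces \<open>y v* M\<close> by \<open>(y v* N) v* M\<close>, and
    \<open>y v* N\<close> is \<open>x\<close>.\<close>
  obtain F where F: "orthogonal_transformation F" "det (matrix F) = 1" "F x = y"
    using rotation_exists[OF True n] by blast
  define N where "N = matrix F"
  have N: "N \<in> SO" "y = N *v x"
    using F by (auto simp: N_def SO_def rotation_matrix_def orthogonal_transformation_matrix orthogonal_transformation_linear
        matrix_works linear_matrix_vector_mul_eq)
  have tr: "(\<lambda>M. N ** M) \<in> measurable \<mu> \<mu>"
  proof (subst measurable_cong_sets[OF sets_haar sets_haar], rule measurable_restrict_space3)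
    show "(\<lambda>M. N ** M) \<in> borel \<rightarrow>\<^sub>M borel"
      unfolding matrix_matrix_mult_def by (intro borel_measurable_continuous_onI continuous_intros)
    show "(\<lambda>M. N ** M) \<in> SO \<rightarrow> SO"
      using N(1) by (auto simp: SO_def rotation_matrix_def orthogonal_matrix_mul det_mul)
  qed
  have "rotation_average f y = (LINT M|distr \<mu> \<mu> (\<lambda>M. N ** M). f (y v* M))"
    by (simp add: rotation_average_def haar_invariant[OF N(1)])
  also have "\<dots> = (LINT M|\<mu>. f (y v* (N ** M)))"
    by (rule integral_distr[OF tr measurable_compose[OF transpose_mult_measurable f(1)]])
  also have "\<dots> = rotation_average f x"
    unfolding rotation_average_def vector_matrix_mul_assoc[symmetric] N(2)
    by (simp add: SO_mult_vec[OF N(1)])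
  finally show ?thesis by simp
next
  case False
  then have c: "CARD('n) = 1" using zero_less_card_finite[where 'a='n] by linarith
  then obtain i :: 'n where i: "UNIV = {i}" by (auto simp: card_1_singleton_iff)
  have "j = i" for j using i by blast
  then have all: "P j \<longleftrightarrow> P i" for P :: "'n \<Rightarrow> bool" and j by metis
  have "norm z = \<bar>z $ i\<bar>" for z :: "real^'n" by (simp add: norm_vec_def L2_set_def i)
  then have "x $ i = y $ i \<or> x $ i = - y $ i" using n by (simp add: abs_eq_iff)
  then have "x = y \<or> x = - y"
    unfolding vec_eq_iff using all[of "\<lambda>j. x $ j = y $ j"] all[of "\<lambda>j. x $ j = (- y) $ j"] by auto
  then show ?thesis
  proof
    assume "x = - y"
    then have "x v* M = - (y v* M)" for M :: "real^'n^'n"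
      using matrix_vector_mult_minus[of "transpose M" y] by simp
    then show ?thesis by (simp add: rotation_average_def f(2))
  qed simp
qed

lemma rotation_average_measurable:
  assumes "f \<in> borel_measurable borel"
  shows "rotation_average f \<in> borel_measurable borel"
proof -
  interpret prob_space \<mu> by (rule prob_space_haar)
  have "(\<lambda>p. (snd p, fst p)) \<in> measurable (borel \<Otimes>\<^sub>M \<mu>) (\<mu> \<Otimes>\<^sub>M (borel :: (real^'n) measure))" by measurable
  from measurable_compose[OF this measurable_compose[OF transpose_mult_measurable_pair assms]]
  have "(\<lambda>(x, M). f (x v* M)) \<in> borel_measurable ((borel :: (real^'n) measure) \<Otimes>\<^sub>M \<mu>)"
    by (simp add: split_def)
  then show ?thesis unfolding rotation_average_def[abs_def]
    by (rule borel_measurable_lebesgue_integral)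
qed

lemma rotation_average_integrable:
  assumes f: "f \<in> borel_measurable borel" "\<And>x. \<bar>f x\<bar> \<le> B"
  shows "integrable \<mu> (\<lambda>M. f (x v* M))"
proof -
  interpret prob_space \<mu> by (rule prob_space_haar)
  show ?thesis
    using f(2) by (intro integrable_const_bound[of _ B] measurable_compose[OF transpose_mult_measurable f(1)]) auto
qed

lemma rotation_average_bound:
  assumes f: "f \<in> borel_measurable borel" "\<And>x. \<bar>f x\<bar> \<le> B"
  shows "\<bar>rotation_average f x\<bar> \<le> B"
proof -
  interpret prob_space \<mu> by (rule prob_space_haar)
  have "\<bar>rotation_average f x\<bar> \<le> (LINT M|\<mu>. \<bar>f (x v* M)\<bar>)"
    unfolding rotation_average_def by (rule integral_abs_bound)
  also have "\<dots> \<le> (LINT M|\<mu>. B)"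
    using rotation_average_integrable[OF f] f(2) by (intro integral_mono) auto
  finally show ?thesis using prob_space by simp
qed

text \<open>The Fourier transform commutes with rotations, and Fubini lets it pass the average.
  Rotation invariance of the L^1 norm gives the joint integrability.\<close>

lemma rotation_average_fourier:
  assumes f: "f \<in> borel_measurable borel" "\<And>x. \<bar>f x\<bar> \<le> B" "integrable lborel f"
    and F: "\<And>\<xi>. (LINT x|lborel. of_real (f x) * phase x \<xi>) = complex_of_real (F \<xi>)"
  shows "integrable lborel (rotation_average f)"
    and "(LINT x|lborel. of_real (rotation_average f x) * phase x \<xi>) = complex_of_real (rotation_average F \<xi>)"
proof -
  interpret prob_space \<mu> by (rule prob_space_haar)
  interpret L: pair_sigma_finite \<mu> "lborel :: (real^'n) measure" ..
  have m1: "(\<lambda>p. f (snd p v* fst p)) \<in> borel_measurable (\<mu> \<Otimes>\<^sub>M lborel)"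
    using measurable_compose[OF transpose_mult_measurable_pair f(1)]
    by (simp cong: measurable_cong_sets sets_pair_measure_cong)
  have rot: "integrable lborel (\<lambda>x. f (x v* M))" if "M \<in> SO" for M
    using integrable_lborel_matrix[OF SO_invertible(2)[OF that] f(3)] by simp
  have int1: "integrable (\<mu> \<Otimes>\<^sub>M lborel) (\<lambda>p. f (snd p v* fst p))"
  proof (rule L.Fubini_integrable[OF m1])
    have "(LINT x|lborel. norm (f (x v* M))) = (LINT x|lborel. norm (f x))" if "M \<in> SO" for M
      using integral_lborel_SO[OF that, of "\<lambda>x. norm (f x)"] f(1) by simp
    then have "integrable \<mu> (\<lambda>M. LINT x|lborel. norm (f (x v* M))) \<longleftrightarrow> integrable \<mu> (\<lambda>M. LINT x|lborel. norm (f x))"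
      by (intro Bochner_Integration.integrable_cong refl) (simp add: space_haar)
    then show "integrable \<mu> (\<lambda>M. LINT x|lborel. norm (f (snd (M, x) v* fst (M, x))))" by simp
    show "AE M in \<mu>. integrable lborel (\<lambda>x. f (snd (M, x) v* fst (M, x)))"
      using rot by (intro AE_I2) (simp add: space_haar)
  qed
  show "integrable lborel (rotation_average f)"
    unfolding rotation_average_def[abs_def]
    using L.integrable_snd[of "\<lambda>M x. f (x v* M)"] int1 by (simp add: split_def)
  let ?c = "\<lambda>x. phase x \<xi>"
  have int2: "integrable (\<mu> \<Otimes>\<^sub>M lborel) (\<lambda>(M, x). of_real (f (x v* M)) * ?c x)"
  proof (rule Bochner_Integration.integrable_bound[OF int1])
    show "(\<lambda>(M, x). of_real (f (x v* M)) * ?c x) \<in> borel_measurable (\<mu> \<Otimes>\<^sub>M lborel)"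
      unfolding split_def by (intro borel_measurable_times measurable_compose[OF m1 borel_measurable_of_real]) measurable
  qed (auto simp: norm_mult)
  have "(LINT x|lborel. of_real (rotation_average f x) * ?c x) = (LINT x|lborel. LINT M|\<mu>. of_real (f (x v* M)) * ?c x)"
    by (simp add: rotation_average_def)
  also have "\<dots> = (LINT M|\<mu>. LINT x|lborel. of_real (f (x v* M)) * ?c x)"
    by (rule L.Fubini_integral[OF int2])
  also have "\<dots> = (LINT M|\<mu>. complex_of_real (F (\<xi> v* M)))"
  proof (rule Bochner_Integration.integral_cong[OF refl])
    fix M assume "M \<in> space \<mu>"
    then have M: "M \<in> SO" by (simp add: space_haar)
    let ?k = "\<lambda>y. of_real (f y) * phase y (\<xi> v* M)"
    have km: "?k \<in> borel_measurable borel" using f(1) by measurable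
    have "complex_of_real (F (\<xi> v* M)) = integral\<^sup>L lborel ?k" by (rule F[symmetric])
    also have "\<dots> = (LINT x|lborel. ?k (x v* M))"
      by (rule integral_lborel_SO[OF M km, symmetric])
    finally show "(LINT x|lborel. of_real (f (x v* M)) * ?c x) = complex_of_real (F (\<xi> v* M))"
      by (simp add: SO_inner[OF M])
  qed
  also have "\<dots> = complex_of_real (rotation_average F \<xi>)"
    unfolding rotation_average_def by (rule integral_complex_of_real)
  finally show "(LINT x|lborel. of_real (rotation_average f x) * ?c x) = complex_of_real (rotation_average F \<xi>)" .
qed

end

section \<open>The covariogram of a bounded Borel set\<close>

context
  fixes D :: "'a::euclidean_space set"
  assumes D: "bounded D" "D \<in> sets borel"
begin

lemma integrable_indicator_bounded: "integrable lborel (indicat_real D)"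
  using D emeasure_bounded_finite[OF D(1)] by (intro integrable_real_indicator) auto

lemma integrable_indicator_reflect: "integrable lborel (\<lambda>x. indicat_real D (y - x))"
  and integral_indicator_reflect: "(LINT x|lborel. indicat_real D (y - x)) = measure lborel D"
proof -
  have [measurable]: "D \<in> sets borel" by (rule D)
  have t: "integrable lborel (\<lambda>x. indicat_real D (y + x))"
    by (rule integrable_lborel_translate[OF integrable_indicator_bounded])
  show "integrable lborel (\<lambda>x. indicat_real D (y - x))"
    using integrable_lborel_scaleR[of "-1", OF _ t] by simp
  have "measure lborel D = (LINT x|lborel. indicat_real D x)" by simp
  also have "\<dots> = (LINT x|lborel. indicat_real D (y + x))" by (rule integral_lborel_translate) measurable
  also have "\<dots> = (LINT x|lborel. indicat_real D (y - x))"
    by (subst integral_lborel_scaleR[of "-1"]) (auto, measurable)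
  finally show "(LINT x|lborel. indicat_real D (y - x)) = measure lborel D" ..
qed

lemma covariogram_borel: "covariogram D x = (LINT y|lborel. indicat_real D y * indicat_real D (y - x))"
proof -
  have [measurable]: "D \<in> sets borel" by (rule D)
  show ?thesis unfolding covariogram_def by (rule integral_completion) measurable
qed

lemma indicator_pair_measurable:
  "(\<lambda>(y, x). indicat_real D y * indicat_real D (y - x)) \<in> borel_measurable (lborel \<Otimes>\<^sub>M lborel)"
proof -
  have [measurable]: "D \<in> sets borel" by (rule D)
  show ?thesis unfolding split_def by measurable
qed

text \<open>For fixed \<open>y\<close> the integral over \<open>x\<close> is at most the measure of
  \<open>D\<close>, by reflection and translation.\<close>

lemma indicator_pair_integrable:
  "integrable (lborel \<Otimes>\<^sub>M lborel) (\<lambda>(y, x). indicat_real D y * indicat_real D (y - x))"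
proof (rule lborel_pair.Fubini_integrable[OF indicator_pair_measurable])
  have "integrable lborel (\<lambda>y. indicat_real D y * measure lborel D)"
    using integrable_indicator_bounded by simp
  then show "integrable lborel (\<lambda>y. LINT x|lborel. norm (case (y, x) of (y, x) \<Rightarrow> indicat_real D y * indicat_real D (y - x)))"
    by (simp add: abs_mult integral_indicator_reflect)
  show "AE y in lborel. integrable lborel (\<lambda>x. case (y, x) of (y, x) \<Rightarrow> indicat_real D y * indicat_real D (y - x))"
    using integrable_indicator_reflect by (intro AE_I2) simp
qed

lemma covariogram_integrable: "integrable lborel (covariogram D)"
  unfolding covariogram_borel[abs_def]
  using lborel_pair.integrable_snd[OF indicator_pair_integrable] by (simp add: split_def)

lemma covariogram_measurable: "covariogram D \<in> borel_measurable borel"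
  using borel_measurable_integrable[OF covariogram_integrable] by simp

lemma covariogram_bound: "\<bar>covariogram D x\<bar> \<le> measure lborel D"
proof -
  have "\<bar>covariogram D x\<bar> \<le> (LINT y|lborel. indicat_real D y)"
    unfolding covariogram_borel
  proof (rule integral_abs_bound_integral[OF _ integrable_indicator_bounded])
    have [measurable]: "D \<in> sets borel" by (rule D)
    show "integrable lborel (\<lambda>y. indicat_real D y * indicat_real D (y - x))"
      by (rule Bochner_Integration.integrable_bound[OF integrable_indicator_bounded]) (auto simp: indicator_def)
  qed (auto simp: indicator_def)
  then show ?thesis by simp
qed

lemma covariogram_uminus: "covariogram D (- x) = covariogram D x"
proof -
  have [measurable]: "D \<in> sets borel" by (rule D)
  have "covariogram D (- x) = (LINT y|lborel. indicat_real D y * indicat_real D (x + y))"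
    by (simp add: covariogram_borel add.commute)
  also have "\<dots> = (LINT y|lborel. indicat_real D (- x + y) * indicat_real D (x + (- x + y)))"
    by (rule integral_lborel_translate) measurable
  finally show ?thesis by (simp add: covariogram_borel mult.commute)
qed

text \<open>An autocorrelation has the squared modulus as its transform: substituting
  \<open>x = y - z\<close> splits the phase into one factor in \<open>y\<close> and the conjugate
  factor in \<open>z\<close>.\<close>

lemma covariogram_fourier:
  "(LINT x|lborel. of_real (covariogram D x) * phase x \<xi>) = complex_of_real ((norm (ft_indicator D \<xi>))\<^sup>2)"
proof -
  have [measurable]: "D \<in> sets borel" by (rule D)
  let ?c = "\<lambda>x. phase x \<xi>"
  let ?F = "\<lambda>y x. complex_of_real (indicat_real D y * indicat_real D (y - x)) * ?c x"
  have int: "integrable (lborel \<Otimes>\<^sub>M lborel) (\<lambda>(y, x). ?F y x)"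
  proof (rule Bochner_Integration.integrable_bound[OF indicator_pair_integrable])
    show "(\<lambda>(y, x). ?F y x) \<in> borel_measurable (lborel \<Otimes>\<^sub>M lborel)"
      unfolding split_def by measurable
  qed (auto simp: norm_mult)
  have inner: "(LINT x|lborel. ?F y x) = indicator D y * ?c y * cnj (ft_indicator D \<xi>)" for y
  proof -
    have m1: "(\<lambda>x. ?F y x) \<in> borel_measurable borel" by measurable
    have m2: "(\<lambda>x. ?F y (y + x)) \<in> borel_measurable borel" by measurable
    have "(LINT x|lborel. ?F y x) = (LINT x|lborel. ?F y (y + x))"
      by (rule integral_lborel_translate[OF m1])
    also have "\<dots> = (LINT z|lborel. ?F y (y - z))"
      using integral_lborel_scaleR[of "-1", OF _ m2] by simp
    also have "\<dots> = (LINT z|lborel. indicator D y * ?c y * cnj (indicator D z * ?c z))"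
      by (intro Bochner_Integration.integral_cong refl)
         (simp add: of_real_indicator cnj_indicator cis_cnj cis_mult algebra_simps)
    also have "\<dots> = indicator D y * ?c y * (LINT z|lborel. cnj (indicator D z * ?c z))"
      by (rule integral_mult_right_zero)
    finally show ?thesis by (simp only: ft_indicator_def Bochner_Integration.integral_cnj)
  qed
  have "(LINT x|lborel. of_real (covariogram D x) * ?c x) = (LINT x|lborel. LINT y|lborel. ?F y x)"
    unfolding covariogram_borel by (simp only: integral_mult_left_zero integral_complex_of_real)
  also have "\<dots> = (LINT y|lborel. LINT x|lborel. ?F y x)"
    by (rule lborel_pair.Fubini_integral[OF int])
  also have "\<dots> = ft_indicator D \<xi> * cnj (ft_indicator D \<xi>)"
    unfolding inner by (simp only: integral_mult_left_zero ft_indicator_def)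
  finally show ?thesis by (simp only: complex_norm_square)
qed

lemma ft_indicator_measurable: "ft_indicator D \<in> borel_measurable borel"
proof -
  have [measurable]: "D \<in> sets borel" by (rule D)
  have "(\<lambda>(\<xi>, x). indicator D x * phase x \<xi>) \<in> borel_measurable (borel \<Otimes>\<^sub>M lborel)"
    unfolding split_def by measurable
  then show ?thesis unfolding ft_indicator_def[abs_def]
    by (rule lborel.borel_measurable_lebesgue_integral)
qed

lemma ft_indicator_bound: "norm (ft_indicator D \<xi>) \<le> measure lborel D"
proof -
  have "norm (ft_indicator D \<xi>) \<le> (LINT x|lborel. norm (indicator D x * phase x \<xi> :: complex))"
    unfolding ft_indicator_def by (rule integral_norm_bound)
  also have "\<dots> = (LINT x|lborel. indicat_real D x)"
    by (intro Bochner_Integration.integral_cong) (auto simp: norm_mult indicator_def)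
  finally show ?thesis by simp
qed

end

section \<open>Rotation averages of covariogram and spectral density\<close>

lemma vector_matrix_diff: "(y - x) v* M = y v* M - x v* M" for M :: "real^'n^'n"
  using matrix_vector_mult_diff_distrib[of "transpose M" y x] by simp

definition spectral_density :: "(real^'n) set \<Rightarrow> real^'n \<Rightarrow> real" where
  "spectral_density D \<xi> = (norm (ft_indicator D \<xi>))\<^sup>2"

context
  fixes \<mu> :: "(real^'n^'n) measure" and D :: "(real^'n) set"
  assumes haar: "is_haar_prob_SO \<mu>" and D: "bounded D" "D \<in> sets borel"
begin

lemma covariogram_rotate:
  assumes M: "M \<in> SO"
  shows "covariogram ((\<lambda>y. M *v y) ` D) x = covariogram D (x v* M)"
proof -
  have [measurable]: "D \<in> sets borel" by (rule D)
  have ind: "indicat_real ((\<lambda>y. M *v y) ` D) y = indicat_real D (y v* M)" for y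
    by (simp add: indicator_def SO_image_iff[OF M])
  let ?f = "\<lambda>y. indicat_real D y * indicat_real D (y - x v* M)"
  have fm: "?f \<in> borel_measurable borel" by measurable
  have "(\<lambda>y. y v* M) \<in> borel_measurable borel"
    unfolding transpose_matrix_vector[symmetric] by (rule borel_measurable_matrix_vector_mult)
  then have "(\<lambda>y. ?f (y v* M)) \<in> borel_measurable lborel"
    using measurable_compose[OF _ fm] by simp
  then have "(LINT y|lebesgue. ?f (y v* M)) = (LINT y|lborel. ?f (y v* M))"
    by (rule integral_completion)
  also have "\<dots> = integral\<^sup>L lborel ?f" by (rule integral_lborel_SO[OF M fm])
  finally have "(LINT y|lebesgue. ?f (y v* M)) = covariogram D (x v* M)"
    unfolding covariogram_borel[OF D] .
  then show ?thesis
    unfolding covariogram_def[of "(\<lambda>y. M *v y) ` D"] ind vector_matrix_diff .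
qed

text \<open>The covariogram is even, so its rotation average depends only on the norm, and the
  vector selected by \<open>SOME\<close> may be replaced by any vector of that norm.\<close>

lemma iso_covariogram_eq: "iso_covariogram \<mu> D (norm x) = rotation_average \<mu> (covariogram D) x"
proof -
  define x0 :: "real^'n" where "x0 = (SOME y. norm y = norm x)"
  have x0: "norm x0 = norm x" unfolding x0_def by (rule someI[of _ x]) simp
  have "iso_covariogram \<mu> D (norm x) = rotation_average \<mu> (covariogram D) x0"
    unfolding iso_covariogram_def rotation_average_def[OF haar] x0_def[symmetric]
    by (intro Bochner_Integration.integral_cong refl) (simp add: space_haar[OF haar] covariogram_rotate)
  also have "\<dots> = rotation_average \<mu> (covariogram D) x"
    by (rule rotation_average_radial[OF haar covariogram_measurable[OF D] covariogram_uminus[OF D] x0])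
  finally show ?thesis .
qed

lemma spectral_density_measurable: "spectral_density D \<in> borel_measurable borel"
  unfolding spectral_density_def[abs_def]
  using ft_indicator_measurable[OF D] by measurable

lemma spectral_density_uminus: "spectral_density D (- \<xi>) = spectral_density D \<xi>"
  by (simp add: spectral_density_def ft_indicator_uminus)

lemma spectral_density_bound: "\<bar>spectral_density D \<xi>\<bar> \<le> (measure lborel D)\<^sup>2"
  using power_mono[OF ft_indicator_bound[OF D, of \<xi>], of 2] by (simp add: spectral_density_def)

lemma iso_covariogram_fourier:
  shows "integrable lborel (\<lambda>x. iso_covariogram \<mu> D (norm (x::real^'n)))"
    and "(LINT x|lborel. of_real (iso_covariogram \<mu> D (norm x)) * phase x \<xi>)
      = complex_of_real (rotation_average \<mu> (spectral_density D) \<xi>)"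
  unfolding iso_covariogram_eq
  using rotation_average_fourier[OF haar covariogram_measurable[OF D] covariogram_bound[OF D] covariogram_integrable[OF D],
      of "spectral_density D"]
  by (simp_all add: covariogram_fourier[OF D] spectral_density_def[abs_def])

text \<open>The choice of frequency is immaterial for the same reason. The right-hand side also
  shows that the transform is real.\<close>

lemma iso_covariogram_ft_eq:
  "iso_covariogram_ft \<mu> D (norm \<xi>) = complex_of_real (rotation_average \<mu> (spectral_density D) \<xi>)"
proof -
  define \<xi>0 :: "real^'n" where "\<xi>0 = (SOME y. norm y = norm \<xi>)"
  have x0: "norm \<xi>0 = norm \<xi>" unfolding \<xi>0_def by (rule someI[of _ \<xi>]) simp
  have [measurable]: "(\<lambda>x::real^'n. iso_covariogram \<mu> D (norm x)) \<in> borel_measurable borel"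
    using borel_measurable_integrable[OF iso_covariogram_fourier(1)] by simp
  have "iso_covariogram_ft \<mu> D (norm \<xi>)
      = (LINT x|lebesgue. of_real (iso_covariogram \<mu> D (norm x)) * phase x \<xi>0)"
    unfolding iso_covariogram_ft_def \<xi>0_def[symmetric] fourier_def by (simp add: cis_conv_exp mult_ac)
  also have "\<dots> = (LINT x|lborel. of_real (iso_covariogram \<mu> D (norm x)) * phase x \<xi>0)"
    by (rule integral_completion) measurable
  also have "\<dots> = complex_of_real (rotation_average \<mu> (spectral_density D) \<xi>0)"
    by (rule iso_covariogram_fourier(2))
  also have "rotation_average \<mu> (spectral_density D) \<xi>0 = rotation_average \<mu> (spectral_density D) \<xi>"
    by (rule rotation_average_radial[OF haar spectral_density_measurable spectral_density_uminus x0])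
  finally show ?thesis .
qed

end

section \<open>The discrepancy of a rotated and dilated set\<close>

lemma scaleR_image_eq_vimage:
  fixes D :: "'a::real_vector set"
  assumes r: "0 < r"
  shows "(\<lambda>y. r *\<^sub>R y) ` D = (\<lambda>y. (1 / r) *\<^sub>R y) -` D"
proof safe
  fix y assume "(1 / r) *\<^sub>R y \<in> D"
  moreover have "y = r *\<^sub>R ((1 / r) *\<^sub>R y)" using r by simp
  ultimately show "y \<in> (\<lambda>y. r *\<^sub>R y) ` D" by (rule rev_image_eqI)
qed (use r in simp)

lemma scaleR_image_borel:
  fixes D :: "'a::euclidean_space set"
  assumes "0 < r" "D \<in> sets borel"
  shows "(\<lambda>y. r *\<^sub>R y) ` D \<in> sets borel"
  using measurable_sets[of "\<lambda>y::'a. (1 / r) *\<^sub>R y" borel borel D] assms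
  by (simp add: scaleR_image_eq_vimage)

lemma measure_scaleR_image:
  fixes D :: "'a::euclidean_space set"
  assumes r: "0 < r" and D: "D \<in> sets borel"
  shows "measure lebesgue ((\<lambda>y. r *\<^sub>R y) ` D) = r ^ DIM('a) * measure lborel D"
proof -
  note [measurable] = scaleR_image_borel[OF r D]
  have "measure lebesgue ((\<lambda>y. r *\<^sub>R y) ` D) = (LINT y|lborel. indicat_real ((\<lambda>y. r *\<^sub>R y) ` D) y)"
    by (simp add: measure_completion)
  also have "\<dots> = \<bar>r\<bar> ^ DIM('a) *\<^sub>R (LINT y|lborel. indicat_real ((\<lambda>y. r *\<^sub>R y) ` D) (r *\<^sub>R y))"
    using r by (intro integral_lborel_scaleR) auto
  also have "(\<lambda>y. indicat_real ((\<lambda>y. r *\<^sub>R y) ` D) (r *\<^sub>R y)) = indicat_real D"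
    using r by (auto simp: scaleR_image_eq_vimage[OF r] indicator_def)
  finally show ?thesis using r by simp
qed

lemma scaleR_matrix_mult: "(c *\<^sub>R A) ** B = c *\<^sub>R (A ** B)" for A :: "real^'n^'m" and B :: "real^'k^'n"
  by (simp add: vec_eq_iff matrix_matrix_mult_def sum_distrib_left mult_ac)

lemma matrix_mult_scaleR: "A ** (c *\<^sub>R B) = c *\<^sub>R (A ** B)" for A :: "real^'n^'m" and B :: "real^'k^'n"
  by (simp add: vec_eq_iff matrix_matrix_mult_def sum_distrib_left mult_ac)

lemma det_scaleR_matrix: "det (c *\<^sub>R A) = c ^ CARD('n) * det A" for A :: "real^'n^'n"
proof -
  have "c *\<^sub>R A = matrix ((*\<^sub>R) c) ** A"
    by (simp add: matrix_scaleR) (simp add: vec_eq_iff matrix_matrix_mult_def mat_def if_distrib[of "\<lambda>x. x * _"] cong: if_cong)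
  then show ?thesis by (simp add: det_mul)
qed

lemma matrix_inv_unique':
  fixes A :: "real^'n^'n"
  assumes "A ** B = mat 1"
  shows "invertible A" "matrix_inv A = B"
proof -
  have "B ** A = mat 1" using assms matrix_left_right_inverse by blast
  then show inv: "invertible A" using assms by (auto simp: invertible_def)
  have "matrix_inv A = matrix_inv A ** (A ** B)" using assms by simp
  also have "\<dots> = B" by (simp add: matrix_mul_assoc invertible_inverse_mult[OF inv])
  finally show "matrix_inv A = B" .
qed

lemma fundamental_region_iff:
  assumes "invertible A"
  shows "x \<in> fundamental_region A \<longleftrightarrow> matrix_inv A *v x \<in> unit_cube"
proof
  note inv = invertible_inverse_mult[OF assms]
  assume "x \<in> fundamental_region A"
  then show "matrix_inv A *v x \<in> unit_cube"
    by (auto simp: fundamental_region_def unit_cube_def[symmetric] matrix_vector_mul_assoc inv)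
next
  note inv = invertible_inverse_mult[OF assms]
  assume *: "matrix_inv A *v x \<in> unit_cube"
  have "x = A *v (matrix_inv A *v x)" by (simp add: matrix_vector_mul_assoc inv)
  then show "x \<in> fundamental_region A"
    unfolding fundamental_region_def unit_cube_def[symmetric] using * by (rule image_eqI)
qed

definition lattice_discrepancy :: "real^'n^'n \<Rightarrow> (real^'n) set \<Rightarrow> real \<Rightarrow> real^'n^'n \<Rightarrow> real^'n \<Rightarrow> real" where
  "lattice_discrepancy A D r M x = real (card ((\<lambda>y. r *\<^sub>R (M *v y) + x) ` D \<inter> lattice_of A))
     - spatial_intensity A * measure lebesgue ((\<lambda>y. r *\<^sub>R y) ` D)"

text \<open>In coordinates \<open>x = A *v z\<close> a lattice point \<open>A *v m\<close> lies in
  the moved set iff \<open>B *v (m - z) \<in> D\<close>, where \<open>B\<close> is \<open>A\<close>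
  followed by the inverse rotation and dilation. This is the counting problem for the integer
  lattice, and the inverse of \<open>B\<close> maps an integer frequency to
  \<open>r *\<^sub>R \<xi>\<close>, rotated, with \<xi> in the dual lattice.\<close>

lemma
  fixes A M :: "real^'n^'n" and D :: "(real^'n) set"
  assumes A: "invertible A" and D: "bounded D" "D \<in> sets borel" and M: "M \<in> SO" and r: "0 < r"
  defines "\<alpha> \<equiv> spatial_intensity A"
  shows rotated_lattice_count_measurable: "(\<lambda>x. indicat_real (fundamental_region A) x *\<^sub>R
      ((lattice_discrepancy A D r M x)\<^sup>2 * \<alpha>)) \<in> borel_measurable borel" (is ?A)
    and rotated_lattice_variance: "((\<lambda>\<xi>. \<alpha>\<^sup>2 * r ^ (2 * CARD('n)) * spectral_density D ((r *\<^sub>R \<xi>) v* M)) has_sum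
    (LINT x:fundamental_region A|lebesgue.
      (lattice_discrepancy A D r M x)\<^sup>2 * \<alpha>)) (dual_lattice_of A - {0})" (is ?B)
proof -
  let ?d = "CARD('n)"
  note invA = invertible_inverse_mult[OF A]
  have detA: "det A \<noteq> 0" using A invertible_det_nz by blast
  define B where "B = (1 / r) *\<^sub>R (transpose M ** A)"
  define C where "C = r *\<^sub>R (matrix_inv A ** M)"
  have BC: "B ** C = mat 1"
  proof -
    have "B ** C = transpose M ** A ** (matrix_inv A ** M)"
      using r by (simp add: B_def C_def scaleR_matrix_mult matrix_mult_scaleR)
    also have "\<dots> = transpose M ** (A ** matrix_inv A) ** M" by (simp only: matrix_mul_assoc)
    finally show ?thesis using SO_transpose_mult[OF M] by (simp add: invA)
  qed
  note B = matrix_inv_unique'[OF BC]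
  have Bv: "B *v x = (1 / r) *\<^sub>R ((A *v x) v* M)" for x
    by (simp add: B_def scaleR_matrix_vector_assoc[symmetric] matrix_vector_mul_assoc[symmetric])
  have Cv: "k v* C = (r *\<^sub>R (k v* matrix_inv A)) v* M" for k
    by (simp add: C_def vector_matrix_mul_assoc[symmetric] vector_scaleR_matrix_ac scaleR_vector_matrix_assoc)
  define \<beta> where "\<beta> = inverse \<bar>det B\<bar>"
  \<comment> \<open>A rotation has determinant 1, so only the dilation changes the intensity. The
    square of this identity is the source of both \<open>\<alpha>\<^sup>2\<close> and
    \<open>r ^ (2 * d)\<close>.\<close>
  have \<beta>: "\<beta> = r ^ ?d * \<alpha>"
    using r SO_det[OF M] unfolding \<beta>_def B_def \<alpha>_def spatial_intensity_def
    by (simp add: det_scaleR_matrix det_mul det_transpose abs_mult power_one_over) (simp only: divide_inverse)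
  define N where "N z = real (card {m \<in> int_vectors. B *v (m - z) \<in> D})" for z
  define V where "V = \<beta> * measure lborel D"
  have V: "\<alpha> * measure lebesgue ((\<lambda>y. r *\<^sub>R y) ` D) = V"
    using measure_scaleR_image[OF r D(2)] by (simp add: V_def \<beta>)
  have ld: "lattice_discrepancy A D r M x = real (card ((\<lambda>y. r *\<^sub>R (M *v y) + x) ` D \<inter> lattice_of A)) - V" for x
    unfolding lattice_discrepancy_def \<alpha>_def[symmetric] V ..
  have card_eq: "real (card ((\<lambda>y. r *\<^sub>R (M *v y) + A *v z) ` D \<inter> lattice_of A)) = N z" for z
  proof -
    have inj: "inj ((*v) A)"
      by (rule inj_on_inverseI[of _ "(*v) (matrix_inv A)"]) (simp add: matrix_vector_mul_assoc invA)
    have iff: "A *v m \<in> (\<lambda>y. r *\<^sub>R (M *v y) + A *v z) ` D \<longleftrightarrow> B *v (m - z) \<in> D" for m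
    proof
      assume "A *v m \<in> (\<lambda>y. r *\<^sub>R (M *v y) + A *v z) ` D"
      then obtain y where y: "y \<in> D" "A *v m = r *\<^sub>R (M *v y) + A *v z" by auto
      have e: "A *v (m - z) = r *\<^sub>R (M *v y)" by (simp add: matrix_vector_mult_diff_distrib y(2))
      have "B *v (m - z) = (1 / r) *\<^sub>R ((r *\<^sub>R (M *v y)) v* M)"
        unfolding Bv e ..
      also have "\<dots> = y"
        using r by (simp add: scaleR_vector_matrix_assoc[symmetric] SO_mult_vec[OF M])
      finally show "B *v (m - z) \<in> D" using y(1) by simp
    next
      assume *: "B *v (m - z) \<in> D"
      have "A *v m = r *\<^sub>R (M *v (B *v (m - z))) + A *v z"
        using r unfolding Bv
        by (simp add: matrix_vector_mult_scaleR SO_mult_vec[OF M] matrix_vector_mult_diff_distrib)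
      then show "A *v m \<in> (\<lambda>y. r *\<^sub>R (M *v y) + A *v z) ` D" using * by (rule image_eqI)
    qed
    have "(\<lambda>y. r *\<^sub>R (M *v y) + A *v z) ` D \<inter> lattice_of A = (*v) A ` {m \<in> int_vectors. B *v (m - z) \<in> D}"
    proof -
      have "X \<inter> (*v) A ` int_vectors = (*v) A ` {m \<in> int_vectors. A *v m \<in> X}" for X by auto
      then show ?thesis unfolding lattice_of_def by (simp only: iff)
    qed
    then show ?thesis using card_image[OF inj_on_subset[OF inj subset_UNIV]] by (simp add: N_def)
  qed
  obtain f where f[measurable]: "f \<in> borel_measurable borel" and Nf: "\<And>z. z \<in> unit_cube \<Longrightarrow> N z = f z"
    using lattice_count_measurable[OF B(1) D] unfolding N_def by blast
  let ?k = "\<lambda>z. indicator unit_cube z * ((f z - V)\<^sup>2 * \<alpha>)"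
  have km: "?k \<in> borel_measurable borel" by measurable
  have km': "(\<lambda>x. ?k (matrix_inv A *v x)) \<in> borel_measurable borel"
    by (rule measurable_compose[OF borel_measurable_matrix_vector_mult km])
  \<comment> \<open>The weight \<alpha> turns the fundamental region into a probability space and
    cancels the Jacobian of the passage to the cube.\<close>
  have \<alpha>: "\<bar>det A\<bar> * \<alpha> = 1" using detA by (simp add: \<alpha>_def spatial_intensity_def)
  have integrand: "indicat_real (fundamental_region A) x *\<^sub>R ((real (card ((\<lambda>y. r *\<^sub>R (M *v y) + x) ` D \<inter> lattice_of A)) - V)\<^sup>2 * \<alpha>)
      = ?k (matrix_inv A *v x)" for x
  proof -
    have x: "x = A *v (matrix_inv A *v x)" by (simp add: matrix_vector_mul_assoc invA)
    have "real (card ((\<lambda>y. r *\<^sub>R (M *v y) + x) ` D \<inter> lattice_of A)) = N (matrix_inv A *v x)"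
      using card_eq[of "matrix_inv A *v x"] unfolding x[symmetric] .
    then show ?thesis
      using Nf[of "matrix_inv A *v x"] by (auto simp: indicator_def fundamental_region_iff[OF A])
  qed
  show ?A unfolding ld integrand by (rule km')
  have "(LINT x:fundamental_region A|lebesgue.
      (real (card ((\<lambda>y. r *\<^sub>R (M *v y) + x) ` D \<inter> lattice_of A)) - V)\<^sup>2 * \<alpha>)
      = (LINT x|lebesgue. ?k (matrix_inv A *v x))"
    unfolding set_lebesgue_integral_def integrand ..
  also have "\<dots> = (LINT x|lborel. ?k (matrix_inv A *v x))"
    using km' by (intro integral_completion) simp
  also have "\<dots> = \<bar>det A\<bar> * (LINT z|lborel. ?k z)"
    by (subst integral_lborel_matrix[OF A km']) (simp add: matrix_vector_mul_assoc invA)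
  also have "\<dots> = \<bar>det A\<bar> * \<alpha> * (LINT z|lborel. indicator unit_cube z * (f z - V)\<^sup>2)"
    by (simp add: mult.assoc[symmetric])
  also have "\<dots> = (LINT z|cube_measure. (f z - V)\<^sup>2)"
    unfolding \<alpha> by (simp add: integral_cube_measure set_lebesgue_integral_def)
  also have "\<dots> = (LINT z|cube_measure. (N z - V)\<^sup>2)"
    by (intro Bochner_Integration.integral_cong refl) (simp add: Nf)
  finally have int: "(LINT x:fundamental_region A|lebesgue.
      (real (card ((\<lambda>y. r *\<^sub>R (M *v y) + x) ` D \<inter> lattice_of A)) - V)\<^sup>2 * \<alpha>)
      = (LINT z|cube_measure. (N z - V)\<^sup>2)" .
  have hs: "((\<lambda>k. \<beta>\<^sup>2 * spectral_density D (k v* C)) has_sum (LINT z|cube_measure. (N z - V)\<^sup>2)) (int_vectors - {0})"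
    using lattice_variance[OF B(1) D] unfolding B(2) spectral_density_def N_def V_def \<beta>_def .
  have injv: "inj (\<lambda>k. k v* matrix_inv A)"
    by (rule inj_on_inverseI[of _ "\<lambda>k. k v* A"]) (simp add: vector_matrix_mul_assoc invA)
  have "dual_lattice_of A - {0} = (\<lambda>k. k v* matrix_inv A) ` (int_vectors - {0})"
  proof -
    have "k v* matrix_inv A = 0 \<longleftrightarrow> k = 0" for k
      using injD[OF injv, of k 0] by auto
    then show ?thesis unfolding dual_lattice_of_def by auto
  qed
  moreover have "((\<lambda>k. \<alpha>\<^sup>2 * r ^ (2 * ?d) * spectral_density D ((r *\<^sub>R (k v* matrix_inv A)) v* M)) has_sum (LINT z|cube_measure. (N z - V)\<^sup>2)) (int_vectors - {0})"
    using hs unfolding \<beta> Cv by (simp add: power_mult_distrib power_mult[symmetric] mult_ac)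
  ultimately show ?B
    unfolding ld int
    by (simp add: has_sum_reindex[OF inj_on_subset[OF injv subset_UNIV]] o_def)
qed

section \<open>Means of weighted dilates and the main theorem\<close>

lemma abs_mult_le_mult:
  fixes a b C :: real
  assumes "\<bar>b\<bar> \<le> C" "0 \<le> a"
  shows "\<bar>a * b\<bar> \<le> C * a"
  using mult_left_mono[OF assms] assms(2) by (simp add: abs_mult mult.commute)

lemma integral_abs_le_integral:
  fixes f g :: "'a \<Rightarrow> real"
  assumes "integrable M f" "integrable M g" "\<And>x. x \<in> space M \<Longrightarrow> \<bar>f x\<bar> \<le> g x"
  shows "\<bar>integral\<^sup>L M f\<bar> \<le> integral\<^sup>L M g"
proof -
  have "\<bar>integral\<^sup>L M f\<bar> \<le> (LINT x|M. \<bar>f x\<bar>)" by (rule integral_abs_bound)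
  also have "\<dots> \<le> integral\<^sup>L M g" using assms by (intro integral_mono) auto
  finally show ?thesis .
qed

text \<open>Nonnegative lattice sums become integrals over a counting measure, which makes dominated
  convergence and Fubini available for them.\<close>

lemma has_sum_count_space:
  fixes f :: "'a \<Rightarrow> real"
  assumes hs: "(f has_sum S) A" and nn: "\<And>x. x \<in> A \<Longrightarrow> 0 \<le> f x"
  shows "integrable (count_space A) f" "integral\<^sup>L (count_space A) f = S"
proof -
  have "(\<lambda>x. norm (f x)) summable_on A"
    using hs nn summable_on_cong[of A "\<lambda>x. norm (f x)" f] by (auto simp: summable_on_def)
  then have a: "Infinite_Set_Sum.abs_summable_on f A"
    by (rule abs_summable_equivalent[THEN iffD1])
  then show "integrable (count_space A) f" by (simp add: Infinite_Set_Sum.abs_summable_on_def)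
  have "infsetsum f A = S" using infsetsum_infsum[OF a] infsumI[OF hs] by simp
  then show "integral\<^sup>L (count_space A) f = S" by (simp add: infsetsum_def)
qed

text \<open>Tonelli for extended nonnegative integrals, translated back at both ends. No finiteness
  of the double integral is required: if it is infinite, \<open>enn2real\<close> makes both sides
  0.\<close>

lemma integral_count_space_swap:
  fixes a :: "'b \<Rightarrow> 'c \<Rightarrow> real"
  assumes A: "countable A" and m: "\<And>\<xi>. \<xi> \<in> A \<Longrightarrow> integrable M (a \<xi>)" and nn: "\<And>\<xi> x. 0 \<le> a \<xi> x"
    and s: "\<And>x. x \<in> space M \<Longrightarrow> integrable (count_space A) (\<lambda>\<xi>. a \<xi> x)"
  shows "(LINT x|M. LINT \<xi>|count_space A. a \<xi> x) = (LINT \<xi>|count_space A. LINT x|M. a \<xi> x)"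
proof -
  let ?V = "\<lambda>x. LINT \<xi>|count_space A. a \<xi> x"
  have V: "ennreal (?V x) = (\<integral>\<^sup>+\<xi>. ennreal (a \<xi> x) \<partial>count_space A)" if "x \<in> space M" for x
    using s[OF that] nn by (intro nn_integral_eq_integral[symmetric]) auto
  have am: "(\<lambda>x. ennreal (a \<xi> x)) \<in> borel_measurable M" if "\<xi> \<in> A" for \<xi>
    using borel_measurable_integrable[OF m[OF that]] by simp
  have "(\<lambda>x. \<integral>\<^sup>+\<xi>. ennreal (a \<xi> x) \<partial>count_space A) \<in> borel_measurable M"
  proof -
    interpret C: sigma_finite_measure "count_space A" by (rule sigma_finite_measure_count_space_countable[OF A])
    have "(\<lambda>p. ennreal (a (fst p) (snd p))) \<in> borel_measurable (count_space A \<Otimes>\<^sub>M M)"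
      using am by (intro measurable_pair_measure_countable1[OF A]) auto
    from measurable_pair_swap[OF this]
    have "(\<lambda>(x, \<xi>). ennreal (a \<xi> x)) \<in> borel_measurable (M \<Otimes>\<^sub>M count_space A)" by simp
    then show ?thesis by (rule C.borel_measurable_nn_integral)
  qed
  then have "(\<lambda>x. enn2real (\<integral>\<^sup>+\<xi>. ennreal (a \<xi> x) \<partial>count_space A)) \<in> borel_measurable M" by measurable
  then have Vm: "?V \<in> borel_measurable M"
    by (rule measurable_cong[THEN iffD1, rotated]) (simp add: nn flip: V)
  have "(LINT x|M. ?V x) = enn2real (\<integral>\<^sup>+x. ennreal (?V x) \<partial>M)"
    using Vm nn by (intro integral_eq_nn_integral) auto
  also have "(\<integral>\<^sup>+x. ennreal (?V x) \<partial>M) = (\<integral>\<^sup>+x. \<integral>\<^sup>+\<xi>. ennreal (a \<xi> x) \<partial>count_space A \<partial>M)"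
    by (intro nn_integral_cong V)
  also have "\<dots> = (\<integral>\<^sup>+\<xi>. \<integral>\<^sup>+x. ennreal (a \<xi> x) \<partial>M \<partial>count_space A)"
    by (rule nn_integral_count_space_nn_integral[OF A am])
  also have "\<dots> = (\<integral>\<^sup>+\<xi>. ennreal (LINT x|M. a \<xi> x) \<partial>count_space A)"
    using m nn by (intro nn_integral_cong nn_integral_eq_integral) auto
  also have "enn2real \<dots> = (LINT \<xi>|count_space A. LINT x|M. a \<xi> x)"
    using nn by (intro integral_eq_nn_integral[symmetric]) auto
  finally show ?thesis .
qed

lemma countable_dual_lattice: "countable (dual_lattice_of A)"
  unfolding dual_lattice_of_def by (intro countable_image countable_int_vectors)

text \<open>Parseval's identity is averaged term by term; each term depends on the rotation only
  through the spectral density at a rotated frequency.\<close>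

lemma averaged_lattice_variance:
  fixes A :: "real^'n^'n" and D :: "(real^'n) set"
  assumes haar: "is_haar_prob_SO \<mu>" and A: "invertible A" and D: "bounded D" "D \<in> sets borel" and r: "0 < r"
  defines "\<alpha> \<equiv> spatial_intensity A"
  shows "(LINT M|\<mu>. (LINT x:fundamental_region A|lebesgue.
      (lattice_discrepancy A D r M x)\<^sup>2 * \<alpha>))
    = (LINT \<xi>|count_space (dual_lattice_of A - {0}).
        \<alpha>\<^sup>2 * r ^ (2 * CARD('n)) * rotation_average \<mu> (spectral_density D) (r *\<^sub>R \<xi>))"
proof -
  let ?\<Xi> = "dual_lattice_of A - {0}"
  let ?a = "\<lambda>\<xi> M. \<alpha>\<^sup>2 * r ^ (2 * CARD('n)) * spectral_density D ((r *\<^sub>R \<xi>) v* M)"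
  have nn: "0 \<le> ?a \<xi> M" for \<xi> M using r by (simp add: spectral_density_def)
  note hs = has_sum_count_space[OF rotated_lattice_variance[OF A D _ r, folded \<alpha>_def] nn]
  have "(LINT M|\<mu>. (LINT x:fundamental_region A|lebesgue.
      (lattice_discrepancy A D r M x)\<^sup>2 * \<alpha>))
      = (LINT M|\<mu>. LINT \<xi>|count_space ?\<Xi>. ?a \<xi> M)"
    by (intro Bochner_Integration.integral_cong refl hs(2)[symmetric]) (simp_all add: space_haar[OF haar])
  also have "\<dots> = (LINT \<xi>|count_space ?\<Xi>. LINT M|\<mu>. ?a \<xi> M)"
  proof (rule integral_count_space_swap)
    show "countable ?\<Xi>" using countable_dual_lattice by (rule countable_subset[rotated]) auto
    show "integrable \<mu> (?a \<xi>)" for \<xi>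
      using rotation_average_integrable[OF haar spectral_density_measurable[OF haar D] spectral_density_bound[OF haar D]] by simp
    show "integrable (count_space ?\<Xi>) (\<lambda>\<xi>. ?a \<xi> M)" if "M \<in> space \<mu>" for M
      using that by (intro hs(1)) (simp_all add: space_haar[OF haar])
  qed (rule nn)
  also have "\<dots> = (LINT \<xi>|count_space ?\<Xi>. \<alpha>\<^sup>2 * r ^ (2 * CARD('n)) * rotation_average \<mu> (spectral_density D) (r *\<^sub>R \<xi>))"
    unfolding rotation_average_def[OF haar] by simp
  finally show ?thesis .
qed

section \<open>Weighted means of dilates of a bounded function\<close>

context
  fixes G :: "real \<Rightarrow> real" and \<Xi> :: "'b set" and w \<nu> :: "'b \<Rightarrow> real" and C :: real
  assumes G [measurable]: "G \<in> borel_measurable borel" and C: "\<And>\<rho>. 0 < \<rho> \<Longrightarrow> \<bar>G \<rho>\<bar> \<le> C"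
    and \<Xi>: "countable \<Xi>" and w: "integrable (count_space \<Xi>) w" "\<And>\<xi>. 0 \<le> w \<xi>"
    and \<nu>: "\<And>\<xi>. \<xi> \<in> \<Xi> \<Longrightarrow> 0 < \<nu> \<xi>"
begin

lemma weighted_dilates_bound:
  assumes "0 < r"
  shows "\<bar>LINT \<xi>|count_space \<Xi>. w \<xi> * G (r * \<nu> \<xi>)\<bar> \<le> C * (LINT \<xi>|count_space \<Xi>. w \<xi>)"
proof -
  have b: "\<bar>w \<xi> * G (r * \<nu> \<xi>)\<bar> \<le> C * w \<xi>" if "\<xi> \<in> \<Xi>" for \<xi>
    using \<nu>[OF that] assms by (intro abs_mult_le_mult C w) simp
  have "\<bar>LINT \<xi>|count_space \<Xi>. w \<xi> * G (r * \<nu> \<xi>)\<bar> \<le> (LINT \<xi>|count_space \<Xi>. C * w \<xi>)"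
  proof (rule integral_abs_le_integral)
    have Cw: "integrable (count_space \<Xi>) (\<lambda>\<xi>. C * w \<xi>)" using w by simp
    then show "integrable (count_space \<Xi>) (\<lambda>\<xi>. w \<xi> * G (r * \<nu> \<xi>))"
      by (rule Bochner_Integration.integrable_bound) (use b in \<open>auto simp: AE_count_space intro: order_trans[OF _ abs_ge_self]\<close>)
  qed (use w b in auto)
  then show ?thesis by simp
qed

text \<open>Every dilate \<open>t * \<nu> \<xi>\<close> tends to infinity, so all terms share the
  limit \<open>L\<close>, and \<open>C * w\<close> dominates. The function \<open>m\<close> is
  general because it stands for \<open>G\<close> in one application and for the means of
  \<open>G\<close> in the other.\<close>

lemma tendsto_weighted_dilates:
  fixes m :: "real \<Rightarrow> real"
  assumes m: "(m \<longlongrightarrow> L) at_top" and b: "\<And>\<rho>. 0 < \<rho> \<Longrightarrow> \<bar>m \<rho>\<bar> \<le> C"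
  shows "((\<lambda>t. LINT \<xi>|count_space \<Xi>. w \<xi> * m (t * \<nu> \<xi>)) \<longlongrightarrow> L * (LINT \<xi>|count_space \<Xi>. w \<xi>)) at_top"
proof -
  have "((\<lambda>t. LINT \<xi>|count_space \<Xi>. w \<xi> * m (t * \<nu> \<xi>)) \<longlongrightarrow> (LINT \<xi>|count_space \<Xi>. w \<xi> * L)) at_top"
  proof (rule integral_dominated_convergence_at_top)
    show "integrable (count_space \<Xi>) (\<lambda>\<xi>. C * w \<xi>)" using w by simp
    show "AE \<xi> in count_space \<Xi>. ((\<lambda>t. w \<xi> * m (t * \<nu> \<xi>)) \<longlongrightarrow> w \<xi> * L) at_top"
    proof (simp add: AE_count_space, intro ballI tendsto_mult tendsto_const)
      fix \<xi> assume "\<xi> \<in> \<Xi>"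
      then have "filterlim (\<lambda>t. t * \<nu> \<xi>) at_top at_top"
        using \<nu> by (intro filterlim_at_top_mult_tendsto_pos[OF tendsto_const _ filterlim_ident]) auto
      then show "((\<lambda>t. m (t * \<nu> \<xi>)) \<longlongrightarrow> L) at_top" by (rule filterlim_compose[OF m])
    qed
    show "\<forall>\<^sub>F t in at_top. AE \<xi> in count_space \<Xi>. norm (w \<xi> * m (t * \<nu> \<xi>)) \<le> C * w \<xi>"
      using eventually_gt_at_top[of 0]
    proof eventually_elim
      case (elim t)
      have "\<bar>w \<xi> * m (t * \<nu> \<xi>)\<bar> \<le> C * w \<xi>" if "\<xi> \<in> \<Xi>" for \<xi>
        using \<nu>[OF that] elim by (intro abs_mult_le_mult b w) simp
      then show ?case by (simp add: AE_count_space)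
    qed
  qed auto
  then show ?thesis by (simp add: mult.commute)
qed

lemma dilate_mean_bound:
  assumes "0 < T"
  shows "integrable pos_lborel (\<lambda>s. G (T * s) * indicator {0<..1} s)" (is ?A)
    and "\<bar>LINT s|pos_lborel. G (T * s) * indicator {0<..1} s\<bar> \<le> C" (is ?B)
proof -
  have C0: "0 \<le> C" using C[of 1] by simp
  have b: "\<bar>G (T * s) * indicator {0<..1} s\<bar> \<le> C * indicator {0<..1} s" for s
    using C[of "T * s"] assms by (auto simp: indicator_def)
  have i: "integrable pos_lborel (\<lambda>s. C * indicat_real {0<..1} s)" using integrable_pos_indicator by simp
  have m: "(\<lambda>s. G (T * s) * indicator {0<..1} s) \<in> borel_measurable pos_lborel"
    by (intro pos_lborel_measurable) measurable
  show ?A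
    by (rule Bochner_Integration.integrable_bound[OF i m]) (use b C0 in \<open>auto intro!: AE_I2 simp: abs_mult\<close>)
  then have "\<bar>LINT s|pos_lborel. G (T * s) * indicator {0<..1} s\<bar> \<le> (LINT s|pos_lborel. C * indicat_real {0<..1} s)"
    by (rule integral_abs_le_integral[OF _ i]) (use b in auto)
  then show ?B using integral_pos_indicator by simp
qed

text \<open>A convergent bounded function has means with the same limit; this identifies the limit
  of \<open>G\<close> once its existence is known.\<close>

lemma tendsto_dilate_mean:
  assumes L: "(G \<longlongrightarrow> L) at_top"
  shows "((\<lambda>T. LINT s|pos_lborel. G (T * s) * indicator {0<..1} s) \<longlongrightarrow> L) at_top"
proof -
  have "((\<lambda>T. LINT s|pos_lborel. G (T * s) * indicator {0<..1} s) \<longlongrightarrow> (LINT s|pos_lborel. L * indicat_real {0<..1} s)) at_top"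
  proof (rule integral_dominated_convergence_at_top)
    show "(\<lambda>s. G (T * s) * indicator {0<..1} s) \<in> borel_measurable pos_lborel" for T
      by (intro pos_lborel_measurable) measurable
    show "(\<lambda>s. L * indicat_real {0<..1} s) \<in> borel_measurable pos_lborel"
      by (intro pos_lborel_measurable) measurable
    show "integrable pos_lborel (\<lambda>s. C * indicat_real {0<..1} s)" using integrable_pos_indicator by simp
    show "AE s in pos_lborel. ((\<lambda>T. G (T * s) * indicator {0<..1} s) \<longlongrightarrow> L * indicat_real {0<..1} s) at_top"
    proof (rule AE_I2, intro tendsto_mult tendsto_const)
      fix s assume "s \<in> space pos_lborel"
      then have "0 < s" by (simp add: space_restrict_space)
      then have "filterlim (\<lambda>T. T * s) at_top at_top"
        by (intro filterlim_at_top_mult_tendsto_pos[OF tendsto_const _ filterlim_ident])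
      then show "((\<lambda>T. G (T * s)) \<longlongrightarrow> L) at_top" by (rule filterlim_compose[OF L])
    qed
    show "\<forall>\<^sub>F T in at_top. AE s in pos_lborel. norm (G (T * s) * indicator {0<..1} s) \<le> C * indicat_real {0<..1} s"
      using eventually_gt_at_top[of 0]
    proof eventually_elim
      case (elim T)
      show ?case using C elim by (intro AE_I2) (auto simp: indicator_def)
    qed
  qed
  then show ?thesis using integral_pos_indicator by simp
qed

lemma weighted_dilates_measurable:
  "(\<lambda>r. LINT \<xi>|count_space \<Xi>. w \<xi> * G (r * \<nu> \<xi>)) \<in> borel_measurable borel"
proof -
  interpret S: sigma_finite_measure "count_space \<Xi>" by (rule sigma_finite_measure_count_space_countable[OF \<Xi>])
  have "(\<lambda>p. w (fst p) * G (snd p * \<nu> (fst p))) \<in> borel_measurable (count_space \<Xi> \<Otimes>\<^sub>M borel)"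
    by (intro measurable_pair_measure_countable1[OF \<Xi>]) simp
  from measurable_pair_swap[OF this]
  have "(\<lambda>(r, \<xi>). w \<xi> * G (r * \<nu> \<xi>)) \<in> borel_measurable (borel \<Otimes>\<^sub>M count_space \<Xi>)" by simp
  then show ?thesis by (rule S.borel_measurable_lebesgue_integral)
qed

text \<open>The substitution \<open>r = t * s\<close> and Fubini: averaging the dilate by
  \<open>\<nu> \<xi>\<close> up to \<open>t\<close> is averaging \<open>G\<close> up to
  \<open>t * \<nu> \<xi>\<close>.\<close>

lemma mean_weighted_dilates:
  assumes t: "0 < t"
  shows "1 / t * (LINT r:{0<..t}|lebesgue. LINT \<xi>|count_space \<Xi>. w \<xi> * G (r * \<nu> \<xi>))
    = (LINT \<xi>|count_space \<Xi>. w \<xi> * (LINT s|pos_lborel. G (t * \<nu> \<xi> * s) * indicator {0<..1} s))"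
proof -
  interpret S: sigma_finite_measure "count_space \<Xi>" by (rule sigma_finite_measure_count_space_countable[OF \<Xi>])
  interpret P: sigma_finite_measure pos_lborel by (rule sigma_finite_measure_restrict_space) (auto intro: lborel.sigma_finite_measure_axioms)
  interpret pair_sigma_finite "count_space \<Xi>" pos_lborel ..
  let ?\<Psi> = "\<lambda>r. LINT \<xi>|count_space \<Xi>. w \<xi> * G (r * \<nu> \<xi>)"
  note [measurable] = weighted_dilates_measurable
  let ?F = "\<lambda>\<xi> s. w \<xi> * (G (t * \<nu> \<xi> * s) * indicator {0<..1} s)"
  have int: "integrable (count_space \<Xi> \<Otimes>\<^sub>M pos_lborel) (\<lambda>(\<xi>, s). ?F \<xi> s)"
  proof (rule Fubini_integrable)
    show "(\<lambda>(\<xi>, s). ?F \<xi> s) \<in> borel_measurable (count_space \<Xi> \<Otimes>\<^sub>M pos_lborel)"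
    proof (intro measurable_pair_measure_countable1[OF \<Xi>])
      fix \<xi>
      have "?F \<xi> \<in> borel_measurable pos_lborel" by (intro pos_lborel_measurable) measurable
      then show "(\<lambda>s. case (\<xi>, s) of (\<xi>, s) \<Rightarrow> ?F \<xi> s) \<in> borel_measurable pos_lborel" unfolding prod.case .
    qed
    have Fi: "integrable pos_lborel (?F \<xi>)" if "\<xi> \<in> \<Xi>" for \<xi>
      using dilate_mean_bound(1)[of "t * \<nu> \<xi>"] t \<nu>[OF that] by simp
    then show "AE \<xi> in count_space \<Xi>. integrable pos_lborel (\<lambda>s. case (\<xi>, s) of (\<xi>, s) \<Rightarrow> ?F \<xi> s)"
      by (simp add: AE_count_space)
    have b: "norm (LINT s|pos_lborel. norm (?F \<xi> s)) \<le> norm (C * w \<xi>)" if \<xi>: "\<xi> \<in> \<Xi>" for \<xi>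
    proof -
      have C0: "0 \<le> C" using C[of 1] by simp
      have "(LINT s|pos_lborel. norm (?F \<xi> s)) \<le> (LINT s|pos_lborel. C * w \<xi> * indicat_real {0<..1} s)"
      proof (rule integral_mono)
        show "integrable pos_lborel (\<lambda>s. norm (?F \<xi> s))" using Fi[OF \<xi>] by simp
        fix s
        show "norm (?F \<xi> s) \<le> C * w \<xi> * indicat_real {0<..1} s"
          using abs_mult_le_mult[OF C[of "t * \<nu> \<xi> * s"] w(2)[of \<xi>]] t \<nu>[OF \<xi>]
          by (auto simp: indicator_def)
      qed (use integrable_pos_indicator in simp)
      then show ?thesis using integral_pos_indicator C0 w(2)[of \<xi>] by simp
    qed
    have "integrable (count_space \<Xi>) (\<lambda>\<xi>. LINT s|pos_lborel. norm (?F \<xi> s))"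
    proof (rule Bochner_Integration.integrable_bound)
      show "integrable (count_space \<Xi>) (\<lambda>\<xi>. C * w \<xi>)" using w(1) by simp
      show "AE \<xi> in count_space \<Xi>. norm (LINT s|pos_lborel. norm (?F \<xi> s)) \<le> norm (C * w \<xi>)"
        unfolding AE_count_space using b by blast
    qed simp
    then show "integrable (count_space \<Xi>) (\<lambda>\<xi>. LINT s|pos_lborel. norm (case (\<xi>, s) of (\<xi>, s) \<Rightarrow> ?F \<xi> s))"
      unfolding prod.case .
  qed
  have "(LINT r:{0<..t}|lebesgue. ?\<Psi> r) = (LINT r|lborel. indicator {0<..t} r *\<^sub>R ?\<Psi> r)"
    unfolding set_lebesgue_integral_def by (rule integral_completion) measurable
  also have "\<dots> = \<bar>t\<bar> *\<^sub>R (LINT s|lborel. indicator {0<..t} (0 + t * s) *\<^sub>R ?\<Psi> (0 + t * s))"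
    using t by (intro lborel_integral_real_affine) auto
  also have "(\<lambda>s. indicator {0<..t} (0 + t * s) *\<^sub>R ?\<Psi> (0 + t * s)) = (\<lambda>s. indicator {0<..} s *\<^sub>R (?\<Psi> (t * s) * indicator {0<..1} s))"
    using t by (auto simp: indicator_def zero_less_mult_iff)
  also have "(LINT s|lborel. indicator {0<..} s *\<^sub>R (?\<Psi> (t * s) * indicator {0<..1} s)) = (LINT s|pos_lborel. ?\<Psi> (t * s) * indicator {0<..1} s)"
    by (simp add: integral_restrict_space)
  also have "\<dots> = (LINT s|pos_lborel. LINT \<xi>|count_space \<Xi>. ?F \<xi> s)"
  proof (intro Bochner_Integration.integral_cong refl)
    fix s
    have "?\<Psi> (t * s) * indicator {0<..1} s = (LINT \<xi>|count_space \<Xi>. w \<xi> * G (t * s * \<nu> \<xi>) * indicator {0<..1} s)"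
      by (rule integral_mult_left_zero[symmetric])
    also have "\<dots> = (LINT \<xi>|count_space \<Xi>. ?F \<xi> s)"
      by (intro Bochner_Integration.integral_cong refl) (simp only: mult.assoc mult.commute[of s])
    finally show "?\<Psi> (t * s) * indicator {0<..1} s = (LINT \<xi>|count_space \<Xi>. ?F \<xi> s)" .
  qed
  also have "\<dots> = (LINT \<xi>|count_space \<Xi>. LINT s|pos_lborel. ?F \<xi> s)"
    by (rule Fubini_integral[OF int])
  finally show ?thesis using t by simp
qed

end

section \<open>From Lebesgue measurable to Borel sets\<close>

lemma negligible_matrix_image:
  fixes A :: "real^'n^'n"
  assumes "negligible S"
  shows "negligible ((*v) A ` S)"
  by (rule negligible_differentiable_image_negligible[OF order_refl assms])
     (auto intro!: linear_imp_differentiable_on)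

text \<open>Measurability of \<open>f\<close> is derived, not assumed: on the exceptional null set
  every preimage is measurable by completeness of Lebesgue measure.\<close>

lemma integral_lebesgue_spike:
  fixes f g :: "'a::euclidean_space \<Rightarrow> real"
  assumes S: "negligible S" and g: "g \<in> borel_measurable lebesgue" and eq: "\<And>x. x \<notin> S \<Longrightarrow> f x = g x"
  shows "integral\<^sup>L lebesgue f = integral\<^sup>L lebesgue g"
proof (rule integral_cong_AE)
  show "AE x in lebesgue. f x = g x"
    using S eq by (intro AE_I'[of S]) (auto simp: negligible_iff_null_sets)
  show "f \<in> borel_measurable lebesgue"
  proof (rule measurableI)
    fix B :: "real set" assume B: "B \<in> sets borel"
    have "f -` B \<inter> S \<in> sets lebesgue"
      by (rule negligible_imp_sets[OF negligible_subset[OF S]]) auto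
    moreover have "g -` B - S \<in> sets lebesgue"
      using measurable_sets[OF g B] negligible_imp_sets[OF S] by auto
    moreover have "f -` B \<inter> space lebesgue = (f -` B \<inter> S) \<union> (g -` B - S)"
      using eq by auto
    ultimately show "f -` B \<inter> space lebesgue \<in> sets lebesgue" by (simp only: sets.Un)
  qed simp
qed (rule g)

lemma borel_core:
  fixes D :: "'a::euclidean_space set"
  assumes "bounded D" "D \<in> sets lebesgue"
  obtains C N where "C \<in> sets borel" "bounded C" "negligible N" "D = C \<union> N"
proof -
  obtain C N where C: "fsigma C" "N \<in> null_sets lebesgue" "C \<union> N = D"
    using lebesgue_set_almost_fsigma[OF assms(2)] by metis
  have "C \<in> sets borel" using C(1)
    by (cases rule: fsigma.cases) (auto intro!: sets.countable_UN borel_closed)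
  moreover have "bounded C" using assms(1) C(3) by (auto intro: bounded_subset)
  ultimately show thesis using that C by (auto simp: negligible_iff_null_sets)
qed

text \<open>For fixed \<open>x\<close> the integrands agree off \<open>N\<close> and its translate
  by \<open>x\<close>.\<close>

lemma covariogram_spike:
  fixes C N :: "'a::euclidean_space set"
  assumes C: "C \<in> sets borel" and N: "negligible N"
  shows "covariogram (C \<union> N) x = covariogram C x"
  unfolding covariogram_def
proof (rule integral_lebesgue_spike)
  show "negligible (N \<union> (+) x ` N)" using N by (intro negligible_Un negligible_translation)
  have [measurable]: "C \<in> sets borel" by (rule C)
  have "(\<lambda>y. indicat_real C y * indicat_real C (y - x)) \<in> borel_measurable lborel" by measurable
  then show "(\<lambda>y. indicat_real C y * indicat_real C (y - x)) \<in> borel_measurable lebesgue"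
    by (rule measurable_completion)
  fix y assume "y \<notin> N \<union> (+) x ` N"
  moreover have "y = x + (y - x)" by simp
  ultimately have "y \<notin> N" "y - x \<notin> N" by (auto simp: image_iff)
  then show "indicat_real (C \<union> N) y * indicat_real (C \<union> N) (y - x) = indicat_real C y * indicat_real C (y - x)"
    by (simp add: indicator_def)
qed

lemma SO_image_borel:
  assumes "M \<in> SO" "C \<in> sets borel"
  shows "(\<lambda>y. M *v y) ` C \<in> sets borel"
proof -
  have "(\<lambda>y. M *v y) ` C = (*v) (transpose M) -` C"
    by (intro set_eqI) (simp add: SO_image_iff[OF assms(1)])
  then show ?thesis
    using measurable_sets[OF borel_measurable_matrix_vector_mult assms(2), of "transpose M"] by simp
qed

lemma iso_covariogram_spike:
  assumes haar: "is_haar_prob_SO \<mu>" and C: "C \<in> sets borel" and N: "negligible N"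
  shows "iso_covariogram \<mu> (C \<union> N) = iso_covariogram \<mu> C"
proof
  fix u
  show "iso_covariogram \<mu> (C \<union> N) u = iso_covariogram \<mu> C u"
    unfolding iso_covariogram_def image_Un
    by (intro Bochner_Integration.integral_cong refl covariogram_spike SO_image_borel C negligible_matrix_image N)
       (simp add: space_haar[OF haar])
qed

text \<open>A point \<open>y\<close> of \<open>N\<close> hits the lattice point \<open>t\<close>
  only for \<open>x = t - r *\<^sub>R (M *v y)\<close>. These positions form a countable union of
  null sets, one for each \<open>t\<close>.\<close>

lemma lattice_discrepancy_spike:
  fixes A M :: "real^'n^'n" and C N :: "(real^'n) set"
  assumes A: "invertible A" and C: "bounded C" "C \<in> sets borel" and N: "negligible N"
    and M: "M \<in> SO" and r: "0 < r"
  defines "\<alpha> \<equiv> spatial_intensity A"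
  shows "(LINT x:fundamental_region A|lebesgue.
      (lattice_discrepancy A (C \<union> N) r M x)\<^sup>2 * \<alpha>)
    = (LINT x:fundamental_region A|lebesgue.
      (lattice_discrepancy A C r M x)\<^sup>2 * \<alpha>)"
proof -
  have rN: "negligible ((\<lambda>y. r *\<^sub>R y) ` N)"
    using negligible_matrix_image[OF N, of "r *\<^sub>R mat 1"] by (simp add: scaleR_matrix_vector_assoc[symmetric])
  have ms: "measure lebesgue ((\<lambda>y. r *\<^sub>R y) ` (C \<union> N)) = measure lebesgue ((\<lambda>y. r *\<^sub>R y) ` C)"
    unfolding image_Un
    using rN scaleR_image_borel[OF r C(2)] by (intro measure_Un_null_set) (auto simp: negligible_iff_null_sets)
  have cl: "countable (lattice_of A)"
    unfolding lattice_of_def by (intro countable_image countable_int_vectors)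
  let ?S = "\<Union>t\<in>lattice_of A. (\<lambda>y. t - r *\<^sub>R (M *v y)) ` N"
  have "negligible ((\<lambda>y. t - r *\<^sub>R (M *v y)) ` N)" for t
  proof -
    have "negligible ((\<lambda>y. (- r) *\<^sub>R (M *v y)) ` N)"
    proof -
      have "(*v) ((- r) *\<^sub>R M) = (\<lambda>y. (- r) *\<^sub>R (M *v y))"
        by (rule ext) (rule scaleR_matrix_vector_assoc[symmetric])
      then show ?thesis using negligible_matrix_image[OF N, of "(- r) *\<^sub>R M"] by (simp only:)
    qed
    then have "negligible ((+) t ` ((\<lambda>y. (- r) *\<^sub>R (M *v y)) ` N))"
      by (rule negligible_translation)
    then show ?thesis by (simp add: image_image)
  qed
  then have S: "negligible ?S"
    using cl by (intro negligible_countable_Union) auto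
  show ?thesis
    unfolding set_lebesgue_integral_def
  proof (rule integral_lebesgue_spike[OF S])
    show "(\<lambda>x. indicat_real (fundamental_region A) x *\<^sub>R ((lattice_discrepancy A C r M x)\<^sup>2 * \<alpha>)) \<in> borel_measurable lebesgue"
      using rotated_lattice_count_measurable[OF A C M r, folded \<alpha>_def]
      by (intro measurable_completion) simp
    fix x assume x: "x \<notin> ?S"
    have "(\<lambda>y. r *\<^sub>R (M *v y) + x) ` N \<inter> lattice_of A = {}"
    proof (rule ccontr)
      assume "(\<lambda>y. r *\<^sub>R (M *v y) + x) ` N \<inter> lattice_of A \<noteq> {}"
      then obtain y where y: "y \<in> N" "r *\<^sub>R (M *v y) + x \<in> lattice_of A" by auto
      have "x = (r *\<^sub>R (M *v y) + x) - r *\<^sub>R (M *v y)" by simp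
      then show False using x y by blast
    qed
    then have "(\<lambda>y. r *\<^sub>R (M *v y) + x) ` (C \<union> N) \<inter> lattice_of A = (\<lambda>y. r *\<^sub>R (M *v y) + x) ` C \<inter> lattice_of A"
      unfolding image_Un by blast
    then have "lattice_discrepancy A (C \<union> N) r M x = lattice_discrepancy A C r M x"
      unfolding lattice_discrepancy_def ms by simp
    then show "indicat_real (fundamental_region A) x *\<^sub>R ((lattice_discrepancy A (C \<union> N) r M x)\<^sup>2 * \<alpha>)
      = indicat_real (fundamental_region A) x *\<^sub>R ((lattice_discrepancy A C r M x)\<^sup>2 * \<alpha>)" by simp
  qed
qed

theorem theorem2p7:
  fixes A :: "real^'n^'n"
    and D :: "(real^'n) set"
    and \<mu> :: "(real^'n^'n) measure"
    and \<gamma>' :: real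
    and \<Phi> :: "real \<Rightarrow> real"
  defines "d \<equiv> CARD('n)"
    and "T \<equiv> lattice_of A"
    and "\<alpha> \<equiv> spatial_intensity A"
  assumes haar: "is_haar_prob_SO \<mu>"
    and regular: "invertible A"
    and D: "bounded D" "D \<in> sets lebesgue"
    and deriv: "(iso_covariogram \<mu> D has_real_derivative \<gamma>') (at_right 0)"
    \<comment> \<open>\<open>\<Phi> r\<close> is the unique solution of its defining equation, which excludes null sets \<open>D\<close>.
        The factor \<open>\<alpha>\<^sup>2\<close> is forced by Parseval's identity: the Fourier coefficients of the
        number of lattice points are \<open>\<alpha>\<close> times the Fourier transform of the indicator of the set.\<close>
    and \<Phi>: "\<And>r y. 0 < r \<Longrightarrow>
      (LINT M|\<mu>. (LINT x:fundamental_region A|lebesgue.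
          (real (card ((\<lambda>y. r *\<^sub>R (M *v y) + x) ` D \<inter> T))
             - \<alpha> * measure lebesgue ((\<lambda>y. r *\<^sub>R y) ` D))\<^sup>2 * \<alpha>))
        = \<alpha>\<^sup>2 * (- \<gamma>' / (2 * pi\<^sup>2 * unit_ball_vol (real (d - 1))))
            * (\<Sum>\<^sub>\<infinity>\<xi>\<in>dual_lattice_of A - {0}. norm \<xi> powr (- real d - 1)) * y * r ^ (d - 1)
      \<longleftrightarrow> y = \<Phi> r"
    and ft_measurable:
      "(\<lambda>\<rho>. of_real \<rho> ^ (d + 1) * iso_covariogram_ft \<mu> D \<rho>) \<in> borel_measurable (lebesgue_on {0<..})"
    and ft_bounded:
      "bounded ((\<lambda>\<rho>. of_real \<rho> ^ (d + 1) * iso_covariogram_ft \<mu> D \<rho>) ` {0<..})"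
  shows "bounded (\<Phi> ` {0<..})
    \<and> ((\<lambda>t. 1 / t * (LINT s:{0<..t}|lebesgue. \<Phi> s)) \<longlongrightarrow> 1) at_top
    \<and> ((\<exists>L. ((\<lambda>\<rho>. of_real \<rho> ^ (d + 1) * iso_covariogram_ft \<mu> D \<rho>) \<longlongrightarrow> L) at_top)
         \<longrightarrow> (\<Phi> \<longlongrightarrow> 1) at_top)"
proof -
  obtain C N where C: "C \<in> sets borel" "bounded C" and N: "negligible N" and DCN: "D = C \<union> N"
    using borel_core[OF D] by blast
  have iso: "iso_covariogram \<mu> D = iso_covariogram \<mu> C"
    unfolding DCN by (rule iso_covariogram_spike[OF haar C(1) N])
  have ft: "iso_covariogram_ft \<mu> D = iso_covariogram_ft \<mu> C"
    unfolding iso_covariogram_ft_def[abs_def] iso ..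
  \<comment> \<open>A real profile on the whole line, read off along a fixed axis; the index
    \<open>undefined\<close> stands for an arbitrary one. Borel measurability is then immediate, and
    for positive arguments \<open>h\<close> is the transform in the statement.\<close>
  define h where "h \<rho> = rotation_average \<mu> (spectral_density C) (\<rho> *\<^sub>R axis undefined 1)" for \<rho>
  define G where "G \<rho> = \<rho> ^ (d + 1) * h \<rho>" for \<rho>
  have avg_m: "rotation_average \<mu> (spectral_density C) \<in> borel_measurable borel"
    by (rule rotation_average_measurable[OF haar spectral_density_measurable[OF haar C(2,1)]])
  have hm[measurable]: "h \<in> borel_measurable borel"
    unfolding h_def[abs_def] by (rule measurable_compose[OF _ avg_m]) simp
  have Gm: "G \<in> borel_measurable borel" unfolding G_def[abs_def] by measurable
  have hn: "h (norm \<xi>) = rotation_average \<mu> (spectral_density C) \<xi>" for \<xi> :: "real^'n"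
    unfolding h_def
    by (rule rotation_average_radial[OF haar spectral_density_measurable[OF haar C(2,1)] spectral_density_uminus[OF haar C(2,1)]])
       simp
  have ft_h: "iso_covariogram_ft \<mu> D \<rho> = of_real (h \<rho>)" if "0 < \<rho>" for \<rho>
  proof -
    let ?\<xi> = "\<rho> *\<^sub>R axis undefined 1 :: real^'n"
    have n: "norm ?\<xi> = \<rho>" using that by simp
    show ?thesis
      using iso_covariogram_ft_eq[OF haar C(2,1), of ?\<xi>] hn[of ?\<xi>] unfolding n ft by simp
  qed
  have ftG: "of_real \<rho> ^ (d + 1) * iso_covariogram_ft \<mu> D \<rho> = of_real (G \<rho>)" if "0 < \<rho>" for \<rho>
    by (simp add: ft_h[OF that] G_def)
  obtain K where K: "\<And>\<rho>. 0 < \<rho> \<Longrightarrow> norm (of_real \<rho> ^ (d + 1) * iso_covariogram_ft \<mu> D \<rho>) \<le> K"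
    using ft_bounded unfolding bounded_iff by auto
  have GK: "\<bar>G \<rho>\<bar> \<le> K" if "0 < \<rho>" for \<rho>
    using K[OF that] unfolding ftG[OF that] by simp
  define c where "c = - \<gamma>' / (2 * pi\<^sup>2 * unit_ball_vol (real (d - 1)))"
  define w where "w \<xi> = norm \<xi> powr (- real d - 1)" for \<xi> :: "real^'n"
  let ?\<Xi> = "dual_lattice_of A - {0}"
  define W where "W = (\<Sum>\<^sub>\<infinity>\<xi>\<in>?\<Xi>. w \<xi>)"
  let ?Psi = "\<lambda>r. LINT \<xi>|count_space ?\<Xi>. w \<xi> * G (r * norm \<xi>)"
  have \<alpha>: "\<alpha> \<noteq> 0"
    using regular invertible_det_nz unfolding \<alpha>_def spatial_intensity_def by auto
  have d: "0 < d" by (simp add: d_def)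
  have \<Xi>: "countable ?\<Xi>" using countable_dual_lattice by (rule countable_subset[rotated]) auto
  let ?V = "\<lambda>D r. LINT M|\<mu>. (LINT x:fundamental_region A|lebesgue. (lattice_discrepancy A D r M x)\<^sup>2 * \<alpha>)"
  have lhs: "?V D r = \<alpha>\<^sup>2 * r ^ (d - 1) * ?Psi r" if r: "0 < r" for r
  proof -
    have "?V D r = ?V C r"
      unfolding DCN \<alpha>_def
      by (intro Bochner_Integration.integral_cong refl lattice_discrepancy_spike[OF regular C(2,1) N _ r])
         (simp add: space_haar[OF haar])
    also have "\<dots> = (LINT \<xi>|count_space ?\<Xi>. \<alpha>\<^sup>2 * r ^ (2 * d) * rotation_average \<mu> (spectral_density C) (r *\<^sub>R \<xi>))"
      unfolding \<alpha>_def d_def by (rule averaged_lattice_variance[OF haar regular C(2,1) r])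
    \<comment> \<open>Since \<open>d > 0\<close>, the power \<open>2 * d\<close> splits as
      \<open>(d - 1) + (d + 1)\<close>. The second part completes \<open>h\<close> to
      \<open>G\<close>, and the missing power of \<open>norm \<xi>\<close> is supplied and
      compensated by the weight.\<close>
    also have "\<dots> = (LINT \<xi>|count_space ?\<Xi>. \<alpha>\<^sup>2 * r ^ (d - 1) * (w \<xi> * G (r * norm \<xi>)))"
    proof (intro Bochner_Integration.integral_cong refl)
      fix \<xi> assume "\<xi> \<in> space (count_space ?\<Xi>)"
      then have x: "0 < norm \<xi>" by simp
      have w: "w \<xi> = inverse (norm \<xi> ^ (d + 1))"
      proof -
        have "- real d - 1 = - real (d + 1)" by simp
        then have "w \<xi> = norm \<xi> powr (- real (d + 1))" by (simp only: w_def)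
        also have "\<dots> = inverse (norm \<xi> ^ (d + 1))"
          unfolding powr_minus powr_realpow[OF x] ..
        finally show ?thesis .
      qed
      have "rotation_average \<mu> (spectral_density C) (r *\<^sub>R \<xi>) = h (r * norm \<xi>)"
        using hn[of "r *\<^sub>R \<xi>"] r by simp
      moreover have "r ^ (2 * d) = r ^ (d - 1) * r ^ (d + 1)"
        unfolding power_add[symmetric] using d by (intro arg_cong[of _ _ "\<lambda>n. r ^ n"]) simp
      moreover have "w \<xi> * G (r * norm \<xi>) = r ^ (d + 1) * h (r * norm \<xi>)"
      proof -
        have "norm \<xi> ^ (d + 1) \<noteq> 0" using x by simp
        then show ?thesis unfolding w G_def power_mult_distrib by (simp add: field_simps del: power_Suc)
      qed
      ultimately show "\<alpha>\<^sup>2 * r ^ (2 * d) * rotation_average \<mu> (spectral_density C) (r *\<^sub>R \<xi>) = \<alpha>\<^sup>2 * r ^ (d - 1) * (w \<xi> * G (r * norm \<xi>))"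
        by (simp only: mult.assoc)
    qed
    finally show ?thesis by simp
  qed
  have def: "\<alpha>\<^sup>2 * r ^ (d - 1) * ?Psi r = \<alpha>\<^sup>2 * c * W * y * r ^ (d - 1) \<longleftrightarrow> y = \<Phi> r" if "0 < r" for r y
    using \<Phi>[OF that, of y]
    unfolding T_def \<alpha>_def lattice_discrepancy_def[symmetric] unfolding \<alpha>_def[symmetric] lhs[OF that] c_def[symmetric] w_def[symmetric] W_def[symmetric] .
  have cW: "c * W \<noteq> 0"
    \<comment> \<open>This also yields the convergence of the lattice sum, as divergent sums have the value 0.\<close>
  proof
    assume 0: "c * W = 0"
    have "\<alpha>\<^sup>2 * 1 ^ (d - 1) * ?Psi 1 = 0" using def[of 1 "\<Phi> 1"] 0 by auto
    then have "\<Phi> 1 + 1 = \<Phi> 1" using def[of 1 "\<Phi> 1 + 1"] 0 by auto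
    then show False by simp
  qed
  have Phi: "\<Phi> r = ?Psi r / (c * W)" if "0 < r" for r
    using def[OF that, of "?Psi r / (c * W)"] cW by (simp add: mult.assoc)
  have w0: "0 \<le> w \<xi>" for \<xi> by (simp add: w_def)
  have "w summable_on ?\<Xi>" using cW infsum_not_exists[of w ?\<Xi>] by (auto simp: W_def)
  then have "(w has_sum W) ?\<Xi>" unfolding W_def by (rule has_sum_infsum)
  note w = has_sum_count_space[OF this w0]
  have \<nu>: "0 < norm \<xi>" if "\<xi> \<in> ?\<Xi>" for \<xi> using that by simp
  note weighted = Gm GK \<Xi> w(1) w0 \<nu>
  have mean: "((\<lambda>T. LINT s|pos_lborel. G (T * s) * indicator {0<..1} s) \<longlongrightarrow> c) at_top"
  proof -
    have gi: "integrable lborel (\<lambda>x. iso_covariogram \<mu> C (norm (x::real^'n)))"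
      by (rule iso_covariogram_fourier(1)[OF haar C(2,1)])
    have gB: "\<bar>iso_covariogram \<mu> C u\<bar> \<le> measure lborel C" if "0 \<le> u" for u
    proof -
      have "norm (u *\<^sub>R axis undefined 1 :: real^'n) = u" using that by simp
      then show ?thesis
        using iso_covariogram_eq[OF haar C(2,1), of "u *\<^sub>R axis undefined 1"]
          rotation_average_bound[OF haar covariogram_measurable[OF C(2,1)] covariogram_bound[OF C(2,1)], of "u *\<^sub>R axis undefined 1"]
        by simp
    qed
    have ftc: "complex_of_real (h (norm \<xi>)) = (LINT x|lborel. of_real (iso_covariogram \<mu> C (norm x)) * phase x \<xi>)"
      for \<xi> :: "real^'n"
      unfolding hn iso_covariogram_fourier(2)[OF haar C(2,1)] ..
    have "\<bar>\<rho> ^ (DIM(real^'n) + 1) * h \<rho>\<bar> \<le> K" if "0 < \<rho>" for \<rho>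
      using GK[OF that] by (simp add: G_def d_def)
    from radial_fourier_mean[OF gi gB hm ftc deriv[unfolded iso] this]
    show ?thesis by (simp add: G_def[abs_def] c_def d_def)
  qed
  have "bounded (\<Phi> ` {0<..})"
    unfolding bounded_iff
  proof (intro exI ballI)
    fix y assume "y \<in> \<Phi> ` {0<..}"
    then obtain r where r: "0 < r" "y = \<Phi> r" by auto
    show "norm y \<le> K * W / \<bar>c * W\<bar>"
      using weighted_dilates_bound[OF weighted r(1)] unfolding r(2) Phi[OF r(1)] w(2)
      by (simp add: divide_right_mono)
  qed
  moreover have "((\<lambda>t. 1 / t * (LINT s:{0<..t}|lebesgue. \<Phi> s)) \<longlongrightarrow> 1) at_top"
  proof -
    let ?m = "\<lambda>T. LINT s|pos_lborel. G (T * s) * indicator {0<..1} s"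
    \<comment> \<open>The mean of \<Phi> up to \<open>t\<close> is the weighted lattice mean of the
      means of \<open>G\<close> up to \<open>t * norm \<xi>\<close>. These converge to
      \<open>c\<close> and inherit the bound of \<open>G\<close>.\<close>
    have "((\<lambda>t. (LINT \<xi>|count_space ?\<Xi>. w \<xi> * ?m (t * norm \<xi>)) / (c * W)) \<longlongrightarrow> c * W / (c * W)) at_top"
      using tendsto_weighted_dilates[OF weighted mean dilate_mean_bound(2)[OF weighted]] cW
      unfolding w(2) by (intro tendsto_divide tendsto_const) auto
    moreover have "eventually (\<lambda>t. (LINT \<xi>|count_space ?\<Xi>. w \<xi> * ?m (t * norm \<xi>)) / (c * W) = 1 / t * (LINT s:{0<..t}|lebesgue. \<Phi> s)) at_top"
      using eventually_gt_at_top[of 0]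
    proof eventually_elim
      case (elim t)
      have "(LINT s:{0<..t}|lebesgue. \<Phi> s) = (LINT s:{0<..t}|lebesgue. ?Psi s / (c * W))"
        by (rule set_lebesgue_integral_cong) (auto simp: Phi)
      also have "\<dots> = (LINT s:{0<..t}|lebesgue. ?Psi s) / (c * W)"
        by (rule set_integral_divide_zero)
      finally show ?case
        using mean_weighted_dilates[OF weighted elim] by simp
    qed
    ultimately have "((\<lambda>t. 1 / t * (LINT s:{0<..t}|lebesgue. \<Phi> s)) \<longlongrightarrow> c * W / (c * W)) at_top"
      by (rule Lim_transform_eventually)
    then show ?thesis using cW by simp
  qed
  moreover have "(\<Phi> \<longlongrightarrow> 1) at_top" if "((\<lambda>\<rho>. of_real \<rho> ^ (d + 1) * iso_covariogram_ft \<mu> D \<rho>) \<longlongrightarrow> L) at_top" for L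
  proof -
    have "((\<lambda>\<rho>. Re (of_real \<rho> ^ (d + 1) * iso_covariogram_ft \<mu> D \<rho>)) \<longlongrightarrow> Re L) at_top"
      by (intro tendsto_Re that)
    moreover have "eventually (\<lambda>\<rho>. Re (of_real \<rho> ^ (d + 1) * iso_covariogram_ft \<mu> D \<rho>) = G \<rho>) at_top"
      using eventually_gt_at_top[of 0]
    proof eventually_elim
      case (elim \<rho>)
      show ?case unfolding ftG[OF elim] by simp
    qed
    ultimately have GL: "(G \<longlongrightarrow> Re L) at_top" by (rule Lim_transform_eventually)
    \<comment> \<open>A limit of \<open>G\<close> is also the limit of its means, which is
      \<open>c\<close>; so the value of the limit need not be prescribed.\<close>
    have "Re L = c"
      using tendsto_unique[OF _ tendsto_dilate_mean[OF weighted GL] mean] by simp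
    then have "((\<lambda>t. ?Psi t / (c * W)) \<longlongrightarrow> c * W / (c * W)) at_top"
      using tendsto_weighted_dilates[OF weighted GL GK] cW
      unfolding w(2) by (intro tendsto_divide tendsto_const) auto
    moreover have "eventually (\<lambda>t. ?Psi t / (c * W) = \<Phi> t) at_top"
      using eventually_gt_at_top[of 0] by eventually_elim (simp add: Phi)
    ultimately have "(\<Phi> \<longlongrightarrow> c * W / (c * W)) at_top" by (rule Lim_transform_eventually)
    then show ?thesis using cW by simp
  qed
  ultimately show ?thesis by blast
qed

end
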